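(* Let $v$ be a flow on a connected compact surface $S$. The orbit space $S/v$ is $T_2$ (Hausdorff) if and only if every point of $S$ is closed and the singular point set either is the whole surface $S$ or consists of at most two centers.
   Context: A surface is a two-dimensional paracompact manifold, possibly with boundary. A flow is a continuous $\mathbb{R}$-action $v\colon\mathbb{R}\times S\to S$, $v_t=v(t,\cdot)$. The orbit space $S/v$ is the quotient of $S$ by the relation $x\sim y$ iff $x,y$ lie on the same orbit. A point $x$ is singular if $v_t(x)=x$ for all $t$, periodic if it is not singular and $v_T(x)=x$ for some $T>0$, and closed if it is singular or periodic. A singular point $x$ is a center if it has an open neighbourhood $U$ such that $v|_U$ is topologically equivalent (via a homeomorphism mapping orbits to orbits preserving time orientation) to the flow generated by the vector field $(-y,x)$ on the open unit disk in $\mathbb{R}^2$. *)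

theory Defs
  imports "HOL-Analysis.Analysis"
begin

definition paracompact_space :: "'a topology \<Rightarrow> bool" where
  "paracompact_space X \<longleftrightarrow>
     (\<forall>\<U>. (\<forall>U\<in>\<U>. openin X U) \<and> \<Union>\<U> = topspace X \<longrightarrow>
        (\<exists>\<V>. (\<forall>V\<in>\<V>. openin X V) \<and> \<Union>\<V> = topspace X \<and> locally_finite_in X \<V> \<and>
              (\<forall>V\<in>\<V>. \<exists>U\<in>\<U>. V \<subseteq> U)))"

definition half_plane :: "complex set" where
  "half_plane = {z. Im z \<ge> 0}"

definition surface :: "'a topology \<Rightarrow> bool" where
  "surface X \<longleftrightarrow> Hausdorff_space X \<and> paracompact_space X \<and>
     (\<forall>x\<in>topspace X. \<exists>U W. openin X U \<and> x \<in> U \<and>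
        openin (top_of_set half_plane) W \<and>
        subtopology X U homeomorphic_space top_of_set W)"

definition flow :: "'a topology \<Rightarrow> (real \<Rightarrow> 'a \<Rightarrow> 'a) \<Rightarrow> bool" where
  "flow X v \<longleftrightarrow>
     continuous_map (prod_topology euclideanreal X) X (\<lambda>(t, x). v t x) \<and>
     (\<forall>x\<in>topspace X. v 0 x = x) \<and>
     (\<forall>x\<in>topspace X. \<forall>s t. v (s + t) x = v s (v t x))"

definition orbit :: "(real \<Rightarrow> 'a \<Rightarrow> 'a) \<Rightarrow> 'a \<Rightarrow> 'a set" where
  "orbit v x = range (\<lambda>t. v t x)"

definition singular_point :: "(real \<Rightarrow> 'a \<Rightarrow> 'a) \<Rightarrow> 'a \<Rightarrow> bool" where
  "singular_point v x \<longleftrightarrow> (\<forall>t. v t x = x)"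

definition periodic_point :: "(real \<Rightarrow> 'a \<Rightarrow> 'a) \<Rightarrow> 'a \<Rightarrow> bool" where
  "periodic_point v x \<longleftrightarrow> \<not> singular_point v x \<and> (\<exists>T>0. v T x = x)"

definition closed_point :: "(real \<Rightarrow> 'a \<Rightarrow> 'a) \<Rightarrow> 'a \<Rightarrow> bool" where
  "closed_point v x \<longleftrightarrow> singular_point v x \<or> periodic_point v x"

definition singular_set :: "'a topology \<Rightarrow> (real \<Rightarrow> 'a \<Rightarrow> 'a) \<Rightarrow> 'a set" where
  "singular_set X v = {x \<in> topspace X. singular_point v x}"

definition orbit_space :: "'a topology \<Rightarrow> (real \<Rightarrow> 'a \<Rightarrow> 'a) \<Rightarrow> 'a set topology" where
  "orbit_space X v = topology (\<lambda>\<U>. \<U> \<subseteq> orbit v ` topspace X \<and> openin X (\<Union>\<U> \<inter> topspace X))"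

text \<open>The flow generated by the vector field (-y, x) on the plane, viewed in
  the complex plane: rotation z \<mapsto> e^{it} z.\<close>
definition rot_flow :: "real \<Rightarrow> complex \<Rightarrow> complex" where
  "rot_flow t z = exp (\<i> * of_real t) * z"

text \<open>A singular point x is a center if it has an open invariant neighbourhood U
  and a homeomorphism h of U onto the open unit disk mapping orbits onto orbits
  preserving the time orientation: along each orbit, h conjugates the flow to the
  rotation flow up to an increasing reparametrisation of time.\<close>
definition center :: "'a topology \<Rightarrow> (real \<Rightarrow> 'a \<Rightarrow> 'a) \<Rightarrow> 'a \<Rightarrow> bool" where
  "center X v x \<longleftrightarrow> x \<in> topspace X \<and> singular_point v x \<and>
     (\<exists>U h. openin X U \<and> x \<in> U \<and> (\<forall>y\<in>U. \<forall>t. v t y \<in> U) \<and>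
        homeomorphic_map (subtopology X U) (top_of_set (ball 0 1)) h \<and>
        (\<forall>y\<in>U. \<exists>\<tau>. strict_mono \<tau> \<and> surj \<tau> \<and>
              (\<forall>t. h (v t y) = rot_flow (\<tau> t) (h y))))"

end

theory Submission
  imports Defs
begin

text \<open>
  If the orbit space is Hausdorff, all orbits are compact, hence all points are closed, and every orbit
  has arbitrarily small saturated neighbourhoods. Near a nonsingular point the flow has a transversal
  which, by invariance of domain, is an arc. When all orbits are closed, the return map of a periodic
  orbit on such an arc is the identity or an involution near its fixed point, so a periodic orbit has
  either a two-sided collar of periodic orbits or a collar which it does not separate. It follows
  that the relation ``the orbit of \<open>y\<close> separates \<open>a\<close> from \<open>b\<close>'' is locally constant in
  the periodic point \<open>y\<close>. For singular points \<open>a\<close> and \<open>b\<close> the periodic points whose orbits separate them form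
  an open and closed subset of the connected set \<open>X - {a, b}\<close>; so if there is one such
  point, then \<open>a\<close> and \<open>b\<close> are the only singular points.

  A small periodic orbit near a singular point is a Jordan curve in a chart. Its interior is invariant
  and contains a singular point, because a periodic orbit with minimal interior cannot
  exist. Thus there are at most two singular points, unless all points are singular. Around an
  isolated singular point the nearby periodic orbits are nested Jordan curves; a strictly monotone
  continuous function of their interiors parametrises the orbits, and a section over this parameter
  together with the period yields polar coordinates in which the flow is a rotation.

  Conversely, the description of the collars of periodic orbits and the small discs around the
  centers provide saturated neighbourhoods that separate distinct orbits.
\<close>

section \<open>Flows on compact surfaces\<close>

text \<open>The flow is only continuous, so there is neither a vector field nor a smooth
  transversal: cross-sections are level sets of a function that increases along orbits near a given
  nonsingular point. The surface may have a boundary, hence the charts into the half plane and the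
  half-open transversals. In the nontrivial case a singular point on the boundary is ruled out
  because singular points lie in the interior of a Jordan curve inside a chart, and that interior is
  open in the plane. The property \<open>saturated_nbhds\<close> is the hinge of both directions:
  compactness extracts it from the Hausdorff property, and collars and centers supply it conversely.
  Separation by an orbit, a notion of the whole surface, also describes the Jordan interior of an
  orbit independently of the chart. So the local constancy of separation controls how that interior
  varies with the orbit.\<close>

lemma floor_mult_bounds:
  fixes r t :: real
  assumes "t > 0" shows "of_int \<lfloor>r / t\<rfloor> * t \<le> r" "r < of_int \<lfloor>r / t\<rfloor> * t + t"
proof -
  have "of_int \<lfloor>r / t\<rfloor> \<le> r / t" "r / t < of_int \<lfloor>r / t\<rfloor> + 1" by linarith+
  then show "of_int \<lfloor>r / t\<rfloor> * t \<le> r" "r < of_int \<lfloor>r / t\<rfloor> * t + t"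
    using assms mult_right_mono[of "of_int \<lfloor>r / t\<rfloor>" "r / t" t] mult_strict_right_mono[of "r / t" "of_int \<lfloor>r /
        t\<rfloor> + 1" t]
    by (simp_all add: distrib_right)
qed

locale surface_flow =
  fixes X :: "'a topology" and v :: "real \<Rightarrow> 'a \<Rightarrow> 'a"
  assumes surface: "surface X" and compact: "compact_space X" and connected: "connected_space X"
    and flow: "flow X v"
begin

lemma Hausdorff: "Hausdorff_space X"
  using surface by (simp add: surface_def)

lemma continuous_flow:
  assumes "continuous_map Y euclideanreal f" "continuous_map Y X g"
  shows "continuous_map Y X (\<lambda>y. v (f y) (g y))"
proof -
  have "continuous_map Y (prod_topology euclideanreal X) (\<lambda>y. (f y, g y))"
    using assms by (simp add: continuous_map_pairedI)
  moreover have "continuous_map (prod_topology euclideanreal X) X (\<lambda>(t, x). v t x)"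
    using flow by (simp add: flow_def)
  ultimately show ?thesis
    using continuous_map_compose[of Y "prod_topology euclideanreal X" "\<lambda>y. (f y, g y)" X "\<lambda>(t, x). v t x"]
    by (simp add: o_def)
qed

lemma flow_0 [simp]: "x \<in> topspace X \<Longrightarrow> v 0 x = x"
  using flow by (simp add: flow_def)

lemma flow_flow: "x \<in> topspace X \<Longrightarrow> v s (v t x) = v (s + t) x"
  using flow by (simp add: flow_def)

lemma continuous_flow_time: "continuous_map X X (v t)"
  using continuous_flow[of X "\<lambda>_. t" "\<lambda>x. x"] by simp

lemma continuous_flow_point: "x \<in> topspace X \<Longrightarrow> continuous_map euclideanreal X (\<lambda>t. v t x)"
  using continuous_flow[of euclideanreal "\<lambda>t. t" "\<lambda>_. x"] by simp

lemma flow_in [simp]: "x \<in> topspace X \<Longrightarrow> v t x \<in> topspace X"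
  using continuous_flow_time continuous_map_image_subset_topspace by blast

lemma flow_cancel [simp]: "x \<in> topspace X \<Longrightarrow> v (- t) (v t x) = x" "x \<in> topspace X \<Longrightarrow> v t (v (- t) x) = x"
  by (simp_all add: flow_flow)

lemma flow_eq_iff: "x \<in> topspace X \<Longrightarrow> y \<in> topspace X \<Longrightarrow> v s x = v t y \<longleftrightarrow> x = v (t - s) y"
proof -
  assume xy: "x \<in> topspace X" "y \<in> topspace X"
  have "x = v (t - s) y" if "v s x = v t y"
  proof -
    have "v (- s) (v s x) = v (- s) (v t y)" using that by simp
    then show ?thesis using xy by (simp add: flow_flow)
  qed
  moreover have "v s x = v t y" if "x = v (t - s) y"
    using xy that by (simp add: flow_flow)
  ultimately show ?thesis by blast
qed

lemma openin_flow_image: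
  assumes "openin X U" shows "openin X (v t ` U)"
proof -
  have "U \<subseteq> topspace X" using assms openin_subset by blast
  then have "v t ` U = {x \<in> topspace X. v (- t) x \<in> U}"
    by (auto simp: image_iff) (metis flow_cancel(2) flow_in)
  then show ?thesis
    using openin_continuous_map_preimage[OF continuous_flow_time assms, of "-t"] by simp
qed

text \<open>Stated for a general map of time and point, because \<open>bebutov_function\<close>
  applies it to a real-valued difference along orbits and not to the flow itself.\<close>

lemma flow_tube_fun:
  assumes F: "continuous_map (prod_topology euclideanreal X) Y (\<lambda>(t, x). F t x)"
    and C: "compact C" and x: "x \<in> topspace X" and N: "openin Y N" and sub: "\<And>t. t \<in> C \<Longrightarrow> F t x \<in> N"
  obtains U where "openin X U" "x \<in> U" "\<And>t y. t \<in> C \<Longrightarrow> y \<in> U \<Longrightarrow> F t y \<in> N"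
proof -
  define W where "W = {p \<in> topspace (prod_topology euclideanreal X). (\<lambda>(t, x). F t x) p \<in> N}"
  have W: "openin (prod_topology euclideanreal X) W"
    unfolding W_def by (rule openin_continuous_map_preimage[OF F N])
  have "\<exists>U V. openin euclideanreal U \<and> openin X V \<and> C \<subseteq> U \<and> x \<in> V \<and> U \<times> V \<subseteq> W"
  proof (rule tube_lemma_left[OF W _ x])
    show "C \<times> {x} \<subseteq> W" using x sub by (auto simp: W_def)
  qed (use C in simp)
  then obtain U V where "openin X V" "C \<subseteq> U" "x \<in> V" "U \<times> V \<subseteq> W" by blast
  then show ?thesis using that[of V] by (force simp: W_def)
qed

lemma flow_tube:
  assumes "compact C" "x \<in> topspace X" "openin X N" "\<And>t. t \<in> C \<Longrightarrow> v t x \<in> N"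
  obtains U where "openin X U" "x \<in> U" "\<And>t y. t \<in> C \<Longrightarrow> y \<in> U \<Longrightarrow> v t y \<in> N"
  using flow_tube_fun[of X v C x N] flow assms by (auto simp: flow_def)

lemma orbit_self: "x \<in> topspace X \<Longrightarrow> x \<in> orbit v x"
  by (metis flow_0 orbit_def rangeI)

lemma orbit_subset: "x \<in> topspace X \<Longrightarrow> orbit v x \<subseteq> topspace X"
  by (auto simp: orbit_def)

lemma flow_in_orbit: "x \<in> topspace X \<Longrightarrow> y \<in> orbit v x \<Longrightarrow> v t y \<in> orbit v x"
  by (auto simp: orbit_def flow_flow)

lemma orbit_eq: "x \<in> topspace X \<Longrightarrow> y \<in> orbit v x \<Longrightarrow> orbit v y = orbit v x"
proof -
  assume x: "x \<in> topspace X" and "y \<in> orbit v x"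
  then obtain t where y: "y = v t x" by (auto simp: orbit_def)
  have "v s x = v (s - t) y" for s by (simp add: y flow_flow x)
  then show ?thesis using x by (auto simp: orbit_def y flow_flow image_iff) (metis diff_add_cancel)
qed

lemma orbit_disjoint:
  assumes "x \<in> topspace X" "y \<in> topspace X" "y \<notin> orbit v x"
  shows "orbit v x \<inter> orbit v y = {}"
  by (metis assms disjoint_iff orbit_eq orbit_self)

lemma connected_orbit: "x \<in> topspace X \<Longrightarrow> connectedin X (orbit v x)"
  unfolding orbit_def
  using connectedin_continuous_map_image[OF continuous_flow_point, of x UNIV] by simp

definition invariant :: "'a set \<Rightarrow> bool" where
  "invariant A \<longleftrightarrow> (\<forall>y\<in>A. \<forall>t. v t y \<in> A)"

lemma invariant_orbit: "invariant A \<Longrightarrow> y \<in> A \<Longrightarrow> orbit v y \<subseteq> A"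
  by (auto simp: invariant_def orbit_def)

definition sat :: "'a set \<Rightarrow> 'a set" where
  "sat V = (\<Union>t. v t ` V)"

lemma sat_iff: "V \<subseteq> topspace X \<Longrightarrow> y \<in> sat V \<longleftrightarrow> y \<in> topspace X \<and> (\<exists>t. v t y \<in> V)"
  unfolding sat_def by (auto simp: image_iff) (metis flow_cancel(1) subsetD, metis flow_cancel(1))

lemma invariant_sat: "V \<subseteq> topspace X \<Longrightarrow> invariant (sat V)"
  unfolding invariant_def by (auto simp: sat_def subset_iff flow_flow)

lemma openin_sat: "openin X V \<Longrightarrow> openin X (sat V)"
  unfolding sat_def by (auto intro: openin_flow_image)

lemma subset_sat: "V \<subseteq> topspace X \<Longrightarrow> V \<subseteq> sat V"
  by (metis flow_0 sat_iff subsetD subsetI)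

section \<open>Return times and periods\<close>

lemma closedin_times: "x \<in> topspace X \<Longrightarrow> closed {t. v t x = x}"
proof -
  assume x: "x \<in> topspace X"
  have "closedin X {x}" using Hausdorff x by (simp add: closedin_Hausdorff_singleton)
  from closedin_continuous_map_preimage[OF continuous_flow_point[OF x] this] show ?thesis by simp
qed

lemma flow_times_int:
  assumes x: "x \<in> topspace X" and t: "v t x = x"
  shows "v (of_int k * t) x = x"
proof -
  have nat: "v (of_nat n * t) x = x" for n
  proof (induction n)
    case (Suc n)
    have "v (of_nat (Suc n) * t) x = v (of_nat n * t) (v t x)"
      using x by (simp add: flow_flow algebra_simps)
    then show ?case using Suc t by simp
  qed (use x in simp)
  show ?thesis
  proof (cases "k \<ge> 0")
    case True then show ?thesis using nat[of "nat k"] by simp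
  next
    case False
    then have "of_int k * t = - (of_nat (nat (-k)) * t)" by simp
    then show ?thesis using nat[of "nat (-k)"] x by (metis flow_cancel(1))
  qed
qed

text \<open>The return times of \<open>x\<close> form a closed additive group. If it had arbitrarily
  small positive elements, their integer multiples would be dense and every time would be a return
  time.\<close>

lemma nonsingular_small_times:
  assumes x: "x \<in> topspace X" and ns: "\<not> singular_point v x"
  obtains e where "e > 0" "\<And>t. 0 < t \<Longrightarrow> t < e \<Longrightarrow> v t x \<noteq> x"
proof (rule ccontr)
  note * = that
  assume no: "\<not> thesis"
  have small: "\<exists>t. 0 < t \<and> t < e \<and> v t x = x" if "e > 0" for e
  proof (rule ccontr)
    assume "\<not> (\<exists>t. 0 < t \<and> t < e \<and> v t x = x)"
    then have thesis by (intro *[OF that]) blast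
    with no show False ..
  qed
  have "r \<in> {t. v t x = x}" for r
  proof (rule closed_approachable[THEN iffD1, OF closedin_times[OF x]])
    show "\<forall>e>0. \<exists>y\<in>{t. v t x = x}. dist y r < e"
    proof clarify
      fix e :: real assume "e > 0"
      then obtain t where t: "0 < t" "t < e" "v t x = x" using small by blast
      have "v (of_int \<lfloor>r / t\<rfloor> * t) x = x" using flow_times_int x t(3) by blast
      moreover have "\<lfloor>r / t\<rfloor> * t \<le> r" "r < \<lfloor>r / t\<rfloor> * t + t"
        using floor_mult_bounds[OF t(1)] by auto
      ultimately show "\<exists>y\<in>{t. v t x = x}. dist y r < e"
        using t(2) by (intro bexI[of _ "of_int \<lfloor>r / t\<rfloor> * t"]) (auto simp: dist_real_def)
    qed
  qed
  then show False using ns by (auto simp: singular_point_def)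
qed

definition period :: "'a \<Rightarrow> real" where
  "period x = Inf {t. t > 0 \<and> v t x = x}"

text \<open>There are no return times between 0 and some \<open>e > 0\<close>, so the infimum runs
  over the closed set \<open>{e..} \<inter> {t. v t x = x}\<close> and is attained.\<close>

lemma
  assumes x: "x \<in> topspace X" and per: "periodic_point v x"
  shows period_pos: "period x > 0" and flow_period: "v (period x) x = x"
    and period_le: "\<And>t. t > 0 \<Longrightarrow> v t x = x \<Longrightarrow> period x \<le> t"
proof -
  obtain e where e: "e > 0" "\<And>t. 0 < t \<Longrightarrow> t < e \<Longrightarrow> v t x \<noteq> x"
    using nonsingular_small_times x per by (metis periodic_point_def)
  obtain T where T: "T > 0" "v T x = x" using per by (auto simp: periodic_point_def)
  have eq: "{t. t > 0 \<and> v t x = x} = {e..} \<inter> {t. v t x = x}"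
    using e by force
  have "closed {t. t > 0 \<and> v t x = x}"
    unfolding eq by (intro closed_Int closedin_times x closed_atLeast)
  moreover have bd: "bdd_below {t. t > 0 \<and> v t x = x}" by (rule bdd_belowI[of _ 0]) auto
  ultimately have "period x \<in> {t. t > 0 \<and> v t x = x}"
    unfolding period_def using T by (intro closed_contains_Inf) auto
  then show "period x > 0" "v (period x) x = x" by auto
  show "\<And>t. t > 0 \<Longrightarrow> v t x = x \<Longrightarrow> period x \<le> t"
    unfolding period_def using bd by (intro cInf_lower) auto
qed

text \<open>The remainder of a return time modulo the least period is again a return time, hence
  zero.\<close>

lemma flow_fixed_iff:
  assumes x: "x \<in> topspace X" and per: "periodic_point v x"
  shows "v t x = x \<longleftrightarrow> (\<exists>k::int. t = of_int k * period x)"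
proof
  assume t: "v t x = x"
  define P where "P = period x"
  have P: "P > 0" "v P x = x" using period_pos flow_period x per by (auto simp: P_def)
  define r where "r = t - of_int \<lfloor>t / P\<rfloor> * P"
  have "v (of_int (- \<lfloor>t / P\<rfloor>) * P) (v t x) = x" using t flow_times_int[OF x P(2), of "- \<lfloor>t / P\<rfloor>"] by (simp
      only: t)
  then have r: "v r x = x" using x by (simp add: flow_flow r_def algebra_simps)
  have "r \<ge> 0" "r < P" using floor_mult_bounds[OF P(1), of t] by (auto simp: r_def)
  then have "r = 0" using period_le[OF x per _ r] by (fastforce simp: P_def)
  then show "\<exists>k::int. t = of_int k * period x" by (auto simp: r_def P_def)
next
  show "\<exists>k::int. t = of_int k * period x \<Longrightarrow> v t x = x"
    using flow_times_int[OF x flow_period[OF x per]] by auto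
qed

lemma flow_same_iff:
  assumes x: "x \<in> topspace X" and per: "periodic_point v x"
  shows "v s x = v t x \<longleftrightarrow> (\<exists>k::int. t - s = of_int k * period x)"
  using flow_fixed_iff[OF assms, of "t - s"] flow_eq_iff[OF x x, of s t] by metis

lemma flow_mod_period:
  assumes x: "x \<in> topspace X" and T: "T > 0" "v T x = x"
  obtains s where "0 \<le> s" "s < T" "v s x = v t x"
proof -
  define s where "s = t - of_int \<lfloor>t / T\<rfloor> * T"
  have "v (t - of_int \<lfloor>t / T\<rfloor> * T) (v (of_int \<lfloor>t / T\<rfloor> * T) x) = v t x"
    using x by (simp add: flow_flow)
  then have "v s x = v t x" using flow_times_int[OF x T(2)] by (simp add: s_def)
  moreover have "s \<ge> 0" "s < T" using floor_mult_bounds[OF T(1), of t] by (auto simp: s_def)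
  ultimately show ?thesis using that by blast
qed

lemma orbit_eq_segment:
  assumes x: "x \<in> topspace X" and T: "T > 0" "v T x = x"
  shows "orbit v x = (\<lambda>t. v t x) ` {0..T}"
proof -
  have "v t x \<in> (\<lambda>t. v t x) ` {0..T}" for t
    using flow_mod_period[OF assms, of t] by (metis atLeastAtMost_iff image_eqI less_imp_le)
  then show ?thesis by (auto simp: orbit_def)
qed

lemma singular_orbit: "singular_point v x \<Longrightarrow> orbit v x = {x}"
  by (auto simp: singular_point_def orbit_def)

lemma compact_orbit:
  assumes x: "x \<in> topspace X" and "closed_point v x"
  shows "compactin X (orbit v x)"
proof (cases "singular_point v x")
  case True then show ?thesis using x by (simp add: singular_orbit)
next
  case False
  then obtain T where "T > 0" "v T x = x" using assms by (auto simp: closed_point_def periodic_point_def)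
  then have "orbit v x = (\<lambda>t. v t x) ` {0..T}" using orbit_eq_segment x by blast
  then show ?thesis using image_compactin[OF _ continuous_flow_point[OF x], of "{0..T}"] by simp
qed

lemma closed_orbit:
  assumes x: "x \<in> topspace X" and "closed_point v x"
  shows "closedin X (orbit v x)"
  using compact_orbit[OF assms] Hausdorff compactin_imp_closedin by blast

text \<open>The orbit piece over \<open>C\<close> is compact and misses \<open>x\<close>, so
  disjoint open sets \<open>N\<close> and \<open>V\<close> separate the two. By the tube lemma,
  points near \<open>x\<close> also spend the times in \<open>C\<close> inside
  \<open>N\<close>.\<close>

lemma no_return:
  assumes C: "compact C" and x: "x \<in> topspace X" and ne: "\<And>t. t \<in> C \<Longrightarrow> v t x \<noteq> x"
  obtains V where "openin X V" "x \<in> V" "\<And>t y. t \<in> C \<Longrightarrow> y \<in> V \<Longrightarrow> v t y \<notin> V"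
proof -
  have 1: "compactin X ((\<lambda>t. v t x) ` C)"
    using image_compactin[OF _ continuous_flow_point[OF x], of C] C by simp
  have 2: "compactin X {x}" using x by simp
  have "disjnt ((\<lambda>t. v t x) ` C) {x}" using ne by (force simp: disjnt_def)
  from Hausdorff_space_compact_separation[OF Hausdorff 1 2 this]
  obtain N V where NV: "openin X N" "openin X V" "(\<lambda>t. v t x) ` C \<subseteq> N" "x \<in> V" "disjnt N V"
    by (metis insert_subset)
  obtain U where U: "openin X U" "x \<in> U" "\<And>t y. t \<in> C \<Longrightarrow> y \<in> U \<Longrightarrow> v t y \<in> N"
    using flow_tube[OF C x NV(1)] NV(3) by auto
  show ?thesis
    using that[of "U \<inter> V"] U NV by (auto simp: disjnt_iff)
qed

lemma period_orbit:
  assumes x: "x \<in> topspace X"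
  shows "period (v s x) = period x"
proof -
  have "v t (v s x) = v s x \<longleftrightarrow> v t x = x" for t
    using x flow_eq_iff[OF x x, of "t + s" s] flow_eq_iff[OF x x, of t 0]
    by (simp add: flow_flow)
  then show ?thesis by (simp add: period_def)
qed

lemma singular_flow:
  assumes "x \<in> topspace X" shows "singular_point v (v s x) \<longleftrightarrow> singular_point v x"
proof -
  have "v t (v s x) = v s x \<longleftrightarrow> v t x = x" for t
    using assms flow_eq_iff[OF assms assms, of "t + s" s] flow_eq_iff[OF assms assms, of t 0]
    by (simp add: flow_flow)
  then show ?thesis by (simp add: singular_point_def)
qed

lemma closed_singular_set: "closedin X (singular_set X v)"
proof -
  have eq: "singular_set X v = (\<Inter>t. {x \<in> topspace X. v t x = x})"
    by (auto simp: singular_set_def singular_point_def)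
  have "closedin X {x \<in> topspace X. v t x = id x}" for t
    by (rule closedin_continuous_maps_eq[OF Hausdorff continuous_flow_time]) simp
  then show ?thesis unfolding eq by (intro closedin_INT) auto
qed

end

section \<open>Charts and transversals\<close>

lemma continuous_map_metric_local:
  fixes g :: "'a \<Rightarrow> 'b::metric_space"
  assumes "\<And>x e. x \<in> topspace X \<Longrightarrow> e > 0 \<Longrightarrow> \<exists>V. openin X V \<and> x \<in> V \<and> (\<forall>y\<in>V. dist (g y) (g x) < e)"
  shows "continuous_map X euclidean g"
  unfolding continuous_map_def
proof (intro conjI allI impI)
  fix U :: "'b set" assume "openin euclidean U"
  then have U: "open U" by simp
  show "openin X {x \<in> topspace X. g x \<in> U}"
  proof (subst openin_subopen, safe)
    fix x assume x: "x \<in> topspace X" "g x \<in> U"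
    then obtain e where e: "e > 0" "ball (g x) e \<subseteq> U" using U open_contains_ball by blast
    obtain V where V: "openin X V" "x \<in> V" "\<forall>y\<in>V. dist (g y) (g x) < e" using assms[OF x(1) e(1)] by blast
    have "V \<subseteq> {x \<in> topspace X. g x \<in> U}"
      using V e(2) openin_subset[OF V(1)] by (force simp: dist_commute)
    then show "\<exists>T. openin X T \<and> x \<in> T \<and> T \<subseteq> {x \<in> topspace X. g x \<in> U}" using V by blast
  qed
qed auto

lemma convex_half_plane: "convex half_plane"
  unfolding half_plane_def by (rule convex_halfspace_Im_ge)

context surface_flow
begin

text \<open>Both directions are part of the data, so sets and paths can be carried back and forth. A
  relatively open part of the half plane as range treats interior and boundary points of the surface
  alike.\<close>

definition chart :: "'a set \<Rightarrow> ('a \<Rightarrow> complex) \<Rightarrow> (complex \<Rightarrow> 'a) \<Rightarrow> complex set \<Rightarrow> bool" where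
  "chart B h k C \<longleftrightarrow> openin X B \<and> openin (top_of_set half_plane) C \<and>
     homeomorphic_maps (subtopology X B) (top_of_set C) h k"

lemma chart_openin: "chart B h k C \<Longrightarrow> openin X B"
  by (simp add: chart_def)

lemma chart_subset: "chart B h k C \<Longrightarrow> B \<subseteq> topspace X"
  using chart_openin openin_subset by blast

lemma chart_half_plane: "chart B h k C \<Longrightarrow> C \<subseteq> half_plane"
  unfolding chart_def by (metis openin_subset topspace_euclidean_subtopology)

lemma chart_h: assumes "chart B h k C" "y \<in> B" shows "h y \<in> C" "k (h y) = y"
proof -
  have "topspace (subtopology X B) = B" using chart_subset[OF assms(1)] by auto
  then show "h y \<in> C" "k (h y) = y"
    using assms unfolding chart_def homeomorphic_maps_def continuous_map_def by auto
qed

lemma chart_k: assumes "chart B h k C" "w \<in> C" shows "k w \<in> B" "h (k w) = w"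
  using assms chart_subset[OF assms(1)] unfolding chart_def homeomorphic_maps_def continuous_map_def by auto

lemma chart_continuous_h:
  assumes c: "chart B h k C" and f: "continuous_map Y X f" "\<And>y. y \<in> topspace Y \<Longrightarrow> f y \<in> B"
  shows "continuous_map Y euclidean (\<lambda>y. h (f y))"
proof -
  have "continuous_map (subtopology X B) euclidean h"
    using c by (auto simp: chart_def homeomorphic_maps_def continuous_map_in_subtopology)
  moreover have "continuous_map Y (subtopology X B) f"
    using f by (auto simp: continuous_map_in_subtopology)
  ultimately show ?thesis using continuous_map_compose by (metis (no_types, lifting) comp_apply
      continuous_map_eq)
qed

lemma chart_continuous_k:
  assumes c: "chart B h k C" and f: "continuous_map Y euclidean f" "\<And>y. y \<in> topspace Y \<Longrightarrow> f y \<in> C"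
  shows "continuous_map Y X (\<lambda>y. k (f y))"
proof -
  have "continuous_map (top_of_set C) X k"
    using c by (auto simp: chart_def homeomorphic_maps_def continuous_map_in_subtopology)
  moreover have "continuous_map Y (top_of_set C) f"
    using f by (auto simp: continuous_map_in_subtopology)
  ultimately show ?thesis using continuous_map_compose by (metis (no_types, lifting) comp_apply
      continuous_map_eq)
qed

lemma chart_open_k:
  assumes c: "chart B h k C" and S: "openin (top_of_set half_plane) S" "S \<subseteq> C"
  shows "openin X (k ` S)"
proof -
  have "k ` S = {y \<in> B. h y \<in> S}"
    using chart_k[OF c] chart_h[OF c] S(2) by (force simp: image_iff)
  moreover have "openin (top_of_set C) S"
    using S chart_half_plane[OF c] by (metis openin_subset_trans)
  moreover have "continuous_map (subtopology X B) (top_of_set C) h"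
    using c by (auto simp: chart_def homeomorphic_maps_def)
  moreover have "topspace (subtopology X B) = B" using chart_subset[OF c] by auto
  ultimately have "openin (subtopology X B) (k ` S)"
    using openin_continuous_map_preimage by fastforce
  then show ?thesis using chart_openin[OF c] openin_trans_full by blast
qed

text \<open>The version for open subsets of the plane, which is what invariance of domain and the
  Jordan curve theorem deliver.\<close>

lemma chart_open_k':
  assumes c: "chart B h k C" and S: "open S" "S \<subseteq> C"
  shows "openin X (k ` S)"
proof -
  have "openin (top_of_set half_plane) S"
    using S chart_half_plane[OF c] by (metis Int_absorb1 order_trans openin_open_Int)
  then show ?thesis using chart_open_k[OF c _ S(2)] by blast
qed

lemma chart_open_h:
  assumes c: "chart B h k C" and V: "openin X V" "V \<subseteq> B"
  shows "openin (top_of_set half_plane) (h ` V)"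
proof -
  have "h ` V = {w \<in> C. k w \<in> V}"
    using chart_k[OF c] chart_h[OF c] V(2) by (force simp: image_iff)
  moreover have "continuous_map (top_of_set C) X k"
    using c by (auto simp: chart_def homeomorphic_maps_def continuous_map_in_subtopology)
  ultimately have "openin (top_of_set C) (h ` V)"
    using openin_continuous_map_preimage[of "top_of_set C" X k V] V(1) by simp
  then show ?thesis using c by (metis chart_def openin_trans)
qed

lemma chart_restrict:
  assumes c: "chart B h k C" and S: "openin (top_of_set half_plane) S" "S \<subseteq> C"
  shows "chart (k ` S) h k S"
  unfolding chart_def
proof (intro conjI S(1))
  show "openin X (k ` S)" using chart_open_k[OF assms] .
  have "homeomorphic_maps (subtopology (subtopology X B) (k ` S)) (subtopology (top_of_set C) S) h k"
    using c chart_k[OF c] S(2) unfolding chart_def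
    by (intro homeomorphic_maps_subtopologies_alt[of "subtopology X B"]) auto
  moreover have "k ` S \<subseteq> B" using chart_k[OF c] S(2) by auto
  ultimately show "homeomorphic_maps (subtopology X (k ` S)) (top_of_set S) h k"
    using S(2) by (simp add: subtopology_subtopology Int_absorb1)
qed

text \<open>Discs cut with the half plane are convex, so segments in them give paths in the
  surface.\<close>

lemma chart_shrink:
  assumes c: "chart B h k C" and x: "x \<in> B" and N: "openin X N" "x \<in> N"
  obtains r where "r > 0" "ball (h x) r \<inter> half_plane \<subseteq> C" "k ` (ball (h x) r \<inter> half_plane) \<subseteq> N"
    "chart (k ` (ball (h x) r \<inter> half_plane)) h k (ball (h x) r \<inter> half_plane)"
    "x \<in> k ` (ball (h x) r \<inter> half_plane)"
proof -
  have "openin (top_of_set half_plane) (h ` (N \<inter> B))"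
    using chart_open_h[OF c] N chart_openin[OF c] by blast
  moreover have "h x \<in> h ` (N \<inter> B)" using x N by auto
  ultimately obtain r where r: "r > 0" "ball (h x) r \<inter> half_plane \<subseteq> h ` (N \<inter> B)"
    unfolding openin_contains_ball by blast
  have sub: "ball (h x) r \<inter> half_plane \<subseteq> C" using r(2) chart_h[OF c] by auto
  have o: "openin (top_of_set half_plane) (ball (h x) r \<inter> half_plane)"
    by (metis Int_commute open_ball openin_open_Int)
  show ?thesis
  proof (rule that[OF r(1) sub])
    show "k ` (ball (h x) r \<inter> half_plane) \<subseteq> N"
    proof
      fix y assume "y \<in> k ` (ball (h x) r \<inter> half_plane)"
      then obtain z where "z \<in> N \<inter> B" "y = k (h z)" using r(2) by auto
      then show "y \<in> N" using chart_h(2)[OF c] by auto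
    qed
    show "chart (k ` (ball (h x) r \<inter> half_plane)) h k (ball (h x) r \<inter> half_plane)"
      by (rule chart_restrict[OF c o sub])
    have "h x \<in> half_plane" using chart_h(1)[OF c x] chart_half_plane[OF c] by auto
    then show "x \<in> k ` (ball (h x) r \<inter> half_plane)"
      using chart_h(2)[OF c x] r(1) by (metis IntI centre_in_ball image_eqI)
  qed
qed

lemma chart_exists:
  assumes "x \<in> topspace X"
  obtains B h k C where "chart B h k C" "x \<in> B"
  using surface assms unfolding surface_def homeomorphic_space_def chart_def by meson

lemma disc_chart:
  assumes "openin X N" "x \<in> N"
  obtains B h k r where "r > 0" "chart B h k (ball (h x) r \<inter> half_plane)" "x \<in> B" "B \<subseteq> N"
proof -
  have "x \<in> topspace X" using assms openin_subset by blast
  then obtain B h k C where c: "chart B h k C" "x \<in> B" using chart_exists by blast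
  obtain r where "r > 0" "ball (h x) r \<inter> half_plane \<subseteq> C" "k ` (ball (h x) r \<inter> half_plane) \<subseteq> N"
    "chart (k ` (ball (h x) r \<inter> half_plane)) h k (ball (h x) r \<inter> half_plane)"
    "x \<in> k ` (ball (h x) r \<inter> half_plane)"
    using chart_shrink[OF c assms] .
  then show ?thesis using that by blast
qed

lemma flow_near:
  assumes N: "openin X N" "x \<in> N"
  obtains e U where "e > 0" "openin X U" "x \<in> U" "\<And>t y. \<bar>t\<bar> \<le> e \<Longrightarrow> y \<in> U \<Longrightarrow> v t y \<in> N"
proof -
  have x: "x \<in> topspace X" using N openin_subset by blast
  define W where "W = {p \<in> topspace (prod_topology euclideanreal X). (\<lambda>(t, x). v t x) p \<in> N}"
  have "openin (prod_topology euclideanreal X) W"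
    unfolding W_def using flow N by (intro openin_continuous_map_preimage) (auto simp: flow_def)
  moreover have "(0, x) \<in> W" using x N by (simp add: W_def)
  ultimately obtain I U where IU: "open I" "openin X U" "0 \<in> I" "x \<in> U" "I \<times> U \<subseteq> W"
    unfolding openin_prod_topology_alt by (metis open_openin)
  obtain e where "e > 0" "cball 0 e \<subseteq> I" using IU(1,3) open_contains_cball by blast
  then show ?thesis
    using that[of e U] IU by (force simp: W_def subset_iff)
qed

lemma connected_sat:
  fixes V :: "real set"
  assumes \<gamma>: "continuous_map (top_of_set J) X \<gamma>" and V: "connected V" "V \<subseteq> J"
  shows "connectedin X (sat (\<gamma> ` V))"
proof -
  have "continuous_map (top_of_set (UNIV \<times> V)) (top_of_set J) snd"
    using V by (auto simp: continuous_map_in_subtopology intro: continuous_on_snd continuous_on_id)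
  then have "continuous_map (top_of_set (UNIV \<times> V)) X (\<lambda>p. \<gamma> (snd p))"
    using \<gamma> continuous_map_compose[of "top_of_set (UNIV \<times> V)" "top_of_set J" snd X \<gamma>] unfolding o_def by blast
  then have c: "continuous_map (top_of_set (UNIV \<times> V)) X (\<lambda>p. v (fst p) (\<gamma> (snd p)))"
    by (intro continuous_flow) (auto intro: continuous_on_fst continuous_on_id)
  have "connectedin (top_of_set (UNIV \<times> V)) ((UNIV::real set) \<times> V)"
    using V connected_UNIV by (simp add: connected_Times connectedin_subtopology)
  from connectedin_continuous_map_image[OF c this]
  have "connectedin X ((\<lambda>p. v (fst p) (\<gamma> (snd p))) ` (UNIV \<times> V))" .
  moreover have "(\<lambda>p. v (fst p) (\<gamma> (snd p))) ` (UNIV \<times> V) = sat (\<gamma> ` V)" by (force simp: sat_def)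
  ultimately show ?thesis by simp
qed

text \<open>Averaging \<open>f\<close> over a time window of length \<open>T\<close> gives a
  function whose derivative along an orbit is the difference of \<open>f\<close> at the two ends of
  the window. With \<open>f\<close> equal to 0 at \<open>x\<close> and 1 at \<open>v T x\<close>,
  this difference is close to 1 near \<open>x\<close>, so the average grows there at rate at least
  1/2. The estimate is the integrated form of this.\<close>

lemma bebutov_function:
  assumes x: "x \<in> topspace X" and ns: "\<not> singular_point v x"
  obtains g e N where "continuous_map X euclideanreal g" "e > 0" "openin X N" "x \<in> N"
    "\<And>y a b. y \<in> N \<Longrightarrow> - e \<le> a \<Longrightarrow> a \<le> b \<Longrightarrow> b \<le> e \<Longrightarrow> g (v b y) - g (v a y) \<ge> (b - a) / 2"
proof -
  obtain d where d: "d > 0" "\<And>t. 0 < t \<Longrightarrow> t < d \<Longrightarrow> v t x \<noteq> x"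
    using nonsingular_small_times[OF x ns] by blast
  \<comment> \<open>Chosen so that \<open>x\<close> and \<open>v T x\<close> are distinct and
    Urysohn's lemma applies to them.\<close>
  define T where "T = d / 2"
  have T: "T > 0" "v T x \<noteq> x" using d by (auto simp: T_def)
  have "normal_space X"
    using compact Hausdorff compact_Hausdorff_or_regular_imp_normal_space by blast
  then obtain f where f: "continuous_map X euclideanreal f" "f ` {x} \<subseteq> {0}" "f ` {v T x} \<subseteq> {1::real}"
    using Urysohn_lemma_alt[of X "{x}" "{v T x}" 0 1] T x Hausdorff closedin_Hausdorff_singleton
    by (metis disjnt_insert1 disjnt_empty1 flow_in singletonD)
  have cf: "continuous_map Y euclideanreal (\<lambda>y. f (v (a y) (b y)))"
    if "continuous_map Y euclideanreal a" "continuous_map Y X b" for Y :: "'c topology" and a b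
    using continuous_map_compose[OF continuous_flow[OF that] f(1)] by (simp add: o_def)
  have cfv: "continuous_on UNIV (\<lambda>t. f (v t y))" if "y \<in> topspace X" for y
    using cf[of euclideanreal "\<lambda>t. t" "\<lambda>_. y"] that by simp
  have int: "(\<lambda>t. f (v t y)) integrable_on {a..b}" if "y \<in> topspace X" for y a b
    by (intro integrable_continuous_real continuous_on_subset[OF cfv[OF that]]) auto
  define g where "g y = integral {0..T} (\<lambda>t. f (v t y))" for y
  have g: "continuous_map X euclideanreal g"
  proof (rule continuous_map_metric_local)
    fix y e :: real and x assume y: "x \<in> topspace X" and e: "e > 0"
    have c: "continuous_map (prod_topology euclideanreal X) euclideanreal (\<lambda>(t, z). f (v t z) - f (v t x))"
      unfolding case_prod_unfold
      by (intro continuous_map_diff cf continuous_map_fst continuous_map_snd) (use y in auto)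
    define e' where "e' = e / (2 * T)"
    have e': "e' > 0" using e T by (auto simp: e'_def)
    obtain U where U: "openin X U" "x \<in> U" "\<And>t z. t \<in> {0..T} \<Longrightarrow> z \<in> U \<Longrightarrow> f (v t z) - f (v t x) \<in> {-e'<..<e'}"
      using flow_tube_fun[OF c compact_Icc y, of "{-e'<..<e'}"] e' by auto
    have "dist (g z) (g x) < e" if z: "z \<in> U" for z
    proof -
      have zt: "z \<in> topspace X" using z U(1) openin_subset by blast
      have "norm (integral {0..T} (\<lambda>t. f (v t z) - f (v t x))) \<le> e' * (T - 0)"
        using T U(3)[OF _ z]
        by (intro integral_bound continuous_intros continuous_on_subset[OF cfv[OF zt]] continuous_on_subset[OF
            cfv[OF y]])
           (auto simp: abs_le_iff less_imp_le, smt (verit))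
      also have "\<dots> < e" using T e by (simp add: e'_def)
      finally show ?thesis
        unfolding g_def dist_norm by (subst integral_diff[symmetric]) (use int zt y in auto)
    qed
    then show "\<exists>V. openin X V \<and> x \<in> V \<and> (\<forall>y\<in>V. dist (g y) (g x) < e)" using U by blast
  qed
  define N where "N = {y \<in> topspace X. f (v T y) - f y > 1/2}"
  have "openin X {y \<in> topspace X. (\<lambda>y. f (v T y) - f y) y \<in> {1/2<..}}"
    by (intro openin_continuous_map_preimage[of X euclideanreal] continuous_map_diff cf f) auto
  then have N: "openin X N" "x \<in> N" using f x by (auto simp: N_def)
  obtain e U where eU: "e > 0" "openin X U" "x \<in> U" "\<And>t y. \<bar>t\<bar> \<le> e \<Longrightarrow> y \<in> U \<Longrightarrow> v t y \<in> N"
    using flow_near[OF N] by metis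
  show ?thesis
  proof (rule that[OF g eU(1-3)])
    fix y a b assume y: "y \<in> U" and ab: "- e \<le> a" "a \<le> b" "b \<le> e"
    have yt: "y \<in> topspace X" using y eU(2) openin_subset by blast
    define F where "F t = f (v t y)" for t
    have iF: "F integrable_on {c..d}" for c d unfolding F_def using int[OF yt] .
    have gv: "g (v c y) = integral {c..c+T} F" for c
    proof -
      have "g (v c y) = integral {0..T} (\<lambda>t. F (t + c))"
        by (simp add: g_def F_def flow_flow yt)
      also have "\<dots> = integral {c..c+T} F"
        using integral_shift_Icc_real[of 0 T F c] by (simp add: o_def add.commute)
      finally show ?thesis .
    qed
    \<comment> \<open>The interval \<open>{a..b+T}\<close> is split at \<open>b\<close> and at
      \<open>a+T\<close>; comparing the two splittings expresses the difference of the averages by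
      the end pieces.\<close>
    have "integral {a..b} F + integral {b..b+T} F = integral {a..b+T} F"
      using ab T by (intro Henstock_Kurzweil_Integration.integral_combine iF) auto
    moreover have "integral {a..a+T} F + integral {a+T..b+T} F = integral {a..b+T} F"
      using ab T by (intro Henstock_Kurzweil_Integration.integral_combine iF) auto
    moreover have "integral {a+T..b+T} F = integral {a..b} (\<lambda>t. F (t + T))"
      using integral_shift_Icc_real[of a b F T] by (simp add: o_def add.commute)
    ultimately have "g (v b y) - g (v a y) = integral {a..b} (\<lambda>t. F (t + T)) - integral {a..b} F"
      by (simp add: gv)
    also have "\<dots> = integral {a..b} (\<lambda>t. F (t + T) - F t)"
    proof (rule integral_diff[symmetric])
      have "continuous_on UNIV (\<lambda>t. F (t + T))"
        using cf[of euclideanreal "\<lambda>t. t + T" "\<lambda>_. y"] yt by (simp add: F_def continuous_intros)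
      then show "(\<lambda>t. F (t + T)) integrable_on {a..b}"
        by (intro integrable_continuous_real) (auto intro: continuous_on_subset)
    qed (rule iF)
    also have "\<dots> \<ge> integral {a..b} (\<lambda>t. 1/2)"
    proof (rule integral_le)
      have "continuous_on UNIV (\<lambda>t. F (t + T) - F t)"
        using cf[of euclideanreal "\<lambda>t. t + T" "\<lambda>_. y"] yt cfv[OF yt] by (simp add: F_def continuous_intros)
      then show "(\<lambda>t. F (t + T) - F t) integrable_on {a..b}"
        by (intro integrable_continuous_real) (auto intro: continuous_on_subset)
      fix t assume "t \<in> {a..b}"
      then have "v t y \<in> N" using eU(4) y ab by auto
      then show "1/2 \<le> F (t + T) - F t" by (simp add: N_def F_def flow_flow yt add.commute)
    qed auto
    finally show "(b - a) / 2 \<le> g (v b y) - g (v a y)" using ab by simp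
  qed
qed


text \<open>A flow box along the transversal \<open>\<gamma>\<close>: flowing the arc for short
  times is injective and open, hence a homeomorphism onto an open set. The half-open
  \<open>J\<close> is meant for points on the boundary of the surface, where the transversal starts
  at \<open>\<gamma> 0\<close>. No chart enters, so later arguments take place in the surface
  itself.\<close>

definition box :: "real set \<Rightarrow> (real \<Rightarrow> 'a) \<Rightarrow> real \<Rightarrow> bool" where
  "box J \<gamma> e \<longleftrightarrow> e > 0 \<and> (J = {-1<..<1} \<or> J = {0..<1}) \<and> continuous_map (top_of_set J) X \<gamma> \<and>
    inj_on (\<lambda>(s::real, t). v t (\<gamma> s)) (J \<times> {-e<..<e}) \<and>
    (\<forall>V. openin (top_of_set (J \<times> {-e<..<e})) V \<longrightarrow> openin X ((\<lambda>(s, t). v t (\<gamma> s)) ` V))"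

text \<open>
  By invariance of domain, the interior of an arc in the local cross-section \<open>Z\<close> is open in \<open>Z\<close>;
  hence an arc issuing from the given point either fills a neighbourhood of it in \<open>Z\<close> or can be
  prolonged beyond it.
\<close>

lemma flow_box:
  assumes x: "x \<in> topspace X" and ns: "\<not> singular_point v x"
  obtains J \<gamma> e where "box J \<gamma> e" "\<gamma> 0 = x"
proof -
  obtain g e0 N where g: "continuous_map X euclideanreal g" and e0: "e0 > 0" and N: "openin X N" "x \<in> N"
    and mono0: "\<And>y a b. y \<in> N \<Longrightarrow> - e0 \<le> a \<Longrightarrow> a \<le> b \<Longrightarrow> b \<le> e0 \<Longrightarrow> g (v b y) - g (v a y) \<ge> (b - a) / 2"
    using bebutov_function[OF x ns] by metis
  obtain B0 h k C0 where c0: "chart B0 h k C0" and xB0: "x \<in> B0" by (rule chart_exists[OF x])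
  have oBN: "openin X (B0 \<inter> N)" using chart_openin[OF c0] N by blast
  obtain e1 N2 where e1: "e1 > 0" and N2: "openin X N2" "x \<in> N2" "\<And>t y. \<bar>t\<bar> \<le> e1 \<Longrightarrow> y \<in> N2 \<Longrightarrow> v t y \<in> B0 \<inter> N"
    using flow_near[OF oBN] xB0 N(2) by (metis IntI)
  \<comment> \<open>Half of both bounds, so that a shift of size below \<open>e\<close> onto the
    cross-section can be followed by another time below \<open>e\<close>.\<close>
  define e where "e = min e0 e1 / 2"
  have e: "e > 0" "2 * e \<le> e0" "2 * e \<le> e1" using e0 e1 by (auto simp: e_def)
  have mono: "g (v b y) - g (v a y) \<ge> (b - a) / 2" if "y \<in> N" "- 2 * e \<le> a" "a \<le> b" "b \<le> 2 * e" for y a b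
    using mono0[of y a b] that e by auto
  have inN: "v t y \<in> B0 \<inter> N" if "\<bar>t\<bar> \<le> 2 * e" "y \<in> N2" for t y using N2(3) that e by auto
  \<comment> \<open>Within \<open>e/2\<close> of the level of \<open>x\<close>: since
    \<open>g\<close> grows at rate at least 1/2, flowing for time \<open>e\<close> forwards or
    backwards crosses that level.\<close>
  define M where "M = {y \<in> N2 \<inter> N. g y \<in> {g x - e/2<..<g x + e/2}}"
  have oM: "openin X M"
  proof -
    have "M = (N2 \<inter> N) \<inter> {y \<in> topspace X. g y \<in> {g x - e/2<..<g x + e/2}}"
      using openin_subset[OF N(1)] by (auto simp: M_def)
    moreover have "openin X {y \<in> topspace X. g y \<in> {g x - e/2<..<g x + e/2}}"
      by (rule openin_continuous_map_preimage[OF g]) auto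
    ultimately show ?thesis using N N2 by (metis openin_Int)
  qed
  have xM: "x \<in> M" using N N2 e by (auto simp: M_def)
  have Mt: "M \<subseteq> topspace X" using oM openin_subset by blast
  have cg: "continuous_map euclideanreal euclideanreal (\<lambda>t. g (v t y))" if "y \<in> topspace X" for y
    using continuous_map_compose[OF continuous_flow_point[OF that] g] by (simp add: o_def)
  have root_ex: "\<exists>t. - e < t \<and> t < e \<and> g (v t y) = g x" if y: "y \<in> M" for y
  proof -
    have yt: "y \<in> topspace X" using y Mt by blast
    have yN: "y \<in> N" "g x - e/2 < g y" "g y < g x + e/2" using y by (auto simp: M_def)
    have 1: "g (v e y) > g x" "g (v (- e) y) < g x"
      using mono[OF yN(1), of 0 e] mono[OF yN(1), of "-e" 0] yN e yt by auto
    obtain t where t: "- e \<le> t" "t \<le> e" "g (v t y) = g x"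
      using IVT'[of "\<lambda>t. g (v t y)" "- e" "g x" e] 1 e cg[OF yt] continuous_on_subset by force
    then show ?thesis using 1 by (metis less_eq_real_def less_irrefl)
  qed
  \<comment> \<open>The shift that carries \<open>y\<close> onto the level of \<open>x\<close>.
    Strict growth of \<open>g\<close> makes it unique, which also yields its continuity.\<close>
  define \<theta> where "\<theta> y = (SOME t. - e < t \<and> t < e \<and> g (v t y) = g x)" for y
  have \<theta>: "- e < \<theta> y" "\<theta> y < e" "g (v (\<theta> y) y) = g x" if "y \<in> M" for y
    using someI_ex[OF root_ex[OF that]] by (auto simp: \<theta>_def)
  have root_unique: "s = t" if "y \<in> N" "\<bar>s\<bar> \<le> 2 * e" "\<bar>t\<bar> \<le> 2 * e" "g (v s y) = g (v t y)" for s t y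
    using mono[of y s t] mono[of y t s] that by (cases s t rule: linorder_cases) (auto simp: abs_le_iff)
  have c\<theta>: "continuous_map (subtopology X M) euclideanreal \<theta>"
  proof (rule continuous_map_metric_local)
    fix y d assume y: "y \<in> topspace (subtopology X M)" and d: "d > (0::real)"
    then have yM: "y \<in> M" and yt: "y \<in> topspace X" by auto
    have yN: "y \<in> N" using yM by (auto simp: M_def)
    define d' where "d' = min (d/2) (min (e - \<theta> y) (e + \<theta> y))"
    have d': "d' > 0" "d' < d" "\<theta> y + d' \<le> e" "- e \<le> \<theta> y - d'" using d \<theta>[OF yM] by (auto simp: d'_def min_def)
    have "g (v (\<theta> y - d') y) < g x" "g x < g (v (\<theta> y + d') y)"
      using mono[OF yN, of "\<theta> y - d'" "\<theta> y"] mono[OF yN, of "\<theta> y" "\<theta> y + d'"] d' \<theta>[OF yM] e by auto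
    moreover define V where "V = {z \<in> topspace X. g (v (\<theta> y - d') z) \<in> {..<g x}} \<inter> {z \<in> topspace X. g (v (\<theta> y
        + d') z) \<in> {g x<..}} \<inter> M"
    moreover have "openin X V"
      unfolding V_def using continuous_map_compose[OF continuous_flow_time g]
      by (intro openin_Int oM openin_continuous_map_preimage[of X euclideanreal]) (auto simp: o_def)
    moreover have "dist (\<theta> z) (\<theta> y) < d" if z: "z \<in> V" for z
    proof -
      have zM: "z \<in> M" and zN: "z \<in> N" and gz: "g (v (\<theta> y - d') z) < g x" "g x < g (v (\<theta> y + d') z)"
        using z by (auto simp: V_def M_def)
      have "\<not> \<theta> z \<ge> \<theta> y + d'"
        using mono[OF zN, of "\<theta> y + d'" "\<theta> z"] gz \<theta>[OF zM] \<theta>[OF yM] d' e by auto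
      moreover have "\<not> \<theta> z \<le> \<theta> y - d'"
        using mono[OF zN, of "\<theta> z" "\<theta> y - d'"] gz \<theta>[OF zM] \<theta>[OF yM] d' e by auto
      ultimately show ?thesis using d' by (auto simp: dist_real_def)
    qed
    ultimately show "\<exists>V. openin (subtopology X M) V \<and> y \<in> V \<and> (\<forall>z\<in>V. dist (\<theta> z) (\<theta> y) < d)"
      using yM yt by (intro exI[of _ V]) (auto intro!: openin_subtopology_Int2 simp: openin_open_subtopology
          oM)
  qed
  obtain \<rho> where \<rho>: "\<rho> > 0" "ball (h x) \<rho> \<inter> half_plane \<subseteq> C0" "k ` (ball (h x) \<rho> \<inter> half_plane) \<subseteq> M"
    "chart (k ` (ball (h x) \<rho> \<inter> half_plane)) h k (ball (h x) \<rho> \<inter> half_plane)"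
    by (rule chart_shrink[OF c0 xB0 oM xM])
  define C where "C = ball (h x) \<rho> \<inter> half_plane"
  have CC0: "C \<subseteq> C0" and kCM: "k ` C \<subseteq> M" and chC: "chart (k ` C) h k C" using \<rho> by (auto simp: C_def)
  have convC: "convex C" unfolding C_def by (intro convex_Int convex_half_plane convex_ball)
  define w0 where "w0 = h x"
  have kw0: "k w0 = x" and w0C0: "w0 \<in> C0" using chart_h[OF c0 xB0] by (auto simp: w0_def)
  have w0H: "w0 \<in> half_plane" using w0C0 chart_half_plane[OF c0] by auto
  then have w0C: "w0 \<in> C" using \<rho>(1) by (auto simp: C_def w0_def)
  \<comment> \<open>The projection of the chart disc along orbits onto the level set, read in the
    chart.\<close>
  define \<zeta> where "\<zeta> w = h (v (\<theta> (k w)) (k w))" for w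
  have k\<zeta>: "k (\<zeta> w) = v (\<theta> (k w)) (k w)" "\<zeta> w \<in> C0" "k (\<zeta> w) \<in> N" "g (k (\<zeta> w)) = g x"
     "\<And>t. \<bar>t\<bar> < e \<Longrightarrow> v t (k (\<zeta> w)) \<in> B0"
    if "w \<in> C" for w
  proof -
    have kM: "k w \<in> M" "k w \<in> N2" "k w \<in> topspace X" using kCM Mt that by (auto simp: M_def)
    have *: "v (\<theta> (k w)) (k w) \<in> B0 \<inter> N" using inN[OF _ kM(2)] \<theta>[OF kM(1)] by auto
    then show 1: "k (\<zeta> w) = v (\<theta> (k w)) (k w)" "\<zeta> w \<in> C0" unfolding \<zeta>_def using chart_h[OF c0] by auto
    then show "k (\<zeta> w) \<in> N" "g (k (\<zeta> w)) = g x" using * \<theta>(3)[OF kM(1)] by auto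
    fix t assume "\<bar>t\<bar> < e"
    then have "\<bar>t + \<theta> (k w)\<bar> \<le> 2 * e" using \<theta>[OF kM(1)] by auto
    then show "v t (k (\<zeta> w)) \<in> B0" using inN[OF _ kM(2)] kM(3) by (simp add: 1 flow_flow)
  qed
  have contk: "continuous_map (top_of_set C) X k"
    using chart_continuous_k[OF chC, of "top_of_set C" "\<lambda>w. w"] by simp
  have cont\<theta>k: "continuous_map (top_of_set C) euclideanreal (\<lambda>w. \<theta> (k w))"
  proof -
    have "continuous_map (top_of_set C) (subtopology X M) k"
      using contk kCM by (auto simp: continuous_map_in_subtopology)
    from continuous_map_compose[OF this c\<theta>] show ?thesis by (simp add: o_def)
  qed
  have cont\<zeta>: "continuous_on C \<zeta>"
  proof -
    have "continuous_map (top_of_set C) X (\<lambda>w. v (\<theta> (k w)) (k w))"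
      by (rule continuous_flow[OF cont\<theta>k contk])
    moreover have "v (\<theta> (k w)) (k w) \<in> B0" if "w \<in> C" for w
      using k\<zeta>(1,2)[OF that] chart_k[OF c0] by metis
    ultimately have "continuous_map (top_of_set C) euclidean \<zeta>"
      unfolding \<zeta>_def by (intro chart_continuous_h[OF c0]) auto
    then show ?thesis by simp
  qed
  \<comment> \<open>The cross-section in chart coordinates. Its shape is unknown at this point; only
    path connectedness is inherited from the convex set \<open>C\<close>.\<close>
  define Z where "Z = \<zeta> ` C"
  have ZC0: "Z \<subseteq> C0" using k\<zeta> by (auto simp: Z_def)
  have kZ: "k z \<in> N" "g (k z) = g x" "\<And>t. \<bar>t\<bar> < e \<Longrightarrow> v t (k z) \<in> B0" "k z \<in> topspace X" if "z \<in> Z" for z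
    using that k\<zeta> openin_subset[OF N(1)] by (auto simp: Z_def)
  have \<zeta>id: "\<zeta> z = z" if "z \<in> Z" "z \<in> C" for z
  proof -
    have kzM: "k z \<in> M" "k z \<in> topspace X" using that kCM Mt by auto
    have "\<theta> (k z) = 0"
      by (rule root_unique[OF kZ(1)[OF that(1)]]) (use \<theta>[OF kzM(1)] kZ[OF that(1)] kzM e in auto)
    then show ?thesis using chart_k[OF c0] that CC0 kzM by (auto simp: \<zeta>_def)
  qed
  have \<zeta>w0: "\<zeta> w0 = w0"
  proof -
    have "\<theta> x = 0" by (rule root_unique[OF N(2)]) (use \<theta>[OF xM] x e in auto)
    then show ?thesis unfolding \<zeta>_def kw0 using x by (simp add: w0_def)
  qed
  then have w0Z: "w0 \<in> Z" using w0C by (force simp: Z_def)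
  have pcZ: "path_connected Z"
    unfolding Z_def by (intro path_connected_continuous_image cont\<zeta> convex_imp_path_connected convC)
  have injZ: "t = t' \<and> z = z'" if "z \<in> Z" "z' \<in> Z" "\<bar>t\<bar> < e" "\<bar>t'\<bar> < e" "v t (k z) = v t' (k z')" for z z' t
      t'
  proof -
    have eq: "k z = v (t' - t) (k z')" using that kZ(4) flow_eq_iff by blast
    have "t' - t = 0"
      by (rule root_unique[OF kZ(1)[OF that(2)]])
         (use that(3,4) kZ(2)[OF that(1)] kZ(2,4)[OF that(2)] eq e in \<open>auto simp: abs_less_iff abs_le_iff\<close>)
    then have "k z = k z'" using eq kZ(4)[OF that(2)] by simp
    then have "z = z'" using chart_k(2)[OF c0] ZC0 that by (metis subsetD)
    then show ?thesis using \<open>t' - t = 0\<close> by auto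
  qed
  \<comment> \<open>Crossing an open arc of \<open>Z\<close> with time is a continuous injection of
    a planar open set into the plane, hence open by invariance of domain.\<close>
  have open_arc: "openin X ((\<lambda>(s, t). v t (k (c s))) ` V)"
    if c: "continuous_on {a<..<b} c" "inj_on c {a<..<b}" "c ` {a<..<b} \<subseteq> Z"
      and V: "open V" "V \<subseteq> {a<..<b} \<times> {-e<..<e}" for a b :: real and c V
  proof -
    have cV: "c (fst p) \<in> Z" "\<bar>snd p\<bar> < e" if "p \<in> V" for p
      using subsetD[OF V(2) that] c(3) by (auto simp: image_subset_iff mem_Times_iff)
    have "continuous_on V (c \<circ> fst)"
      by (rule continuous_on_compose) (use V(2) in \<open>auto intro!: continuous_intros continuous_on_subset[OF
          c(1)]\<close>)
    then have 1: "continuous_map (top_of_set V) X (\<lambda>p. k (c (fst p)))"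
      using cV ZC0 by (intro chart_continuous_k[OF c0]) (auto simp: o_def)
    have 2: "continuous_map (top_of_set V) X (\<lambda>p. v (snd p) (k (c (fst p))))"
      by (rule continuous_flow[OF _ 1]) (simp add: continuous_intros)
    have inB: "v (snd p) (k (c (fst p))) \<in> B0" if "p \<in> V" for p
      using cV[OF that] by (intro kZ(3)) auto
    define H where "H p = h (v (snd p) (k (c (fst p))))" for p
    have cH: "continuous_on V H"
      using chart_continuous_h[OF c0 2] inB by (simp add: H_def)
    have iH: "inj_on H V"
    proof (rule inj_onI)
      fix p q assume pq: "p \<in> V" "q \<in> V" "H p = H q"
      then have "v (snd p) (k (c (fst p))) = v (snd q) (k (c (fst q)))"
        using chart_h(2)[OF c0] inB by (metis H_def)
      then have "snd p = snd q \<and> c (fst p) = c (fst q)"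
        using cV[OF pq(1)] cV[OF pq(2)] by (intro injZ) auto
      then show "p = q" using subsetD[OF V(2) pq(1)] subsetD[OF V(2) pq(2)] inj_onD[OF c(2)]
        by (auto simp: prod_eq_iff mem_Times_iff)
    qed
    have oH: "open (H ` V)" by (rule invariance_of_domain_gen[OF V(1) cH iH]) simp
    have "H ` V \<subseteq> C0" using chart_h(1)[OF c0] inB by (auto simp: H_def)
    then have "openin X (k ` (H ` V))" using chart_open_k'[OF c0 oH] by blast
    moreover have "k ` (H ` V) = (\<lambda>(s, t). v t (k (c s))) ` V"
      unfolding image_image using chart_h(2)[OF c0] inB by (intro image_cong) (auto simp: H_def)
    ultimately show ?thesis by simp
  qed
  \<comment> \<open>If \<open>Z\<close> were a point, all nearby points would lie on one orbit and
    the shift \<open>\<theta>\<close> would embed a planar open set into the real line.\<close>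
  have "\<exists>w1. w1 \<in> Z \<and> w1 \<noteq> w0"
  proof (rule ccontr)
    assume "\<not> ?thesis"
    then have Zw0: "\<zeta> w = w0" if "w \<in> C" for w using that by (auto simp: Z_def)
    define G where "G = ball w0 \<rho> \<inter> {w. Im w > 0}"
    have GC: "G \<subseteq> C" by (auto simp: G_def C_def half_plane_def w0_def)
    have oG: "open G" unfolding G_def by (intro open_Int open_ball open_halfspace_Im_gt)
    have "w0 + of_real (\<rho>/2) * \<i> \<in> G"
      using \<rho>(1) w0H by (auto simp: G_def half_plane_def dist_norm norm_mult)
    then have ne: "G \<noteq> {}" by auto
    define q where "q w = complex_of_real (\<theta> (k w))" for w
    have "continuous_on C (\<lambda>w. \<theta> (k w))" using cont\<theta>k by simp
    then have "continuous_on G q" unfolding q_def by (intro continuous_intros continuous_on_subset[OF _ GC])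
    moreover have "inj_on q G"
    proof (rule inj_onI)
      fix w w' assume w: "w \<in> G" "w' \<in> G" "q w = q w'"
      then have wC: "w \<in> C" "w' \<in> C" using GC by auto
      have "v (\<theta> (k w)) (k w) = v (\<theta> (k w')) (k w')"
        using k\<zeta>(1)[OF wC(1)] k\<zeta>(1)[OF wC(2)] Zw0 wC by metis
      moreover have "\<theta> (k w) = \<theta> (k w')" using w by (simp add: q_def)
      moreover have "k w \<in> topspace X" "k w' \<in> topspace X" using wC kCM Mt by auto
      ultimately have "k w = k w'" using flow_eq_iff by (metis diff_self flow_0)
      then show "w = w'" using chart_k(2)[OF chC] wC by metis
    qed
    ultimately have "open (q ` G)" using invariance_of_domain[OF _ oG] by blast
    then obtain u r where "r > 0" "u \<in> q ` G" "ball u r \<subseteq> q ` G" using ne open_contains_ball by blast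
    moreover from this have "u + of_real (r/2) * \<i> \<in> ball u r" by (auto simp: dist_norm norm_mult)
    ultimately have "u + of_real (r/2) * \<i> \<in> q ` G" by blast
    then have "Im (u + of_real (r/2) * \<i>) = 0" by (metis (no_types, lifting) Im_complex_of_real imageE q_def)
    moreover have "Im u = 0" using \<open>u \<in> q ` G\<close> by (auto simp: q_def)
    ultimately show False using \<open>r > 0\<close> by simp
  qed
  then obtain w1 where w1: "w1 \<in> Z" "w1 \<noteq> w0" by blast
  then obtain g1 where g1: "arc g1" "path_image g1 \<subseteq> Z" "pathstart g1 = w0" "pathfinish g1 = w1"
    using pcZ w0Z path_connected_arcwise by metis
  have cg1: "continuous_on {0..1} g1" and ig1: "inj_on g1 {0..1}" and g10: "g1 0 = w0" "g1 1 = w1"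
    and g1Z: "\<And>s. s \<in> {0..1} \<Longrightarrow> g1 s \<in> Z"
    using g1 by (auto simp: arc_def path_def pathstart_def pathfinish_def path_image_def)
  show ?thesis
  proof (cases "\<exists>E. open E \<and> w0 \<in> E \<and> Z \<inter> E \<subseteq> g1 ` {0..<1}")
    case True
    then obtain E where E: "open E" "w0 \<in> E" "Z \<inter> E \<subseteq> g1 ` {0..<1}" by blast
    define \<gamma> where "\<gamma> s = k (g1 s)" for s
    have "box {0..<1} \<gamma> e"
      unfolding box_def
    proof (intro conjI allI impI)
      show "e > 0" by (rule e(1))
      show "{0..<1::real} = {-1<..<1} \<or> {0..<1::real} = {0..<1}" by simp
      show "continuous_map (top_of_set {0..<1}) X \<gamma>"
        unfolding \<gamma>_def using g1Z ZC0
        by (intro chart_continuous_k[OF c0]) (auto intro: continuous_on_subset[OF cg1])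
      show "inj_on (\<lambda>(s, t). v t (\<gamma> s)) ({0..<1} \<times> {- e<..<e})"
      proof (rule inj_onI, clarify)
        fix s t s' t' assume *: "s \<in> {0..<1}" "t \<in> {-e<..<e}" "s' \<in> {0..<1}" "t' \<in> {-e<..<e}" "v t (\<gamma> s) = v
            t' (\<gamma> s')"
        then have "t = t' \<and> g1 s = g1 s'" unfolding \<gamma>_def by (intro injZ g1Z) auto
        then show "s = s' \<and> t = t'" using ig1 * by (auto simp: inj_on_def)
      qed
      fix V :: "(real \<times> real) set" assume V: "openin (top_of_set ({0..<1} \<times> {- e<..<e})) V"
      obtain V' where V': "open V'" "V = ({0..<1} \<times> {- e<..<e}) \<inter> V'" using V by (auto simp: openin_open)
      show "openin X ((\<lambda>(s, t). v t (\<gamma> s)) ` V)"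
      proof (subst openin_subopen, safe)
        fix s0 t0 assume st: "(s0, t0) \<in> V"
        show "\<exists>T. openin X T \<and> v t0 (\<gamma> s0) \<in> T \<and> T \<subseteq> (\<lambda>(s, t). v t (\<gamma> s)) ` V"
        proof (cases "s0 > 0")
          case True
          define V2 where "V2 = ({0<..<1} \<times> {- e<..<e}) \<inter> V'"
          have "openin X ((\<lambda>(s, t). v t (k (g1 s))) ` V2)"
            by (rule open_arc[of 0 1])
               (use g1Z V'(1) in \<open>auto simp: V2_def intro!: continuous_on_subset[OF cg1] inj_on_subset[OF ig1]
                   open_Times\<close>)
          moreover have "V2 \<subseteq> V" "(s0, t0) \<in> V2" using V' st True by (auto simp: V2_def)
          ultimately show ?thesis
            by (intro exI[of _ "(\<lambda>(s, t). v t (k (g1 s))) ` V2"]) (auto simp: \<gamma>_def)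
        next
          case False
          then have s0: "s0 = 0" using st V' by auto
          have t0: "- e < t0" "t0 < e" "(0, t0) \<in> V'" using st V' s0 by auto
          obtain A1 A2 where A: "open A1" "open A2" "(0, t0) \<in> A1 \<times> A2" "A1 \<times> A2 \<subseteq> V'"
            using open_prod_elim[OF V'(1) t0(3)] by blast
          obtain d1 where d1: "d1 > 0" "ball 0 d1 \<subseteq> A1" using A open_contains_ball by blast
          obtain d2 where d2: "d2 > 0" "ball t0 d2 \<subseteq> A2" using A open_contains_ball by blast
          define d where "d = min (min d1 d2) (min 1 (min (e - t0) (e + t0)))"
          have d: "d > 0" "d \<le> d1" "d \<le> d2" "d \<le> 1" "d \<le> e - t0" "d \<le> e + t0"
            using d1 d2 t0 by (auto simp: d_def)
          have inV: "(s, t) \<in> V" if "0 \<le> s" "s < d" "\<bar>t - t0\<bar> < d" for s t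
          proof -
            have "s \<in> ball 0 d1" "t \<in> ball t0 d2" using that d by (auto simp: dist_real_def)
            then have "(s, t) \<in> V'" using A(4) d1(2) d2(2) by blast
            then show ?thesis using that d V'(2) by auto
          qed
          \<comment> \<open>Points of the cross-section in \<open>E2\<close> lie on the arc at
            parameters below \<open>d\<close>, because the compact remainder of the arc is cut
            out.\<close>
          define E2 where "E2 = E - g1 ` {d..1}"
          have "compact (g1 ` {d..1})" using d by (intro compact_continuous_image continuous_on_subset[OF
              cg1]) auto
          then have oE2: "open E2" using E by (simp add: E2_def open_Diff compact_imp_closed)
          have "g1 0 \<notin> g1 ` {d..1}" using ig1 d by (auto simp: inj_on_def) (metis atLeastAtMost_iff leD
              less_eq_real_def order_trans zero_le_one)
          then have w0E2: "w0 \<in> E2" using E g10 by (auto simp: E2_def)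
          \<comment> \<open>Chart points with small shift whose projection lies near
            \<open>w0\<close>; flowed by \<open>t0\<close>, they form the required open
            neighbourhood.\<close>
          define Cb where "Cb = {w \<in> C. \<zeta> w \<in> E2} \<inter> {w \<in> C. \<theta> (k w) \<in> {-d<..<d}}"
          have "openin (top_of_set C) {w \<in> C. \<zeta> w \<in> E2}" "openin (top_of_set C) {w \<in> C. \<theta> (k w) \<in> {-d<..<d}}"
            using openin_continuous_map_preimage[of "top_of_set C" euclidean \<zeta> E2] cont\<zeta> oE2
              openin_continuous_map_preimage[OF cont\<theta>k, of "{-d<..<d}"] by auto
          then have "openin (top_of_set C) Cb" by (simp add: Cb_def openin_Int)
          then have oCb: "openin (top_of_set half_plane) Cb" "Cb \<subseteq> C"
            using chC openin_trans by (auto simp: chart_def Cb_def)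
          have "openin X (k ` Cb)" by (rule chart_open_k[OF chC oCb])
          then have oQ: "openin X (v t0 ` k ` Cb)" by (rule openin_flow_image)
          have "\<theta> x = 0" by (rule root_unique[OF N(2)]) (use \<theta>[OF xM] x e in auto)
          then have "w0 \<in> Cb" using w0C \<zeta>w0 w0E2 d kw0 by (auto simp: Cb_def)
          then have "v t0 (\<gamma> s0) \<in> v t0 ` k ` Cb" by (simp add: s0 \<gamma>_def g10)
          moreover have "v t0 ` k ` Cb \<subseteq> (\<lambda>(s, t). v t (\<gamma> s)) ` V"
          proof clarify
            fix w assume w: "w \<in> Cb"
            then have wC: "w \<in> C" and ww: "\<zeta> w \<in> E2" "\<bar>\<theta> (k w)\<bar> < d" by (auto simp: Cb_def)
            have kwt: "k w \<in> topspace X" using wC kCM Mt by auto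
            have "\<zeta> w \<in> g1 ` {0..<1}" using ww E wC by (auto simp: E2_def Z_def)
            then obtain s where s: "0 \<le> s" "s < 1" "\<zeta> w = g1 s" by auto
            then have "s < d" using ww by (force simp: E2_def)
            then have V: "(s, t0 - \<theta> (k w)) \<in> V" using inV s ww by auto
            have "\<gamma> s = v (\<theta> (k w)) (k w)" unfolding \<gamma>_def s(3)[symmetric] by (rule k\<zeta>(1)[OF wC])
            then have "v t0 (k w) = v (t0 - \<theta> (k w)) (\<gamma> s)" by (simp add: flow_flow kwt)
            then show "v t0 (k w) \<in> (\<lambda>(s, t). v t (\<gamma> s)) ` V" using V by force
          qed
          ultimately show ?thesis using oQ by blast
        qed
      qed
    qed
    moreover have "\<gamma> 0 = x" by (simp add: \<gamma>_def g10 kw0)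
    ultimately show ?thesis by (rule that)
  next
    case False
    \<comment> \<open>Small enough that no point within \<open>r\<close> of \<open>w0\<close>
      projects to the far end \<open>w1\<close> of the arc, so that the prolongation avoids
      \<open>w1\<close>.\<close>
    obtain r where r: "r > 0" "\<And>w. w \<in> C \<Longrightarrow> dist w w0 < r \<Longrightarrow> \<zeta> w \<noteq> w1"
    proof -
      have "dist w1 w0 > 0" using w1 by simp
      then obtain r where r: "r > 0" "\<forall>w\<in>C. dist w w0 < r \<longrightarrow> dist (\<zeta> w) (\<zeta> w0) < dist w1 w0"
        using cont\<zeta> w0C unfolding continuous_on_iff by metis
      show ?thesis by (rule that[OF r(1)]) (use r(2) \<zeta>w0 in force)
    qed
    define r' where "r' = min r \<rho>"
    have Cr': "w \<in> C" if "w \<in> ball w0 r'" "w \<in> half_plane" for w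
      using that by (auto simp: C_def w0_def r'_def)
    have "\<not> Z \<inter> ball w0 r' \<subseteq> g1 ` {0..<1}" using False r(1) \<rho>(1)
      by (metis r'_def centre_in_ball min_less_iff_conj open_ball)
    then obtain w' where w': "w' \<in> Z" "w' \<in> ball w0 r'" "w' \<notin> g1 ` {0..<1}" by blast
    have w'H: "w' \<in> half_plane" using w'(1) ZC0 chart_half_plane[OF c0] by auto
    have w'C: "w' \<in> C" by (rule Cr'[OF w'(2) w'H])
    have \<zeta>w': "\<zeta> w' = w'" by (rule \<zeta>id[OF w'(1) w'C])
    have "w' \<noteq> w1" using r(2)[OF w'C] \<zeta>w' w'(2) by (auto simp: r'_def dist_commute)
    then have w'n: "w' \<notin> path_image g1"
    proof -
      have "{0..1} = {0..<1} \<union> {1::real}" by auto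
      then show ?thesis using w'(3) \<open>w' \<noteq> w1\<close> g10 by (auto simp: path_image_def)
    qed
    have "w' \<noteq> w0" using w'n g1 by (metis pathstart_in_path_image)
    have seg: "closed_segment w' w0 \<subseteq> ball w0 r' \<inter> half_plane"
      using w'(2) w'H w0H r(1) \<rho>(1)
      by (intro closed_segment_subset convex_Int convex_ball convex_half_plane) (auto simp: r'_def)
    have segC: "closed_segment w' w0 \<subseteq> C" using seg Cr' by blast
    define p where "p = \<zeta> \<circ> linepath w' w0"
    have "path p" unfolding p_def
      by (intro path_continuous_image path_linepath continuous_on_subset[OF cont\<zeta>]) (simp add: segC)
    moreover have "pathstart p = w'" "pathfinish p = w0"
      by (auto simp: p_def pathstart_compose pathfinish_compose \<zeta>w' \<zeta>w0)
    ultimately obtain g2 where g2: "arc g2" "path_image g2 \<subseteq> path_image p" "pathstart g2 = w'" "pathfinish g2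
        = w0"
      using path_contains_arc \<open>w' \<noteq> w0\<close> by metis
    have pp: "path_image p \<subseteq> Z - {w1}"
    proof -
      have "path_image p = \<zeta> ` closed_segment w' w0" by (simp add: p_def path_image_compose)
      moreover have "\<zeta> w \<noteq> w1" if "w \<in> closed_segment w' w0" for w
        using that segC seg by (intro r(2)) (auto simp: r'_def dist_commute)
      ultimately show ?thesis using segC by (auto simp: Z_def)
    qed
    have cg2: "continuous_on {0..1} g2" and ig2: "inj_on g2 {0..1}" and g20: "g2 0 = w'" "g2 1 = w0"
      and g2Z: "\<And>s. s \<in> {0..1} \<Longrightarrow> g2 s \<in> Z - {w1}"
      using g2 subset_trans[OF g2(2) pp] by (auto simp: arc_def path_def pathstart_def pathfinish_def
          path_image_def image_subset_iff)
    \<comment> \<open>The path \<open>g2\<close> starts off the first arc; the infimum of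
      \<open>S\<close> is the moment at which it first meets it.\<close>
    define S where "S = {t \<in> {0..1}. g2 t \<in> path_image g1}"
    have "compact (path_image g1)" using g1 arc_imp_path compact_path_image by blast
    then have "closed S" unfolding S_def
      using continuous_closed_preimage[OF cg2 closed_atLeastAtMost compact_imp_closed]
      by (simp add: vimage_def Int_def)
    moreover have "1 \<in> S" using g20 g1 by (auto simp: S_def) (metis pathstart_in_path_image)
    moreover have bS: "bdd_below S" by (rule bdd_belowI[of _ 0]) (auto simp: S_def)
    ultimately have uS: "Inf S \<in> S" by (intro closed_contains_Inf) auto
    define u where "u = Inf S"
    have u: "0 \<le> u" "u \<le> 1" "g2 u \<in> path_image g1" using uS by (auto simp: S_def u_def)
    have before: "g2 t \<notin> path_image g1" if "0 \<le> t" "t < u" for t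
      using that u cInf_lower[OF _ bS, of t] by (force simp: S_def u_def)
    have "u \<noteq> 0" using u g20 w'n by auto
    obtain s where s: "0 \<le> s" "s \<le> 1" "g2 u = g1 s" using u by (auto simp: path_image_def)
    have "s \<noteq> 1" using g2Z[of u] u s g10 by auto
    \<comment> \<open>Meeting the arc at an interior parameter is impossible: near such a point all
      of \<open>Z\<close> lies on the arc, so \<open>g2\<close> would have met it earlier.\<close>
    have "s = 0"
    proof (rule ccontr)
      assume "s \<noteq> 0"
      then have s01: "s \<in> {0<..<1}" using s \<open>s \<noteq> 1\<close> by auto
      define G where "G = (\<lambda>(s, t). v t (k (g1 s))) ` ({0<..<1} \<times> {-e<..<e})"
      have oG: "openin X G" unfolding G_def
        by (rule open_arc[of 0 1])
           (use g1Z in \<open>auto intro!: continuous_on_subset[OF cg1] inj_on_subset[OF ig1] open_Times\<close>)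
      have "k (g2 u) \<in> G"
      proof -
        have "k (g1 s) \<in> topspace X" using kZ(4) g1Z s by auto
        then have "k (g2 u) = v 0 (k (g1 s))" using s by simp
        then show ?thesis unfolding G_def using s01 e by force
      qed
      moreover have "continuous_map (top_of_set {0..1}) X (\<lambda>t. k (g2 t))"
        using cg2 g2Z ZC0 by (intro chart_continuous_k[OF c0]) auto
      from openin_continuous_map_preimage[OF this oG]
      have "openin (top_of_set {0..1}) {t \<in> {0..1}. k (g2 t) \<in> G}" by simp
      ultimately obtain d where d: "d > 0" "ball u d \<inter> {0..1} \<subseteq> {t \<in> {0..1}. k (g2 t) \<in> G}"
        using u unfolding openin_contains_ball by (metis (mono_tags, lifting) atLeastAtMost_iff
            mem_Collect_eq)
      define t where "t = max 0 (u - d/2)"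
      have t: "0 \<le> t" "t < u" "t \<in> ball u d \<inter> {0..1}"
        using u \<open>u \<noteq> 0\<close> d by (auto simp: t_def dist_real_def)
      then have "k (g2 t) \<in> G" using d by blast
      then obtain s' t' where st: "s' \<in> {0<..<1}" "t' \<in> {-e<..<e}" "k (g2 t) = v t' (k (g1 s'))"
        by (auto simp: G_def)
      have "v 0 (k (g2 t)) = v t' (k (g1 s'))" using st(3) flow_0[OF kZ(4)[of "g2 t"]] g2Z[of t] t by auto
      then have "0 = t' \<and> g2 t = g1 s'"
        using g2Z[of t] g1Z[of s'] t st e by (intro injZ) auto
      then show False using before[OF t(1,2)] st by (auto simp: path_image_def)
    qed
    then have "u = 1" using s g10 g20 ig2 u by (auto simp: inj_on_def)
    have "path_image g2 \<inter> path_image g1 \<subseteq> {w0}"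
    proof
      fix z assume z: "z \<in> path_image g2 \<inter> path_image g1"
      then obtain t where t: "t \<in> {0..1}" "z = g2 t" by (auto simp: path_image_def)
      then have "t = 1" using before[of t] z \<open>u = 1\<close> by force
      then show "z \<in> {w0}" using t g20 by simp
    qed
    then have arc: "arc (g2 +++ g1)" using g1 g2 by (intro arc_join) auto
    have imZ: "path_image (g2 +++ g1) \<subseteq> Z" using g1 g2 subset_trans[OF g2(2) pp] by (auto simp:
        path_image_join)
    \<comment> \<open>Reparametrised so that the common point \<open>w0\<close> of the two arcs sits
      at 0.\<close>
    define c where "c s = (g2 +++ g1) ((s + 1) / 2)" for s
    have cj: "continuous_on {0..1} (g2 +++ g1)" "inj_on (g2 +++ g1) {0..1}" using arc by (auto simp: arc_def
        path_def)
    have cc: "continuous_on {-1<..<1} c"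
      unfolding c_def by (rule continuous_on_compose2[OF cj(1)]) (auto intro!: continuous_intros)
    have ci: "inj_on c {-1<..<1}"
      unfolding c_def inj_on_def using inj_onD[OF cj(2)] by fastforce
    have cZ: "c ` {-1<..<1} \<subseteq> Z"
      using imZ by (auto simp: c_def path_image_def image_subset_iff)
    define \<gamma> where "\<gamma> s = k (c s)" for s
    have "box {-1<..<1} \<gamma> e"
      unfolding box_def
    proof (intro conjI allI impI)
      show "e > 0" by (rule e(1))
      show "{-1<..<1::real} = {-1<..<1} \<or> {-1<..<1::real} = {0..<1}" by simp
      show "continuous_map (top_of_set {-1<..<1}) X \<gamma>"
        unfolding \<gamma>_def using subset_trans[OF cZ ZC0] cc by (intro chart_continuous_k[OF c0]) (auto simp:
            image_subset_iff)
      show "inj_on (\<lambda>(s, t). v t (\<gamma> s)) ({-1<..<1} \<times> {- e<..<e})"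
      proof (rule inj_onI, clarify)
        fix s t s' t' assume *: "s \<in> {-1<..<1}" "t \<in> {-e<..<e}" "s' \<in> {-1<..<1}" "t' \<in> {-e<..<e}" "v t (\<gamma> s) =
            v t' (\<gamma> s')"
        then have "t = t' \<and> c s = c s'" unfolding \<gamma>_def using cZ by (intro injZ) auto
        then show "s = s' \<and> t = t'" using ci * by (auto simp: inj_on_def)
      qed
      fix V :: "(real \<times> real) set" assume V: "openin (top_of_set ({-1<..<1} \<times> {- e<..<e})) V"
      have "open V" "V \<subseteq> {-1<..<1} \<times> {- e<..<e}"
        using V by (auto simp: openin_open_eq open_Times)
      then show "openin X ((\<lambda>(s, t). v t (\<gamma> s)) ` V)"
        unfolding \<gamma>_def by (intro open_arc[OF cc ci cZ])
    qed
    moreover have "\<gamma> 0 = x" using g20 by (simp add: \<gamma>_def c_def joinpaths_def kw0)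
    ultimately show ?thesis by (rule that)
  qed
qed

end

section \<open>Return maps of periodic orbits\<close>

text \<open>\<open>c\<close> stands for the orbit through a transversal point. If \<open>f\<close>
  moved \<open>s\<close>, take the least point \<open>m\<close> in the class of \<open>s\<close>
  that is moved in the same direction. For \<open>f m < m\<close> the point \<open>f m\<close> is a
  smaller one; for \<open>f m > m\<close> a preimage of \<open>m\<close> is. Finiteness of the
  classes makes the minimum available.\<close>

lemma increasing_eq_id:
  fixes f :: "real \<Rightarrow> real"
  assumes f: "continuous_on {0..a} f" "f 0 = 0" "\<And>s t. 0 \<le> s \<Longrightarrow> s < t \<Longrightarrow> t \<le> a \<Longrightarrow> f s < f t"
    and fin: "\<And>s. s \<in> {0..a} \<Longrightarrow> finite {t \<in> {0..a}. c t = c s}"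
    and c: "\<And>s. s \<in> {0..a} \<Longrightarrow> c (f s) = c s"
    and s: "s \<in> {0..a}"
  shows "f s = s"
proof (cases "f s" s rule: linorder_cases)
  case less
  define A where "A = {t \<in> {0..a}. c t = c s} \<inter> {t. f t < t}"
  have A: "finite A" "s \<in> A" using fin[OF s] s less by (auto simp: A_def)
  define m where "m = Min A"
  have m: "m \<in> A" using A Min_in unfolding m_def by blast
  have "0 < m" using m f(2) by (auto simp: A_def less_le)
  then have "f m > 0" using m f(2) f(3)[of 0 m] by (auto simp: A_def)
  then have "f m \<in> A" using m f(3)[of "f m" m] c[of m] by (auto simp: A_def)
  then have "m \<le> f m" using A unfolding m_def by auto
  then show ?thesis using m by (auto simp: A_def)
next
  case greater
  define A where "A = {t \<in> {0..a}. c t = c s} \<inter> {t. t < f t}"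
  have A: "finite A" "s \<in> A" using fin[OF s] s greater by (auto simp: A_def)
  define m where "m = Min A"
  have m: "m \<in> A" using A Min_in unfolding m_def by blast
  have m': "0 \<le> m" "m \<le> a" "m < f m" "c m = c s" using m by (auto simp: A_def)
  obtain b where b: "0 \<le> b" "b \<le> m" "f b = m"
    using IVT'[of f 0 m m] f(2) m' continuous_on_subset[OF f(1), of "{0..m}"] by auto
  have "b \<noteq> m" using b m' by auto
  then have "b \<in> A" using b m' c[of b] by (auto simp: A_def)
  then have "m \<le> b" using A unfolding m_def by auto
  then show ?thesis using b \<open>b \<noteq> m\<close> by auto
qed auto

locale closed_flow = surface_flow +
  assumes closed_points: "x \<in> topspace X \<Longrightarrow> closed_point v x"
begin

section \<open>Intersections of periodic orbits with a transversal\<close>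

lemma box_in: "box J \<gamma> e \<Longrightarrow> s \<in> J \<Longrightarrow> \<gamma> s \<in> topspace X"
  unfolding box_def continuous_map_def by auto

text \<open>Only the difference of the two times matters, so injectivity extends from short times to
  arbitrary times that are less than \<open>e\<close> apart.\<close>

lemma box_inj:
  assumes b: "box J \<gamma> e" and "s \<in> J" "s' \<in> J" "v t (\<gamma> s) = v t' (\<gamma> s')" "\<bar>t - t'\<bar> < e"
  shows "s = s' \<and> t = t'"
proof -
  have e: "e > 0" using b by (auto simp: box_def)
  have "\<gamma> s = v (t' - t) (\<gamma> s')" using flow_eq_iff box_in[OF b] assms by blast
  then have "(\<lambda>(s, t). v t (\<gamma> s)) (s, 0) = (\<lambda>(s, t). v t (\<gamma> s)) (s', t' - t)"
    using box_in[OF b] assms by simp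
  moreover have "inj_on (\<lambda>(s, t). v t (\<gamma> s)) (J \<times> {-e<..<e})" using b by (auto simp: box_def)
  moreover have "(s, 0) \<in> J \<times> {-e<..<e}" "(s', t' - t) \<in> J \<times> {-e<..<e}" using assms e by auto
  ultimately have "(s, 0) = (s', t' - t)" by (meson inj_onD)
  then show ?thesis by simp
qed

lemma box_periodic:
  assumes b: "box J \<gamma> e" and s: "s \<in> J"
  shows "periodic_point v (\<gamma> s)"
proof -
  have e: "e > 0" using b by (auto simp: box_def)
  have "\<not> singular_point v (\<gamma> s)"
  proof
    assume "singular_point v (\<gamma> s)"
    then have "v 0 (\<gamma> s) = v (e/2) (\<gamma> s)" by (simp add: singular_point_def)
    then show False using box_inj[OF b s s, of 0 "e/2"] e by auto
  qed
  then show ?thesis using closed_points[OF box_in[OF b s]] by (simp add: closed_point_def)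
qed

text \<open>Distinct intersections of one orbit with the transversal are at least \<open>e\<close>
  apart in time, and the orbit is traversed in a finite period. The number \<open>m t\<close> is the
  time slot of length \<open>e/2\<close> in which the intersection occurs.\<close>

lemma box_finite:
  assumes b: "box J \<gamma> e" and s: "s \<in> J"
  shows "finite {t \<in> J. orbit v (\<gamma> t) = orbit v (\<gamma> s)}" (is "finite ?A")
proof -
  have e: "e > 0" using b by (auto simp: box_def)
  define P where "P = period (\<gamma> s)"
  have P: "P > 0" "v P (\<gamma> s) = \<gamma> s"
    using period_pos flow_period box_in[OF b s] box_periodic[OF b s] by (auto simp: P_def)
  have "\<exists>\<tau>. 0 \<le> \<tau> \<and> \<tau> < P \<and> \<gamma> t = v \<tau> (\<gamma> s)" if "t \<in> ?A" for t
  proof -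
    have "\<gamma> t \<in> orbit v (\<gamma> s)" using that orbit_self[OF box_in[OF b]] by auto
    then obtain r where "\<gamma> t = v r (\<gamma> s)" by (auto simp: orbit_def)
    then show ?thesis using flow_mod_period[OF box_in[OF b s] P, of r] by metis
  qed
  then obtain \<tau> where \<tau>: "\<And>t. t \<in> ?A \<Longrightarrow> 0 \<le> \<tau> t \<and> \<tau> t < P \<and> \<gamma> t = v (\<tau> t) (\<gamma> s)" by metis
  define m where "m t = \<lfloor>\<tau> t / (e/2)\<rfloor>" for t
  have "inj_on m ?A"
  proof (rule inj_onI)
    fix t t' assume tt: "t \<in> ?A" "t' \<in> ?A" "m t = m t'"
    have "\<bar>\<tau> t - \<tau> t'\<bar> < e"
      using floor_mult_bounds[of "e/2" "\<tau> t"] floor_mult_bounds[of "e/2" "\<tau> t'"] e tt(3) by (auto simp: m_def)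
    moreover have "v (- \<tau> t) (\<gamma> t) = v (- \<tau> t') (\<gamma> t')"
      using \<tau>[OF tt(1)] \<tau>[OF tt(2)] box_in[OF b s] by simp
    ultimately show "t = t'" using box_inj[OF b, of t t' "- \<tau> t" "- \<tau> t'"] tt by auto
  qed
  moreover have "m ` ?A \<subseteq> {0..\<lfloor>P / (e/2)\<rfloor>}"
  proof clarify
    fix t assume "t \<in> J" "orbit v (\<gamma> t) = orbit v (\<gamma> s)"
    then have "t \<in> ?A" by simp
    then have "0 \<le> \<tau> t \<and> \<tau> t < P" using \<tau>[of t] by blast
    then show "m t \<in> {0..\<lfloor>P / (e/2)\<rfloor>}"
      using e by (auto simp: m_def intro!: floor_mono divide_right_mono)
  qed
  ultimately show ?thesis using inj_on_finite by blast
qed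

text \<open>Flowing the arc for short times does not enlarge its saturation, and the resulting box
  is open.\<close>

lemma box_open_sat:
  assumes b: "box J \<gamma> e" and V: "openin (top_of_set J) V"
  shows "openin X (sat (\<gamma> ` V))"
proof -
  have e: "e > 0" using b by (auto simp: box_def)
  have VJ: "V \<subseteq> J" using V openin_imp_subset by blast
  have "openin (top_of_set (J \<times> {-e<..<e})) (V \<times> {-e<..<e})"
    using V by (intro openin_Times) auto
  then have "openin X (sat ((\<lambda>(s, t). v t (\<gamma> s)) ` (V \<times> {-e<..<e})))"
    using b by (auto simp: box_def intro: openin_sat)
  moreover have "sat ((\<lambda>(s, t). v t (\<gamma> s)) ` (V \<times> {-e<..<e})) = sat (\<gamma> ` V)"
  proof
    have "v r (v t (\<gamma> s)) \<in> sat (\<gamma> ` V)" if "s \<in> V" for s r t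
      using flow_flow[OF box_in[OF b subsetD[OF VJ that]]] that unfolding sat_def by auto
    then show "sat ((\<lambda>(s, t). v t (\<gamma> s)) ` (V \<times> {-e<..<e})) \<subseteq> sat (\<gamma> ` V)" by (force simp: sat_def)
    have "v r (\<gamma> s) \<in> sat ((\<lambda>(s, t). v t (\<gamma> s)) ` (V \<times> {-e<..<e}))" if "s \<in> V" for s r
    proof -
      have "v r (\<gamma> s) = v r ((\<lambda>(s, t). v t (\<gamma> s)) (s, 0))" using box_in[OF b] that VJ by auto
      moreover have "(s, 0) \<in> V \<times> {-e<..<e}" using that e by auto
      ultimately show ?thesis unfolding sat_def by blast
    qed
    then show "sat (\<gamma> ` V) \<subseteq> sat ((\<lambda>(s, t). v t (\<gamma> s)) ` (V \<times> {-e<..<e}))"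
      unfolding sat_def[of "\<gamma> ` V"] by auto
  qed
  ultimately show ?thesis by simp
qed

text \<open>In box coordinates the point \<open>v (period y) (\<gamma> s)\<close> reads
  \<open>(f s, u s)\<close>: \<open>f\<close> is the return map and \<open>u\<close> corrects the
  return time. The conclusions about \<open>orbit v y\<close> and about fixed points of
  \<open>f\<close> say that nothing comes back in between; they later make
  \<open>period y - u s\<close> the least period at a fixed point.\<close>

lemma first_return:
  assumes y: "y \<in> topspace X" and per: "periodic_point v y"
  obtains J \<gamma> e \<eta> f u where "box J \<gamma> e" "\<gamma> 0 = y" "\<eta> > 0" "\<eta> < 1"
    "\<And>s. s \<in> J \<inter> {-\<eta><..<\<eta>} \<Longrightarrow> f s \<in> J \<and> \<bar>u s\<bar> < e / 4 \<and> v (period y - u s) (\<gamma> s) = \<gamma> (f s)"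
    "continuous_on (J \<inter> {-\<eta><..<\<eta>}) f" "continuous_on (J \<inter> {-\<eta><..<\<eta>}) u"
    "f 0 = 0" "u 0 = 0" "inj_on f (J \<inter> {-\<eta><..<\<eta>})"
    "\<And>s. s \<in> J \<inter> {-\<eta><..<\<eta>} \<Longrightarrow> \<gamma> s \<in> orbit v y \<Longrightarrow> s = 0"
    "\<And>s s' t. s \<in> J \<inter> {-\<eta><..<\<eta>} \<Longrightarrow> s' \<in> J \<inter> {-\<eta><..<\<eta>} \<Longrightarrow> f s = s \<Longrightarrow> 0 \<le> t \<Longrightarrow> t < period y - u s \<Longrightarrow>
        v t (\<gamma> s) = \<gamma> s' \<Longrightarrow> t = 0 \<and> s' = s"
    "period y \<ge> e"
proof -
  have ns: "\<not> singular_point v y" using per by (simp add: periodic_point_def)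
  obtain J \<gamma> e where b: "box J \<gamma> e" and bx4: "\<gamma> 0 = y" by (rule flow_box[OF y ns])
  have bx: "e > 0" "J = {-1<..<1} \<or> J = {0..<1}" "continuous_map (top_of_set J) X \<gamma>" "\<gamma> 0 = y"
    "inj_on (\<lambda>(s::real, t). v t (\<gamma> s)) (J \<times> {-e<..<e})"
    "\<And>V. openin (top_of_set (J \<times> {-e<..<e})) V \<Longrightarrow> openin X ((\<lambda>(s, t). v t (\<gamma> s)) ` V)"
    using b bx4 by (auto simp: box_def)
  have J0: "0 \<in> J" using bx by auto
  define T where "T = period y"
  have T: "T > 0" "v T y = y" using period_pos[OF y per] flow_period[OF y per] by (auto simp: T_def)
  have Te: "T \<ge> e"
  proof (rule ccontr)
    assume "\<not> T \<ge> e"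
    moreover have "v 0 (\<gamma> 0) = v T (\<gamma> 0)" using T bx y by simp
    ultimately show False using box_inj[OF b J0 J0, of 0 T] T by auto
  qed
  define K where "K = J \<times> {-e<..<e}"
  define \<Phi> where "\<Phi> = (\<lambda>(s, t). v t (\<gamma> s))"
  define \<Omega> where "\<Omega> = \<Phi> ` K"
  define \<psi> where "\<psi> = inv_into K \<Phi>"
  have oK: "openin X (\<Phi> ` V)" if "openin (top_of_set K) V" for V
    using bx(6) that by (simp add: \<Phi>_def K_def)
  have o\<Omega>: "openin X \<Omega>" unfolding \<Omega>_def by (rule oK) simp
  have inj\<Phi>: "inj_on \<Phi> K" using bx(5) by (simp add: \<Phi>_def K_def)
  have \<psi>\<Phi>: "\<psi> (\<Phi> p) = p" if "p \<in> K" for p using that inj\<Phi> by (simp add: \<psi>_def)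
  have \<Phi>\<psi>: "\<psi> z \<in> K" "\<Phi> (\<psi> z) = z" if "z \<in> \<Omega>" for z
    using that by (auto simp: \<psi>_def \<Omega>_def f_inv_into_f inv_into_into)
  have c\<psi>: "continuous_map (subtopology X \<Omega>) euclidean \<psi>"
    unfolding continuous_map_def
  proof (intro conjI allI impI)
    fix U :: "(real \<times> real) set" assume "openin euclidean U"
    then have "openin X (\<Phi> ` (K \<inter> U))" by (intro oK) (auto simp: openin_open_Int)
    moreover have "{z \<in> topspace (subtopology X \<Omega>). \<psi> z \<in> U} = \<Phi> ` (K \<inter> U)"
      using \<Phi>\<psi> \<psi>\<Phi> openin_subset[OF o\<Omega>] by (force simp: \<Omega>_def image_iff)
    moreover have "\<Phi> ` (K \<inter> U) \<subseteq> \<Omega>" by (auto simp: \<Omega>_def)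
    ultimately show "openin (subtopology X \<Omega>) {z \<in> topspace (subtopology X \<Omega>). \<psi> z \<in> U}"
      using o\<Omega> by (simp add: openin_open_subtopology)
  qed auto
  have c\<gamma>T: "continuous_map (top_of_set J) X (\<lambda>s. v T (\<gamma> s))"
    by (rule continuous_flow[OF _ bx(3)]) simp
  define I0 where "I0 = {s \<in> J. v T (\<gamma> s) \<in> \<Omega>}"
  have oI0: "openin (top_of_set J) I0"
    using openin_continuous_map_preimage[OF c\<gamma>T o\<Omega>] by (simp add: I0_def)
  have \<Phi>0: "\<Phi> (0, 0) = y" using bx y by (simp add: \<Phi>_def)
  have 00: "(0, 0) \<in> K" using J0 bx by (simp add: K_def)
  then have y\<Omega>: "y \<in> \<Omega>" using \<Phi>0 by (force simp: \<Omega>_def)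
  define F where "F s = \<psi> (v T (\<gamma> s))" for s
  have "continuous_map (top_of_set I0) (subtopology X \<Omega>) (\<lambda>s. v T (\<gamma> s))"
    using continuous_map_from_subtopology_mono[OF c\<gamma>T, of I0] by (auto simp: I0_def
        continuous_map_in_subtopology)
  from continuous_map_compose[OF this c\<psi>] have cF: "continuous_on I0 F" by (simp add: F_def[abs_def] o_def)
  have F0: "F 0 = (0, 0)" using bx T \<psi>\<Phi>[OF 00] \<Phi>0 by (simp add: F_def)
  define f where "f s = fst (F s)" for s
  define u where "u s = snd (F s)" for s
  have cf: "continuous_on I0 f" "continuous_on I0 u" unfolding f_def u_def by (intro continuous_intros cF)+
  have Fs: "f s \<in> J \<and> v T (\<gamma> s) = v (u s) (\<gamma> (f s))" if "s \<in> I0" for s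
  proof -
    have "v T (\<gamma> s) \<in> \<Omega>" using that by (simp add: I0_def)
    from \<Phi>\<psi>[OF this] show ?thesis by (auto simp: F_def[symmetric] K_def \<Phi>_def f_def u_def split: prod.splits)
  qed
  \<comment> \<open>A neighbourhood that is not re-entered at intermediate times; times within
    \<open>e/2\<close> of 0 or \<open>T\<close> are left to the injectivity of the box.\<close>
  have "\<exists>V. openin X V \<and> y \<in> V \<and> (\<forall>t\<in>{e/2..T - e/2}. \<forall>z\<in>V. v t z \<notin> V)"
  proof -
    have "v t y \<noteq> y" if "t \<in> {e/2..T - e/2}" for t
    proof
      assume "v t y = y"
      then have "T \<le> t" using period_le[OF y per, of t] that bx(1) by (auto simp: T_def)
      then show False using that bx(1) by auto
    qed
    then show ?thesis using no_return[OF compact_Icc y, of "e/2" "T - e/2"] by metis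
  qed
  then obtain V where V: "openin X V" "y \<in> V" "\<And>t z. t \<in> {e/2..T - e/2} \<Longrightarrow> z \<in> V \<Longrightarrow> v t z \<notin> V" by blast
  define I1 where "I1 = {s \<in> J. \<gamma> s \<in> V}"
  have oI1: "openin (top_of_set J) I1"
    using openin_continuous_map_preimage[OF bx(3) V(1)] by (simp add: I1_def)
  \<comment> \<open>The bound \<open>e/4\<close> keeps differences of return times, even after an
    error of \<open>e/2\<close>, below the \<open>e\<close> required by
    \<open>box_inj\<close>.\<close>
  define I2 where "I2 = {s \<in> I0. u s \<in> {-e/4<..<e/4}}"
  have "openin (top_of_set I0) I2"
    using openin_continuous_map_preimage[of "top_of_set I0" euclideanreal u "{-e/4<..<e/4}"] cf(2) by (simp
        add: I2_def)
  then have oI2: "openin (top_of_set J) I2" using oI0 openin_trans by blast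
  have "0 \<in> I1 \<inter> I2" using J0 bx V y\<Omega> T F0 by (auto simp: I1_def I2_def I0_def u_def)
  moreover have "openin (top_of_set J) (I1 \<inter> I2)" using oI1 oI2 by blast
  ultimately obtain r where r: "r > 0" "ball 0 r \<inter> J \<subseteq> I1 \<inter> I2"
    unfolding openin_contains_ball by metis
  define \<eta> where "\<eta> = min r (1/2)"
  have \<eta>: "\<eta> > 0" "\<eta> < 1" using r by (auto simp: \<eta>_def)
  have I: "s \<in> J" "s \<in> I0" "\<gamma> s \<in> V" "\<bar>u s\<bar> < e/4" if "s \<in> J \<inter> {-\<eta><..<\<eta>}" for s
  proof -
    have "s \<in> ball 0 r \<inter> J" using that by (auto simp: \<eta>_def dist_real_def)
    then have "s \<in> I1" "s \<in> I2" using r by auto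
    then show "s \<in> J" "s \<in> I0" "\<gamma> s \<in> V" "\<bar>u s\<bar> < e/4" by (auto simp: I1_def I2_def)
  qed
  have ret: "v (T - u s) (\<gamma> s) = \<gamma> (f s)" if "s \<in> J \<inter> {-\<eta><..<\<eta>}" for s
  proof -
    have st: "\<gamma> s \<in> topspace X" "\<gamma> (f s) \<in> topspace X" using box_in[OF b] I(1)[OF that] Fs[OF I(2)[OF that]]
        by auto
    have "v (- u s) (v T (\<gamma> s)) = v (- u s) (v (u s) (\<gamma> (f s)))" using Fs[OF I(2)[OF that]] by simp
    then show ?thesis using st by (simp add: flow_flow)
  qed
  show ?thesis
  proof (rule that[OF b bx(4) \<eta>, of f u])
    show "f s \<in> J \<and> \<bar>u s\<bar> < e / 4 \<and> v (period y - u s) (\<gamma> s) = \<gamma> (f s)" if "s \<in> J \<inter> {-\<eta><..<\<eta>}" for s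
      using ret[OF that] I[OF that] Fs by (auto simp: T_def)
    show "continuous_on (J \<inter> {-\<eta><..<\<eta>}) f" "continuous_on (J \<inter> {-\<eta><..<\<eta>}) u"
      using I(2) by (auto intro!: continuous_on_subset[OF cf(1)] continuous_on_subset[OF cf(2)])
    show "f 0 = 0" "u 0 = 0" by (auto simp: f_def u_def F0)
    show "inj_on f (J \<inter> {-\<eta><..<\<eta>})"
    proof (rule inj_onI)
      fix s s' assume s: "s \<in> J \<inter> {-\<eta><..<\<eta>}" "s' \<in> J \<inter> {-\<eta><..<\<eta>}" "f s = f s'"
      have "v (T - u s) (\<gamma> s) = v (T - u s') (\<gamma> s')" using ret s by metis
      then show "s = s'" using box_inj[OF b, of s s' "T - u s" "T - u s'"] I[OF s(1)] I[OF s(2)] by auto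
    qed
    show "s = 0" if s: "s \<in> J \<inter> {-\<eta><..<\<eta>}" and o: "\<gamma> s \<in> orbit v y" for s
    proof -
      obtain t' where "\<gamma> s = v t' y" using o by (auto simp: orbit_def)
      then obtain t where t: "0 \<le> t" "t < T" "\<gamma> s = v t y" using flow_mod_period[OF y T, of t'] by metis
      have st: "\<gamma> s \<in> topspace X" using box_in[OF b] s by auto
      have "t \<notin> {e/2..T - e/2}" using V(2,3) t(3) I(3)[OF s] by metis
      then consider "t < e/2" | "t > T - e/2" using t by force
      then show ?thesis
      proof cases
        case 1
        then show ?thesis using box_inj[OF b _ J0, of s 0 t] t s bx st by auto
      next
        case 2
        have "v (t - T) y = v t y" using flow_eq_iff[OF y y, of "t - T" t] T by simp
        then show ?thesis using box_inj[OF b _ J0, of s 0 "t - T"] t s bx st 2 by auto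
      qed
    qed
    show "t = 0 \<and> s' = s" if s: "s \<in> J \<inter> {-\<eta><..<\<eta>}" "s' \<in> J \<inter> {-\<eta><..<\<eta>}" "f s = s"
      and t: "0 \<le> t" "t < period y - u s" "v t (\<gamma> s) = \<gamma> s'" for s s' t
    proof -
      have st: "\<gamma> s \<in> topspace X" "\<gamma> s' \<in> topspace X" using box_in[OF b] s by auto
      have "t \<notin> {e/2..T - e/2}" using V(3) t(3) I(3)[OF s(1)] I(3)[OF s(2)] by metis
      then consider "t < e/2" | "t > T - e/2" by force
      then show ?thesis
      proof cases
        case 1
        then show ?thesis using box_inj[OF b _ _, of s s' t 0] t s st bx(1) by auto
      next
        case 2
        have "v (T - u s) (\<gamma> s) = \<gamma> s" using ret[OF s(1)] s(3) by simp
        then have "v (t - (T - u s)) (\<gamma> s) = v t (\<gamma> s)"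
          using flow_eq_iff[OF st(1) st(1), of "t - (T - u s)" t] by simp
        then have "v (t - (T - u s)) (\<gamma> s) = v 0 (\<gamma> s')" using t st by simp
        moreover have "\<bar>t - (T - u s) - 0\<bar> < e" using I(4)[OF s(1)] 2 t(2) bx(1) by (auto simp: T_def)
        ultimately have "t - (T - u s) = 0" using box_inj[OF b] s by blast
        then show ?thesis using t(2) by (simp add: T_def)
      qed
    qed
    show "period y \<ge> e" using Te by (simp add: T_def)
  qed
qed


text \<open>An injective continuous function on an interval is monotone. If the return map
  increases, it is the identity by \<open>increasing_eq_id\<close>, since it preserves orbits. If it
  decreases, its square increases, so it is an involution. At the end of a half-open transversal it
  cannot decrease.\<close>

lemma return_involutive:
  assumes b: "box J \<gamma> e" and \<eta>: "0 < \<eta>" "\<eta> < 1"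
    and f: "\<And>s. s \<in> J \<inter> {-\<eta><..<\<eta>} \<Longrightarrow> f s \<in> J \<and> orbit v (\<gamma> (f s)) = orbit v (\<gamma> s)"
      "continuous_on (J \<inter> {-\<eta><..<\<eta>}) f" "f 0 = 0" "inj_on f (J \<inter> {-\<eta><..<\<eta>})"
  obtains a where "0 < a" "a < \<eta>"
    "(\<forall>s\<in>J \<inter> {-a..a}. f s = s) \<or>
     (J = {-1<..<1} \<and> (\<forall>s\<in>{-a..a}. f s \<in> {-\<eta><..<\<eta>} \<and> f (f s) = s) \<and> (\<forall>s t. -a \<le> s \<longrightarrow> s < t \<longrightarrow> t \<le> a \<longrightarrow> f t < f
         s))"
proof -
  have J: "J = {-1<..<1} \<or> J = {0..<1}" using b by (auto simp: box_def)
  define c where "c s = orbit v (\<gamma> s)" for s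
  \<comment> \<open>Treats both sides of 0; the negative side is brought into the form of
    \<open>increasing_eq_id\<close> by reflection.\<close>
  have id: "g s = s" if a: "0 < a" "a < 1" and g: "continuous_on (J \<inter> {-a..a}) g" "g 0 = 0"
    "\<And>s t. s \<in> J \<inter> {-a..a} \<Longrightarrow> t \<in> J \<inter> {-a..a} \<Longrightarrow> s < t \<Longrightarrow> g s < g t"
    "\<And>s. s \<in> J \<inter> {-a..a} \<Longrightarrow> c (g s) = c s"
    and s: "s \<in> J \<inter> {-a..a}" for g a s
  proof (cases "s \<ge> 0")
    case True
    have sub: "{0..a} \<subseteq> J \<inter> {-a..a}" using a J by auto
    show ?thesis
    proof (rule increasing_eq_id[of a g c s])
      show "continuous_on {0..a} g" by (rule continuous_on_subset[OF g(1) sub])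
      show "finite {t \<in> {0..a}. c t = c s}" if "s \<in> {0..a}" for s
      proof (rule finite_subset)
        show "finite {t \<in> J. orbit v (\<gamma> t) = orbit v (\<gamma> s)}" using that sub by (intro box_finite[OF b]) blast
        show "{t \<in> {0..a}. c t = c s} \<subseteq> {t \<in> J. orbit v (\<gamma> t) = orbit v (\<gamma> s)}" using sub by (auto simp:
            c_def)
      qed
    qed (use g sub s True in \<open>auto simp: subset_iff\<close>)
  next
    case False
    then have J1: "J = {-1<..<1}" using J s by auto
    have sub: "t \<in> {0..a} \<Longrightarrow> - t \<in> J \<inter> {-a..a}" for t using a J1 by auto
    have "(\<lambda>t. - g (- t)) (- s) = - s"
    proof (rule increasing_eq_id[of a "\<lambda>t. - g (- t)" "\<lambda>t. c (- t)" "- s"])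
      show "continuous_on {0..a} (\<lambda>t. - g (- t))"
        using sub by (intro continuous_intros continuous_on_compose2[OF g(1)] image_subsetI)
      show "finite {t \<in> {0..a}. c (- t) = c (- s)}" if "s \<in> {0..a}" for s
      proof -
        have "finite (uminus ` {t \<in> J. c t = c (- s)})" using box_finite[OF b, of "- s"] sub that by (auto
            simp: c_def)
        moreover have "{t \<in> {0..a}. c (- t) = c (- s)} \<subseteq> uminus ` {t \<in> J. c t = c (- s)}"
          using sub by (force simp: image_iff)
        ultimately show ?thesis using finite_subset by blast
      qed
      show "- g (- s) < - g (- t)" if "0 \<le> s" "s < t" "t \<le> a" for s t
        using g(3)[of "- t" "- s"] sub[of t] sub[of s] that by auto
    qed (use g(2,4) sub s False in auto)
    then show ?thesis by simp
  qed
  define I where "I = J \<inter> {-\<eta><..<\<eta>}"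
  have "is_interval I" using J unfolding I_def by (intro is_interval_Int) (auto simp: is_interval_cc
      is_interval_oo is_interval_co)
  then consider (inc) "strict_mono_on I f" | (dec) "strict_antimono_on I f"
    using injective_eq_monotone_map[of I f] f I_def by auto
  then show ?thesis
  proof cases
    case inc
    have "f s = s" if "s \<in> J \<inter> {-(\<eta>/2)..\<eta>/2}" for s
    proof (rule id[OF _ _ _ _ _ _ that])
      show "continuous_on (J \<inter> {-(\<eta>/2)..\<eta>/2}) f" using \<eta> by (intro continuous_on_subset[OF f(2)]) auto
      show "f s < f t" if "s \<in> J \<inter> {-(\<eta>/2)..\<eta>/2}" "t \<in> J \<inter> {-(\<eta>/2)..\<eta>/2}" "s < t" for s t
        using inc that \<eta> by (intro strict_mono_onD[OF inc]) (auto simp: I_def)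
    qed (use \<eta> f in \<open>auto simp: c_def\<close>)
    then show ?thesis using that[of "\<eta>/2"] \<eta> by auto
  next
    case dec
    have anti: "f t < f s" if "s \<in> I" "t \<in> I" "s < t" for s t
      using dec that by (auto simp: monotone_on_def)
    have J1: "J = {-1<..<1}"
    proof (rule ccontr)
      assume "J \<noteq> {-1<..<1}"
      then have "J = {0..<1}" using J by auto
      then have "0 \<in> I" "\<eta>/2 \<in> I" using \<eta> by (auto simp: I_def)
      then have "f (\<eta>/2) < 0" using anti[of 0 "\<eta>/2"] \<eta> f(3) by auto
      moreover have "f (\<eta>/2) \<in> J" using f(1) \<open>\<eta>/2 \<in> I\<close> by (auto simp: I_def)
      ultimately show False using \<open>J = {0..<1}\<close> by auto
    qed
    have I: "I = {-\<eta><..<\<eta>}" using J1 \<eta> by (auto simp: I_def)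
    have "0 \<in> I" using \<eta> by (simp add: I)
    have "\<exists>d>0. \<forall>s\<in>I. dist s 0 < d \<longrightarrow> dist (f s) (f 0) < \<eta>"
      using f(2) \<eta>(1) \<open>0 \<in> I\<close> unfolding continuous_on_iff I_def[symmetric] by blast
    then obtain d where d: "d > 0" "\<And>s. s \<in> I \<Longrightarrow> \<bar>s\<bar> < d \<Longrightarrow> \<bar>f s\<bar> < \<eta>" using f(3) by auto
    \<comment> \<open>Small enough for \<open>f\<close> to map \<open>{-a..a}\<close> into the
      interval on which \<open>f\<close> is controlled, so that \<open>f\<close> can be
      iterated.\<close>
    define a where "a = min d \<eta> / 2"
    have a: "0 < a" "a < \<eta>" "a < 1" "a < d" using d \<eta> by (auto simp: a_def min_def)
    have fI: "f s \<in> I" "s \<in> I" if "s \<in> {-a..a}" for s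
    proof -
      show "s \<in> I" using that a by (auto simp: I)
      then have "\<bar>f s\<bar> < \<eta>" using d(2)[of s] that a by auto
      then show "f s \<in> I" by (auto simp: I)
    qed
    have "f (f s) = s" if "s \<in> J \<inter> {-a..a}" for s
    proof (rule id[OF _ _ _ _ _ _ that, of "\<lambda>s. f (f s)"])
      show "continuous_on (J \<inter> {-a..a}) (\<lambda>s. f (f s))"
        using f(2) fI unfolding I_def[symmetric]
        by (intro continuous_on_compose2[OF f(2)[unfolded I_def[symmetric]], of _ f] continuous_on_subset[OF
            f(2)[unfolded I_def[symmetric]]]) auto
      show "f (f s) < f (f t)" if "s \<in> J \<inter> {-a..a}" "t \<in> J \<inter> {-a..a}" "s < t" for s t
        using that by (intro anti fI) auto
      show "c (f (f s)) = c s" if "s \<in> J \<inter> {-a..a}" for s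
        using that fI[of s] f(1)[of s] f(1)[of "f s"] by (auto simp: I_def c_def)
    qed (use a f in auto)
    then have "\<forall>s\<in>{-a..a}. f s \<in> {-\<eta><..<\<eta>} \<and> f (f s) = s" using fI a J1 by (auto simp: I)
    then show ?thesis using that[OF a(1,2)] J1 anti fI by auto
  qed
qed

text \<open>All points of a short transversal return within a bounded time, so a compact range of
  times sweeps out their whole orbits, and the tube lemma applies.\<close>

lemma saturated_nbhd_periodic:
  assumes y: "y \<in> topspace X" and per: "periodic_point v y" and N: "openin X N" "orbit v y \<subseteq> N"
  shows "\<exists>A. openin X A \<and> invariant A \<and> y \<in> A \<and> A \<subseteq> N"
proof -
  obtain J \<gamma> e \<eta> f u where b: "box J \<gamma> e" and \<gamma>0: "\<gamma> 0 = y" and \<eta>: "\<eta> > 0" "\<eta> < 1"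
    and fu: "\<And>s. s \<in> J \<inter> {-\<eta><..<\<eta>} \<Longrightarrow> f s \<in> J \<and> \<bar>u s\<bar> < e / 4 \<and> v (period y - u s) (\<gamma> s) = \<gamma> (f s)"
    and cont: "continuous_on (J \<inter> {-\<eta><..<\<eta>}) f" "f 0 = 0" "inj_on f (J \<inter> {-\<eta><..<\<eta>})" and pe: "period y \<ge> e"
    using first_return[OF y per] by metis
  define T where "T = period y"
  have e: "e > 0" and J0: "0 \<in> J" using b by (auto simp: box_def)
  have T: "T \<ge> e" using pe by (simp add: T_def)
  have bt: "\<gamma> s \<in> topspace X" if "s \<in> J" for s using box_in[OF b that] .
  have orb: "orbit v (\<gamma> (f s)) = orbit v (\<gamma> s)" if "s \<in> J \<inter> {-\<eta><..<\<eta>}" for s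
    using fu[OF that] that orbit_eq[OF bt, of s "\<gamma> (f s)"] by (metis IntD1 orbit_def rangeI)
  obtain a where a: "0 < a" "a < \<eta>" and
    cases: "(\<forall>s\<in>J \<inter> {-a..a}. f s = s) \<or>
     (J = {-1<..<1} \<and> (\<forall>s\<in>{-a..a}. f s \<in> {-\<eta><..<\<eta>} \<and> f (f s) = s) \<and> (\<forall>s t. -a \<le> s \<longrightarrow> s < t \<longrightarrow> t \<le> a \<longrightarrow> f t < f
         s))"
    using return_involutive[OF b \<eta> _ cont(1-3)] fu orb by metis
  \<comment> \<open>One turn if the point is fixed by \<open>f\<close>, two turns otherwise. The
    corrections add at most \<open>e/2\<close>, and \<open>e \<le> T\<close> gives the bound
    \<open>3 * T\<close>.\<close>
  have ret: "\<exists>P. 0 < P \<and> P \<le> 3 * T \<and> v P (\<gamma> s) = \<gamma> s" if s: "s \<in> J \<inter> {-a..a}" for s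
  proof -
    have s\<eta>: "s \<in> J \<inter> {-\<eta><..<\<eta>}" using s a by auto
    note fs = fu[OF s\<eta>]
    show ?thesis
    proof (cases "f s = s")
      case True
      then show ?thesis using fs T e by (intro exI[of _ "T - u s"]) (auto simp: T_def)
    next
      case False
      then have *: "J = {-1<..<1}" "f s \<in> {-\<eta><..<\<eta>}" "f (f s) = s" using cases s by auto
      note ffs = fu[of "f s"]
      have "v (T - u (f s)) (v (T - u s) (\<gamma> s)) = \<gamma> s" using fs ffs * by (auto simp: T_def)
      then have "v (2 * T - u s - u (f s)) (\<gamma> s) = \<gamma> s" using bt s by (simp add: flow_flow algebra_simps)
      then show ?thesis using fs ffs * T e by (intro exI[of _ "2 * T - u s - u (f s)"]) auto
    qed
  qed
  obtain U where U: "openin X U" "y \<in> U" "\<And>t z. t \<in> {0..3*T} \<Longrightarrow> z \<in> U \<Longrightarrow> v t z \<in> N"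
    using flow_tube[OF compact_Icc y N(1), of 0 "3*T"] N(2) by (metis orbit_def rangeI subsetD)
  define W where "W = {s \<in> J. \<gamma> s \<in> U} \<inter> (J \<inter> {-a<..<a})"
  have "openin (top_of_set J) {s \<in> topspace (top_of_set J). \<gamma> s \<in> U}"
    using b U(1) by (intro openin_continuous_map_preimage[of _ X]) (auto simp: box_def)
  then have oW: "openin (top_of_set J) W" unfolding W_def by (auto intro!: openin_Int openin_open_Int)
  have WJ: "W \<subseteq> J" by (auto simp: W_def)
  have Wt: "\<gamma> ` W \<subseteq> topspace X" using WJ bt by auto
  show ?thesis
  proof (intro exI conjI)
    show "openin X (sat (\<gamma> ` W))" by (rule box_open_sat[OF b oW])
    show "invariant (sat (\<gamma> ` W))" by (rule invariant_sat[OF Wt])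
    have "0 \<in> W" using J0 U \<gamma>0 a by (auto simp: W_def)
    then show "y \<in> sat (\<gamma> ` W)" using subset_sat[OF Wt] \<gamma>0 by blast
    show "sat (\<gamma> ` W) \<subseteq> N"
    proof
      fix z assume "z \<in> sat (\<gamma> ` W)"
      then obtain r s where z: "z = v r (\<gamma> s)" "s \<in> W" by (auto simp: sat_def)
      have "s \<in> J \<inter> {-a..a}" using z by (auto simp: W_def)
      then obtain P where P: "0 < P" "P \<le> 3 * T" "v P (\<gamma> s) = \<gamma> s" using ret by blast
      obtain t where "0 \<le> t" "t < P" "v t (\<gamma> s) = z"
        using flow_mod_period[of "\<gamma> s" P r] bt WJ z P by (metis subsetD)
      then show "z \<in> N" using U(3)[of t "\<gamma> s"] P z by (auto simp: W_def)
    qed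
  qed
qed

text \<open>The collar of an orbit with neighbours on both sides: an annulus made of periodic
  orbits, one for each parameter. Continuity of the period is included because it makes closed parts
  of the annulus compact.\<close>

definition two_sided :: "real \<Rightarrow> (real \<Rightarrow> 'a) \<Rightarrow> bool" where
  "two_sided d \<gamma> \<longleftrightarrow> d > 0 \<and> continuous_map (top_of_set {-d<..<d}) X \<gamma> \<and>
    continuous_on {-d<..<d} (\<lambda>s. period (\<gamma> s)) \<and>
    (\<forall>s\<in>{-d<..<d}. periodic_point v (\<gamma> s)) \<and>
    (\<forall>s\<in>{-d<..<d}. \<forall>s'\<in>{-d<..<d}. \<gamma> s' \<in> orbit v (\<gamma> s) \<longrightarrow> s = s') \<and>
    (\<forall>V. open V \<longrightarrow> V \<subseteq> {-d<..<d} \<longrightarrow> openin X (sat (\<gamma> ` V)))"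

text \<open>If the return map is the identity on an open interval, the orbits form an annulus. At
  the boundary of the surface, and for an orientation-reversing return map as in a Moebius band,
  removing the orbit leaves a connected collar.\<close>

lemma one_or_two_sided:
  assumes y: "y \<in> topspace X" and per: "periodic_point v y"
  obtains (one) A where "openin X A" "invariant A" "y \<in> A" "connectedin X (A - orbit v y)"
  | (two) d \<gamma> where "two_sided d \<gamma>" "\<gamma> 0 = y"
proof -
  obtain J \<gamma> e \<eta> f u where b: "box J \<gamma> e" and \<gamma>0: "\<gamma> 0 = y" and \<eta>: "\<eta> > 0" "\<eta> < 1"
    and fu: "\<And>s. s \<in> J \<inter> {-\<eta><..<\<eta>} \<Longrightarrow> f s \<in> J \<and> \<bar>u s\<bar> < e / 4 \<and> v (period y - u s) (\<gamma> s) = \<gamma> (f s)"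
    and cont: "continuous_on (J \<inter> {-\<eta><..<\<eta>}) f" "f 0 = 0" "inj_on f (J \<inter> {-\<eta><..<\<eta>})"
    and cu: "continuous_on (J \<inter> {-\<eta><..<\<eta>}) u"
    and d0: "\<And>s. s \<in> J \<inter> {-\<eta><..<\<eta>} \<Longrightarrow> \<gamma> s \<in> orbit v y \<Longrightarrow> s = 0"
    and d1: "\<And>s s' t. s \<in> J \<inter> {-\<eta><..<\<eta>} \<Longrightarrow> s' \<in> J \<inter> {-\<eta><..<\<eta>} \<Longrightarrow> f s = s \<Longrightarrow> 0 \<le> t \<Longrightarrow> t < period y - u s \<Longrightarrow>
        v t (\<gamma> s) = \<gamma> s' \<Longrightarrow> t = 0 \<and> s' = s"
    and pe: "period y \<ge> e"
    by (rule first_return[OF y per], rule that)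
  have e: "e > 0" and J0: "0 \<in> J" and J: "J = {-1<..<1} \<or> J = {0..<1}" using b by (auto simp: box_def)
  have bt: "\<gamma> s \<in> topspace X" if "s \<in> J" for s using box_in[OF b that] .
  have orb: "orbit v (\<gamma> (f s)) = orbit v (\<gamma> s)" if "s \<in> J \<inter> {-\<eta><..<\<eta>}" for s
    using fu[OF that] that orbit_eq[OF bt, of s "\<gamma> (f s)"] by (metis IntD1 orbit_def rangeI)
  obtain a where a: "0 < a" "a < \<eta>" and
    cases: "(\<forall>s\<in>J \<inter> {-a..a}. f s = s) \<or>
     (J = {-1<..<1} \<and> (\<forall>s\<in>{-a..a}. f s \<in> {-\<eta><..<\<eta>} \<and> f (f s) = s) \<and> (\<forall>s t. -a \<le> s \<longrightarrow> s < t \<longrightarrow> t \<le> a \<longrightarrow> f t < f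
         s))"
    using return_involutive[OF b \<eta> _ cont(1-3)] fu orb by metis
  define W where "W = J \<inter> {-a<..<a}"
  have oW: "openin (top_of_set J) W" unfolding W_def by (auto intro!: openin_open_Int)
  have Wt: "\<gamma> ` W \<subseteq> topspace X" using bt by (auto simp: W_def)
  have "0 \<in> W" using J0 a by (auto simp: W_def)
  then have yW: "y \<in> sat (\<gamma> ` W)" using subset_sat[OF Wt] \<gamma>0 by blast
  \<comment> \<open>It suffices to find one connected piece of the transversal that meets exactly
    the orbits of the collar other than that of \<open>y\<close>.\<close>
  have one_sided: thesis if V: "connected V" "V \<subseteq> J" "\<gamma> ` V \<inter> orbit v y = {}" "sat (\<gamma> ` V) = sat (\<gamma> ` (W -
      {0}))" for V
  proof (rule one)
    show "openin X (sat (\<gamma> ` W))" by (rule box_open_sat[OF b oW])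
    show "invariant (sat (\<gamma> ` W))" by (rule invariant_sat[OF Wt])
    show "y \<in> sat (\<gamma> ` W)" by (rule yW)
    have "sat (\<gamma> ` W) - orbit v y = sat (\<gamma> ` (W - {0}))"
    proof
      show "sat (\<gamma> ` W) - orbit v y \<subseteq> sat (\<gamma> ` (W - {0}))"
      proof
        fix z assume z: "z \<in> sat (\<gamma> ` W) - orbit v y"
        then obtain r s where rs: "z = v r (\<gamma> s)" "s \<in> W" by (auto simp: sat_def)
        then have "s \<noteq> 0" using z \<gamma>0 by (auto simp: orbit_def)
        then show "z \<in> sat (\<gamma> ` (W - {0}))" using rs unfolding sat_def by blast
      qed
      have "z \<notin> orbit v y" if "z \<in> sat (\<gamma> ` (W - {0}))" for z
      proof
        assume "z \<in> orbit v y"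
        from that obtain r s where rs: "z = v r (\<gamma> s)" "s \<in> W" "s \<noteq> 0" by (auto simp: sat_def)
        have st: "\<gamma> s \<in> topspace X" using rs bt by (auto simp: W_def)
        have "v (- r) z \<in> orbit v y" by (rule flow_in_orbit[OF y \<open>z \<in> orbit v y\<close>])
        then have "\<gamma> s \<in> orbit v y" using rs st by simp
        then show False using d0[of s] rs a by (auto simp: W_def)
      qed
      then show "sat (\<gamma> ` (W - {0})) \<subseteq> sat (\<gamma> ` W) - orbit v y" by (force simp: sat_def)
    qed
    then show "connectedin X (sat (\<gamma> ` W) - orbit v y)" using connected_sat[of J \<gamma> V] b V by (simp add:
        box_def)
  qed
  show thesis
  proof (cases "\<forall>s\<in>J \<inter> {-a..a}. f s = s")
    case True
    show thesis
    proof (cases "J = {0..<1}")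
      case J1: True
      have eq: "W - {0} = {0<..<a}" using J1 a \<eta> by (auto simp: W_def)
      show thesis
      proof (rule one_sided[of "{0<..<a}"])
        have "\<gamma> s \<notin> orbit v y" if "s \<in> {0<..<a}" for s using d0[of s] that J1 a \<eta> by auto
        then show "\<gamma> ` {0<..<a} \<inter> orbit v y = {}" by blast
        show "{0<..<a} \<subseteq> J" using J1 a \<eta> by auto
        show "sat (\<gamma> ` {0<..<a}) = sat (\<gamma> ` (W - {0}))" by (simp only: eq)
      qed simp
    next
      case False
      then have J1: "J = {-1<..<1}" using J by auto
      then have W1: "W = {-a<..<a}" using a \<eta> by (auto simp: W_def)
      have W\<eta>: "W \<subseteq> J \<inter> {-\<eta><..<\<eta>}" using a by (auto simp: W_def)
      have fid: "f s = s" if "s \<in> W" for s using True that by (auto simp: W_def)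
      have Tpos: "period y - u s > 0" if "s \<in> W" for s using fu[of s] that W\<eta> pe e by (auto simp: subset_iff)
      have ret: "v (period y - u s) (\<gamma> s) = \<gamma> s" if "s \<in> W" for s using fu[of s] that W\<eta> fid[OF that] by (auto
          simp: subset_iff)
      have pers: "periodic_point v (\<gamma> s)" if "s \<in> W" for s using box_periodic[OF b, of s] that by (auto simp:
          W_def)
      \<comment> \<open>A fixed point of the return map does not come back earlier, so the corrected
        return time is its least period; this makes the period continuous in
        \<open>s\<close>.\<close>
      have per_eq: "period (\<gamma> s) = period y - u s" if s: "s \<in> W" for s
      proof -
        have st: "\<gamma> s \<in> topspace X" using s Wt by auto
        have "period (\<gamma> s) \<le> period y - u s" by (rule period_le[OF st pers[OF s] Tpos[OF s] ret[OF s]])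
        moreover have "\<not> period (\<gamma> s) < period y - u s"
        proof
          assume "period (\<gamma> s) < period y - u s"
          then have "period (\<gamma> s) = 0"
            using d1[of s s "period (\<gamma> s)"] s W\<eta> fid[OF s] period_pos[OF st pers[OF s]] flow_period[OF st
                pers[OF s]]
            by (auto simp: subset_iff)
          then show False using period_pos[OF st pers[OF s]] by simp
        qed
        ultimately show ?thesis by simp
      qed
      have "two_sided a \<gamma>"
        unfolding two_sided_def W1[symmetric]
      proof (intro conjI ballI allI impI)
        show "continuous_map (top_of_set W) X \<gamma>"
          using b continuous_map_from_subtopology_mono[of euclidean J X \<gamma> W] by (auto simp: box_def W_def)
        have "continuous_on W (\<lambda>s. period y - u s)" by (intro continuous_intros continuous_on_subset[OF cu
            W\<eta>])
        then show "continuous_on W (\<lambda>s. period (\<gamma> s))" using per_eq by (simp cong: continuous_on_cong)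
        show "s = s'" if s: "s \<in> W" "s' \<in> W" and o: "\<gamma> s' \<in> orbit v (\<gamma> s)" for s s'
        proof -
          have st: "\<gamma> s \<in> topspace X" using s Wt by auto
          obtain r where "\<gamma> s' = v r (\<gamma> s)" using o by (auto simp: orbit_def)
          then obtain t where "0 \<le> t" "t < period y - u s" "v t (\<gamma> s) = \<gamma> s'"
            using flow_mod_period[OF st Tpos[OF s(1)] ret[OF s(1)], of r] by metis
          then show ?thesis using d1[of s s' t] s W\<eta> fid by (auto simp: subset_iff)
        qed
        show "openin X (sat (\<gamma> ` V))" if "open V" "V \<subseteq> W" for V
        proof (rule box_open_sat[OF b])
          show "openin (top_of_set J) V" using that by (auto simp: W_def intro!: open_subset)
        qed
      qed (use a pers in auto)
      then show thesis using two \<gamma>0 by blast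
    qed
  next
    case False
    then have J1: "J = {-1<..<1}" and ff: "\<And>s. s \<in> {-a..a} \<Longrightarrow> f s \<in> {-\<eta><..<\<eta>} \<and> f (f s) = s"
      and anti: "\<And>s t. -a \<le> s \<Longrightarrow> s < t \<Longrightarrow> t \<le> a \<Longrightarrow> f t < f s" using cases by auto
    have W1: "W = {-a<..<a}" using J1 a \<eta> by (auto simp: W_def)
    have W\<eta>: "W \<subseteq> J \<inter> {-\<eta><..<\<eta>}" using a by (auto simp: W_def)
    \<comment> \<open>The reversal carries the negative side into the positive one, so a single
      connected set of parameters represents the orbits on both sides.\<close>
    define V where "V = f ` {-a<..<0} \<union> {0<..<a}"
    have sub: "{-a<..<0} \<subseteq> J \<inter> {-\<eta><..<\<eta>}" "{0<..<a} \<subseteq> J \<inter> {-\<eta><..<\<eta>}" using J1 a \<eta> by auto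
    have fneg: "f s > 0" if "-a < s" "s < 0" for s using anti[of s 0] that a cont(2) by auto
    show thesis
    proof (rule one_sided[of V])
      have "connected (f ` {-a<..<0})"
        by (intro connected_continuous_image continuous_on_subset[OF cont(1)] sub) auto
      moreover have "f ` {-a<..<0} \<inter> {0<..<a} \<noteq> {}"
      proof -
        have "0 \<in> J \<inter> {-\<eta><..<\<eta>}" using J0 \<eta> by auto
        then obtain d where d: "d > 0" "\<And>s. s \<in> J \<inter> {-\<eta><..<\<eta>} \<Longrightarrow> \<bar>s\<bar> < d \<Longrightarrow> \<bar>f s\<bar> < a"
          using cont(1,2) a(1) unfolding continuous_on_iff by (metis diff_zero dist_real_def)
        define s where "s = - min (a/2) (d/2)"
        have s: "-a < s" "s < 0" "\<bar>s\<bar> < d" using a d by (auto simp: s_def min_def)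
        then have "\<bar>f s\<bar> < a" using d(2)[of s] J1 a \<eta> by auto
        then have "f s \<in> f ` {-a<..<0} \<inter> {0<..<a}" using fneg[of s] s by auto
        then show ?thesis by blast
      qed
      ultimately show "connected V" unfolding V_def by (intro connected_Un) auto
      show VJ: "V \<subseteq> J" using fu sub by (auto simp: V_def subset_iff)
      have V\<eta>: "s \<in> J \<inter> {-\<eta><..<\<eta>} \<and> s \<noteq> 0" if sV: "s \<in> V" for s
      proof (cases "s \<in> {0<..<a}")
        case True then show ?thesis using sub by auto
      next
        case False
        then obtain t where t: "-a < t" "t < 0" "s = f t" using sV by (auto simp: V_def)
        then show ?thesis using ff[of t] fneg[of t] VJ sV a by auto
      qed
      then show "\<gamma> ` V \<inter> orbit v y = {}" using d0 by blast
      have same: "sat {\<gamma> (f s)} = sat {\<gamma> s}" if "s \<in> J \<inter> {-\<eta><..<\<eta>}" for s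
        using orb[OF that] by (auto simp: orbit_def sat_def)
      have sat_UN: "sat (\<gamma> ` A) = (\<Union>s\<in>A. sat {\<gamma> s})" for A by (auto simp: sat_def)
      have "(\<Union>s\<in>V. sat {\<gamma> s}) = (\<Union>s\<in>{-a<..<0}. sat {\<gamma> (f s)}) \<union> (\<Union>s\<in>{0<..<a}. sat {\<gamma> s})"
        by (auto simp: V_def)
      also have "(\<Union>s\<in>{-a<..<0}. sat {\<gamma> (f s)}) = (\<Union>s\<in>{-a<..<0}. sat {\<gamma> s})"
        by (intro SUP_cong refl same subsetD[OF sub(1)])
      also have "\<dots> \<union> (\<Union>s\<in>{0<..<a}. sat {\<gamma> s}) = (\<Union>s\<in>W - {0}. sat {\<gamma> s})"
      proof -
        have "W - {0} = {-a<..<0} \<union> {0<..<a}" by (auto simp: W1)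
        then show ?thesis by (simp add: UN_Un)
      qed
      finally show "sat (\<gamma> ` V) = sat (\<gamma> ` (W - {0}))" by (simp add: sat_UN)
    qed
  qed
qed

end

section \<open>The orbit space\<close>

context surface_flow
begin

text \<open>Orbits are equal or disjoint; this closes the open sets of \<open>orbit_space\<close>
  under intersection.\<close>

lemma Union_orbits_Int:
  assumes "\<S> \<subseteq> orbit v ` topspace X" "\<T> \<subseteq> orbit v ` topspace X"
  shows "\<Union>(\<S> \<inter> \<T>) = \<Union>\<S> \<inter> \<Union>\<T>"
proof
  show "\<Union>\<S> \<inter> \<Union>\<T> \<subseteq> \<Union>(\<S> \<inter> \<T>)"
  proof
    fix z assume "z \<in> \<Union>\<S> \<inter> \<Union>\<T>"
    then obtain S T where ST: "S \<in> \<S>" "z \<in> S" "T \<in> \<T>" "z \<in> T" by blast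
    then obtain x y where "x \<in> topspace X" "S = orbit v x" "y \<in> topspace X" "T = orbit v y" using assms by
        blast
    then have "S = T" using ST orbit_eq by metis
    then show "z \<in> \<Union>(\<S> \<inter> \<T>)" using ST by blast
  qed
qed auto

lemma openin_orbit_space:
  "openin (orbit_space X v) \<U> \<longleftrightarrow> \<U> \<subseteq> orbit v ` topspace X \<and> openin X (\<Union>\<U> \<inter> topspace X)"
proof -
  define L where "L = (\<lambda>\<U>. \<U> \<subseteq> orbit v ` topspace X \<and> openin X (\<Union>\<U> \<inter> topspace X))"
  have "istopology L"
    unfolding istopology_def
  proof (intro conjI allI impI)
    fix \<S> \<T> assume ST: "L \<S>" "L \<T>"
    have "\<Union>(\<S> \<inter> \<T>) = \<Union>\<S> \<inter> \<Union>\<T>" using ST by (intro Union_orbits_Int) (auto simp: L_def)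
    then have eq: "\<Union>(\<S> \<inter> \<T>) \<inter> topspace X = (\<Union>\<S> \<inter> topspace X) \<inter> (\<Union>\<T> \<inter> topspace X)" by auto
    show "L (\<S> \<inter> \<T>)" using ST unfolding L_def eq by (auto intro: openin_Int)
  next
    fix K assume K: "\<forall>\<S>\<in>K. L \<S>"
    have eq: "\<Union>(\<Union>K) \<inter> topspace X = \<Union>((\<lambda>\<S>. \<Union>\<S> \<inter> topspace X) ` K)" by auto
    have "openin X (\<Union>((\<lambda>\<S>. \<Union>\<S> \<inter> topspace X) ` K))" using K by (intro openin_Union) (auto simp: L_def)
    then show "L (\<Union>K)" using K unfolding L_def eq by auto
  qed
  then have "openin (topology L) = L" by (rule topology_inverse')
  then show ?thesis by (simp add: orbit_space_def L_def)
qed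

lemma Union_orbits: "A \<subseteq> topspace X \<Longrightarrow> invariant A \<Longrightarrow> \<Union>(orbit v ` A) \<inter> topspace X = A"
  using invariant_orbit orbit_self by blast

lemma topspace_orbit_space: "topspace (orbit_space X v) = orbit v ` topspace X"
proof
  show "topspace (orbit_space X v) \<subseteq> orbit v ` topspace X"
    using openin_orbit_space openin_topspace by blast
  have "openin (orbit_space X v) (orbit v ` topspace X)"
    unfolding openin_orbit_space using Union_orbits[of "topspace X"] by (simp add: invariant_def)
  then show "orbit v ` topspace X \<subseteq> topspace (orbit_space X v)" using openin_subset by blast
qed

lemma orbit_of_Union:
  assumes "\<U> \<subseteq> orbit v ` topspace X" "x \<in> topspace X"
  shows "x \<in> \<Union>\<U> \<longleftrightarrow> orbit v x \<in> \<U>"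
proof
  assume "x \<in> \<Union>\<U>"
  then obtain S where S: "S \<in> \<U>" "x \<in> S" by blast
  then obtain y where "y \<in> topspace X" "S = orbit v y" using assms by blast
  then show "orbit v x \<in> \<U>" using S orbit_eq by metis
qed (use orbit_self[OF assms(2)] in blast)

lemma continuous_orbit_map: "continuous_map X (orbit_space X v) (orbit v)"
  unfolding continuous_map_def topspace_orbit_space
proof (intro conjI allI impI)
  fix \<U> assume U: "openin (orbit_space X v) \<U>"
  have "{x \<in> topspace X. orbit v x \<in> \<U>} = \<Union>\<U> \<inter> topspace X"
    using orbit_of_Union U[unfolded openin_orbit_space] by blast
  then show "openin X {x \<in> topspace X. orbit v x \<in> \<U>}" using U[unfolded openin_orbit_space] by simp
qed auto

text \<open>Upper semicontinuity of the partition into orbits. It is the form in which the Hausdorff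
  property of the orbit space is used, and the form in which it is verified.\<close>

definition saturated_nbhds :: bool where
  "saturated_nbhds \<longleftrightarrow> (\<forall>x\<in>topspace X. \<forall>N. openin X N \<longrightarrow> orbit v x \<subseteq> N \<longrightarrow>
     (\<exists>A. openin X A \<and> invariant A \<and> x \<in> A \<and> A \<subseteq> N))"

lemma saturated_nbhdsD:
  assumes saturated_nbhds "x \<in> topspace X" "openin X N" "orbit v x \<subseteq> N"
  obtains A where "openin X A" "invariant A" "x \<in> A" "A \<subseteq> N"
  using assms unfolding saturated_nbhds_def by blast

text \<open>Distinct closed orbits are disjoint compact sets; open sets separating them contain
  invariant open neighbourhoods of the orbits, which descend to the quotient.\<close>

lemma saturated_nbhds_imp_Hausdorff:
  assumes cl: "\<And>x. x \<in> topspace X \<Longrightarrow> closed_point v x" and sat: saturated_nbhds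
  shows "Hausdorff_space (orbit_space X v)"
  unfolding Hausdorff_space_def topspace_orbit_space
proof (intro allI impI)
  fix P Q assume "P \<in> orbit v ` topspace X \<and> Q \<in> orbit v ` topspace X \<and> P \<noteq> Q"
  then obtain x y where xy: "x \<in> topspace X" "P = orbit v x" "y \<in> topspace X" "Q = orbit v y" "P \<noteq> Q" by blast
  then have "y \<notin> orbit v x" using orbit_eq by blast
  then have dj: "disjnt P Q" using orbit_disjoint xy by (auto simp: disjnt_def)
  have "compactin X P" "compactin X Q" using compact_orbit cl xy by auto
  then obtain U V where UV: "openin X U" "openin X V" "P \<subseteq> U" "Q \<subseteq> V" "disjnt U V"
    using Hausdorff_space_compact_separation[OF Hausdorff _ _ dj] by metis
  obtain A where A: "openin X A" "invariant A" "x \<in> A" "A \<subseteq> U"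
    using saturated_nbhdsD[OF sat xy(1) UV(1)] UV(3) xy(2) by blast
  obtain B where B: "openin X B" "invariant B" "y \<in> B" "B \<subseteq> V"
    using saturated_nbhdsD[OF sat xy(3) UV(2)] UV(4) xy(4) by blast
  have op: "openin (orbit_space X v) (orbit v ` D)" if "openin X D" "invariant D" for D
    using that openin_subset[OF that(1)] Union_orbits[of D] by (auto simp: openin_orbit_space)
  have "disjnt (orbit v ` A) (orbit v ` B)"
  proof -
    have False if "a \<in> A" "b \<in> B" "orbit v a = orbit v b" for a b
    proof -
      have "a \<in> orbit v b" using that orbit_self openin_subset[OF A(1)] by blast
      then have "a \<in> B" using invariant_orbit[OF B(2) that(2)] by blast
      then show False using that A(4) B(4) UV(5) by (auto simp: disjnt_iff)
    qed
    then show ?thesis by (auto simp: disjnt_iff)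
  qed
  then show "\<exists>U V. openin (orbit_space X v) U \<and> openin (orbit_space X v) V \<and> P \<in> U \<and> Q \<in> V \<and> disjnt U V"
    using op[OF A(1,2)] op[OF B(1,2)] A(3) B(3) xy by blast
qed

lemma Hausdorff_imp_closed_orbit:
  assumes T2: "Hausdorff_space (orbit_space X v)" and x: "x \<in> topspace X"
  shows "closedin X (orbit v x)"
proof -
  have "closedin (orbit_space X v) {orbit v x}"
    using T2 x closedin_Hausdorff_singleton topspace_orbit_space by (metis imageI)
  from closedin_continuous_map_preimage[OF continuous_orbit_map this]
  have "closedin X {y \<in> topspace X. orbit v y \<in> {orbit v x}}" .
  moreover have "{y \<in> topspace X. orbit v y \<in> {orbit v x}} = orbit v x"
    using orbit_eq[OF x] orbit_self orbit_subset[OF x] by blast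
  ultimately show ?thesis by simp
qed

text \<open>The quotient map goes from a compact space to a Hausdorff space, hence is closed. The
  invariant neighbourhood consists of the points whose orbits miss the complement of
  \<open>N\<close>.\<close>

lemma Hausdorff_imp_saturated_nbhds:
  assumes T2: "Hausdorff_space (orbit_space X v)"
  shows saturated_nbhds
  unfolding saturated_nbhds_def
proof (intro ballI allI impI)
  fix x N assume x: "x \<in> topspace X" and N: "openin X N" "orbit v x \<subseteq> N"
  define K where "K = topspace X - N"
  have "closedin X K" unfolding K_def by (rule closedin_diff[OF closedin_topspace N(1)])
  then have "compactin X K" using compact closedin_compact_space by blast
  then have "closedin (orbit_space X v) (orbit v ` K)"
    using T2 compactin_imp_closedin image_compactin[OF _ continuous_orbit_map] by blast
  then have "openin (orbit_space X v) (topspace (orbit_space X v) - orbit v ` K)" by blast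
  from openin_continuous_map_preimage[OF continuous_orbit_map this]
  have "openin X {y \<in> topspace X. orbit v y \<notin> orbit v ` K}"
    by (simp add: topspace_orbit_space cong: conj_cong)
  moreover have "invariant {y \<in> topspace X. orbit v y \<notin> orbit v ` K}"
    using orbit_eq by (auto simp: invariant_def orbit_def[of v] image_iff) (metis orbit_def orbit_eq rangeI)
  moreover have "orbit v x \<notin> orbit v ` K"
    using N(2) orbit_self by (force simp: K_def)
  moreover have "{y \<in> topspace X. orbit v y \<notin> orbit v ` K} \<subseteq> N" by (auto simp: K_def)
  ultimately show "\<exists>A. openin X A \<and> invariant A \<and> x \<in> A \<and> A \<subseteq> N" using x by blast
qed

text \<open>A closed orbit is a Baire space, hence finitely many translates of a compact arc of it cover it.\<close>

lemma closed_orbit_imp_closed_point: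
  assumes x: "x \<in> topspace X" and cl: "closedin X (orbit v x)"
  shows "closed_point v x"
proof (rule ccontr)
  assume "\<not> closed_point v x"
  then have np: "v t x \<noteq> x" if "t > 0" for t using that by (auto simp: closed_point_def periodic_point_def)
  have inj: "s = t" if "v s x = v t x" for s t
  proof -
    have "x = v (t - s) x" "x = v (s - t) x" using that flow_eq_iff[OF x x, of s t] flow_eq_iff[OF x x, of t
        s] by auto
    then show ?thesis using np[of "t - s"] np[of "s - t"] by (cases s t rule: linorder_cases) auto
  qed
  define K where "K = orbit v x"
  have Kc: "compactin X K" using cl compact closedin_compact_space by (auto simp: K_def)
  define Y where "Y = subtopology X K"
  have tY: "topspace Y = K" using orbit_subset[OF x] by (auto simp: Y_def K_def)
  have Yc: "compact_space Y" using Kc by (simp add: Y_def compact_space_subtopology)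
  have YH: "Hausdorff_space Y" using Hausdorff by (simp add: Y_def Hausdorff_space_subtopology)
  define S where "S n = (\<lambda>t. v t x) ` {- real n..real n}" for n
  have Scl: "closedin Y (S n)" for n
  proof -
    have "compactin X (S n)" unfolding S_def
      using image_compactin[OF _ continuous_flow_point[OF x]] by simp
    then have "closedin X (S n)" using Hausdorff compactin_imp_closedin by blast
    moreover have "S n \<subseteq> K" by (auto simp: S_def K_def orbit_def)
    ultimately show ?thesis unfolding Y_def by (meson closedin_subset_topspace)
  qed
  have US: "\<Union>(range S) = K"
  proof
    show "K \<subseteq> \<Union>(range S)"
    proof
      fix y assume "y \<in> K"
      then obtain t where "y = v t x" by (auto simp: K_def orbit_def)
      moreover obtain n where "\<bar>t\<bar> \<le> real n" using real_arch_simple by blast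
      ultimately have "y \<in> S n" unfolding S_def by (intro image_eqI[of _ _ t]) auto
      then show "y \<in> \<Union>(range S)" by blast
    qed
  qed (auto simp: S_def K_def orbit_def)
  have "\<exists>n. Y interior_of (S n) \<noteq> {}"
  proof (rule ccontr)
    assume "\<not> ?thesis"
    then have "Y interior_of \<Union>(range S) = {}"
      using Yc YH Scl compact_imp_locally_compact_space compact_Hausdorff_imp_regular_space
      by (intro Baire_category_alt) auto
    then have "K = {}" using US tY by (metis interior_of_topspace)
    then show False using orbit_self[OF x] by (auto simp: K_def)
  qed
  then obtain n z where "z \<in> Y interior_of (S n)" by blast
  then obtain W where W: "openin Y W" "z \<in> W" "W \<subseteq> S n" by (auto simp: interior_of_def)
  then obtain G where G: "openin X G" "W = G \<inter> K" unfolding Y_def openin_subtopology by blast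
  obtain s where s: "z = v s x" using W G by (auto simp: K_def orbit_def)
  have "\<exists>F. finite F \<and> F \<subseteq> range (\<lambda>t. v t ` G) \<and> K \<subseteq> \<Union>F"
  proof (rule compactinD[OF Kc])
    show "openin X U" if "U \<in> range (\<lambda>t. v t ` G)" for U using that openin_flow_image[OF G(1)] by auto
    show "K \<subseteq> \<Union>(range (\<lambda>t. v t ` G))"
    proof
      fix y assume "y \<in> K"
      then obtain t where "y = v t x" by (auto simp: K_def orbit_def)
      then have "y = v (t - s) z" using x by (simp add: s flow_flow)
      moreover have "z \<in> G" using W G by blast
      ultimately show "y \<in> \<Union>(range (\<lambda>t. v t ` G))" by blast
    qed
  qed
  then obtain D where D: "finite D" "K \<subseteq> (\<Union>t\<in>D. v t ` G)" by (metis finite_subset_image)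
  \<comment> \<open>A bound for the times needed to reach any point of the orbit; the point at time
    \<open>M + 1\<close> then contradicts \<open>inj\<close>.\<close>
  define M where "M = real n + Max (insert 0 (abs ` D))"
  have M: "\<exists>r. \<bar>r\<bar> \<le> M \<and> y = v r x" if yK: "y \<in> K" for y
  proof -
    obtain t g where t: "t \<in> D" "g \<in> G" "y = v t g" using subsetD[OF D(2) yK] by blast
    have gt: "g \<in> topspace X" using t(2) openin_subset[OF G(1)] by auto
    then have "g = v (- t) y" using t by simp
    then have "g \<in> K" using flow_in_orbit[OF x, of y "- t"] yK by (simp add: K_def)
    then have "g \<in> S n" using W G t by auto
    then obtain r where "r \<in> {- real n..real n}" "g = v r x" unfolding S_def by blast
    then have r: "\<bar>r\<bar> \<le> real n" "g = v r x" by auto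
    have "\<bar>t\<bar> \<le> Max (insert 0 (abs ` D))" using t(1) D(1) by (intro Max_ge) auto
    then have "\<bar>t + r\<bar> \<le> M" using r by (auto simp: M_def)
    then show ?thesis using t r x by (intro exI[of _ "t + r"]) (auto simp: flow_flow)
  qed
  have "v (M + 1) x \<in> K" by (auto simp: K_def orbit_def)
  then obtain r where "\<bar>r\<bar> \<le> M" "v (M + 1) x = v r x" using M by blast
  then show False using inj[of "M + 1" r] by auto
qed

text \<open>In the disc model the radius is constant along orbits, so small concentric discs are
  invariant.\<close>

lemma center_saturated_nbhd:
  assumes c: "center X v x" and N: "openin X N" "x \<in> N"
  shows "\<exists>A. openin X A \<and> invariant A \<and> x \<in> A \<and> A \<subseteq> N"
proof -
  obtain U h where U: "openin X U" "x \<in> U" "\<forall>y\<in>U. \<forall>t. v t y \<in> U"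
    and h: "homeomorphic_map (subtopology X U) (top_of_set (ball 0 1)) h"
    and \<tau>: "\<forall>y\<in>U. \<exists>\<tau>. strict_mono \<tau> \<and> surj \<tau> \<and> (\<forall>t. h (v t y) = rot_flow (\<tau> t) (h y))"
    and x: "x \<in> topspace X" "singular_point v x"
    using c unfolding center_def by blast
  have tU: "topspace (subtopology X U) = U" using openin_subset[OF U(1)] by auto
  \<comment> \<open>The reparametrisation takes the value \<open>pi\<close>, so \<open>h x\<close>
    is fixed by the half turn.\<close>
  have h0: "h x = 0"
  proof -
    obtain \<tau> where "surj \<tau>" "\<And>t. h (v t x) = rot_flow (\<tau> t) (h x)" using \<tau> U(2) by blast
    moreover then obtain t where "\<tau> t = pi" by (metis surjD)
    ultimately have "h x = rot_flow pi (h x)" using x(2) by (metis singular_point_def)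
    then have "h x = - h x" by (simp add: rot_flow_def exp_eq_polar cis_conv_exp[symmetric])
    then show ?thesis by simp
  qed
  have norm_h: "norm (h (v t y)) = norm (h y)" if "y \<in> U" for y t
    using \<tau> that by (metis norm_exp_i_times norm_mult mult_1 rot_flow_def)
  have ho: "openin (top_of_set (ball 0 1)) (h ` (U \<inter> N))"
    using homeomorphic_imp_open_map[OF h] U(1) N(1) unfolding open_map_def
    by (metis inf_le1 openin_Int openin_open_subtopology)
  then have "open (h ` (U \<inter> N))" by (metis open_ball openin_open_eq)
  moreover have "0 \<in> h ` (U \<inter> N)" using h0 U N by force
  ultimately obtain r where r: "r > 0" "ball 0 r \<subseteq> h ` (U \<inter> N)" using open_contains_ball by blast
  have hinj: "inj_on h U" using homeomorphic_imp_injective_map[OF h] tU by simp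
  define A where "A = {y \<in> topspace (subtopology X U). h y \<in> ball 0 r}"
  have "continuous_map (subtopology X U) euclidean h"
    using homeomorphic_imp_continuous_map[OF h] by (auto simp: continuous_map_in_subtopology)
  then have "openin (subtopology X U) A" unfolding A_def by (rule openin_continuous_map_preimage) auto
  then have "openin X A" using U(1) openin_trans_full by blast
  moreover have "invariant A" using U(3) norm_h unfolding invariant_def A_def tU by auto
  moreover have "x \<in> A" using U(2) h0 r(1) by (auto simp: A_def tU simp del: topspace_subtopology)
  moreover have "A \<subseteq> N"
  proof
    fix y assume y: "y \<in> A"
    then obtain z where "z \<in> U \<inter> N" "h y = h z" using r(2) by (auto simp: A_def)
    then show "y \<in> N" using hinj y by (auto simp: A_def tU inj_on_def simp del: topspace_subtopology)
  qed
  ultimately show ?thesis by blast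
qed

end

context closed_flow
begin

lemma singular_imp_saturated_nbhds:
  assumes sing: "singular_set X v = topspace X \<or> (\<forall>x\<in>singular_set X v. center X v x)"
  shows saturated_nbhds
  unfolding saturated_nbhds_def
proof (intro ballI allI impI)
  fix x N assume x: "x \<in> topspace X" and N: "openin X N" "orbit v x \<subseteq> N"
  consider (all) "singular_set X v = topspace X" | (center) "center X v x" | (periodic) "periodic_point v x"
    using sing closed_points[OF x] x by (auto simp: singular_set_def closed_point_def)
  then show "\<exists>A. openin X A \<and> invariant A \<and> x \<in> A \<and> A \<subseteq> N"
  proof cases
    case all
    have "v t y = y" if "y \<in> N" for y t
      using all that openin_subset[OF N(1)] by (auto simp: singular_set_def singular_point_def)
    then have "invariant N" by (simp add: invariant_def)
    then show ?thesis using N orbit_self[OF x] by blast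
  next
    case center
    then show ?thesis using center_saturated_nbhd N orbit_self[OF x] by blast
  next
    case periodic
    then show ?thesis using saturated_nbhd_periodic x N by blast
  qed
qed

end

section \<open>Separation by periodic orbits\<close>

context surface_flow
begin

text \<open>Path components rather than components: a path is compact, so it remains disjoint from
  all orbits near a given one. By \<open>connected_linked\<close> the two notions agree off a closed
  set.\<close>

abbreviation linked :: "'a set \<Rightarrow> 'a \<Rightarrow> 'a \<Rightarrow> bool" where
  "linked S \<equiv> path_component_of (subtopology X (topspace X - S))"

lemma chart_path:
  assumes c: "chart B h k C" and "convex C" and ab: "a \<in> B" "b \<in> B"
  shows "path_component_of (subtopology X B) a b"
proof -
  have seg: "closed_segment (h a) (h b) \<subseteq> C" using assms chart_h(1)[OF c] by (simp add: closed_segment_subset)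
  then have lp: "linepath (h a) (h b) t \<in> C" if "t \<in> {0..1}" for t
    using that by (metis image_eqI linepath_image_01 subsetD)
  have "continuous_map (top_of_set {0..1}) X (\<lambda>t. k (linepath (h a) (h b) t))"
    by (rule chart_continuous_k[OF c]) (use lp in \<open>auto intro: continuous_on_linepath\<close>)
  then have "pathin (subtopology X B) (\<lambda>t. k (linepath (h a) (h b) t))"
    using chart_k(1)[OF c] lp by (auto simp: pathin_def continuous_map_in_subtopology)
  then show ?thesis unfolding path_component_of_def
    using chart_h(2)[OF c] ab by (intro exI[of _ "\<lambda>t. k (linepath (h a) (h b) t)"]) (auto simp: linepath_def)
qed

lemma linked_chart:
  assumes "closedin X S" "b \<in> topspace X - S"
  obtains B where "openin X B" "b \<in> B" "B \<subseteq> topspace X - S" "\<And>c. c \<in> B \<Longrightarrow> linked S b c"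
proof -
  have "openin X (topspace X - S)" using assms by blast
  from disc_chart[OF this assms(2)] obtain B h k r where B: "r > 0" "chart B h k (ball (h b) r \<inter> half_plane)"
      "b \<in> B" "B \<subseteq> topspace X - S"
    by metis
  have "linked S b c" if "c \<in> B" for c
  proof -
    have "path_component_of (subtopology X B) b c"
      by (rule chart_path[OF B(2) _ B(3) that]) (intro convex_Int convex_half_plane convex_ball)
    then show ?thesis using B(4) by (auto simp: path_component_of_def pathin_subtopology)
  qed
  then show ?thesis using that B chart_openin[OF B(2)] by blast
qed

lemma linked_in: "linked S a b \<Longrightarrow> a \<in> topspace X - S \<and> b \<in> topspace X - S"
  using path_component_in_topspace by fastforce

lemma open_linked:
  assumes "closedin X S" shows "openin X {b. linked S a b}"
proof (subst openin_subopen, clarify)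
  fix b assume ab: "linked S a b"
  then have bS: "b \<in> topspace X - S" using linked_in by blast
  obtain B where B: "openin X B" "b \<in> B" "\<And>c. c \<in> B \<Longrightarrow> linked S b c" by (rule linked_chart[OF assms bS], rule
      that)
  have "linked S a c" if "c \<in> B" for c by (rule path_component_of_trans[OF ab B(3)[OF that]])
  then show "\<exists>T. openin X T \<and> b \<in> T \<and> T \<subseteq> {b. linked S a b}"
    using B by (intro exI[of _ B]) blast
qed

lemma open_not_linked:
  assumes "closedin X S" shows "openin X {b \<in> topspace X - S. \<not> linked S a b}"
proof (subst openin_subopen, clarify)
  fix b assume b: "b \<in> topspace X" "b \<notin> S" "\<not> linked S a b"
  then obtain B where B: "openin X B" "b \<in> B" "B \<subseteq> topspace X - S" "\<And>c. c \<in> B \<Longrightarrow> linked S b c"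
    using linked_chart[OF assms, of b] by blast
  have "B \<subseteq> {b \<in> topspace X - S. \<not> linked S a b}"
  proof
    fix c assume "c \<in> B"
    then have "linked S c b" using B(4) path_component_of_sym by metis
    then show "c \<in> {b \<in> topspace X - S. \<not> linked S a b}"
      using b(3) path_component_of_trans linked_in by fastforce
  qed
  then show "\<exists>T. openin X T \<and> b \<in> T \<and> T \<subseteq> {b \<in> topspace X - S. \<not> linked S a b}" using B by blast
qed

lemma linked_not_separated:
  assumes l: "linked S a b" and UV: "openin X U" "openin X V" "U \<inter> V = {}" "topspace X - S \<subseteq> U \<union> V" and a: "a
      \<in> U"
  shows "b \<in> U"
proof (rule ccontr)
  assume b: "b \<notin> U"
  obtain g where g: "pathin (subtopology X (topspace X - S)) g" "g 0 = a" "g 1 = b"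
    using l unfolding path_component_of_def by blast
  define T where "T = g ` {0..1}"
  have T: "connectedin (subtopology X (topspace X - S)) T" "a \<in> T" "b \<in> T"
    using connectedin_path_image[OF g(1)] g(2,3) by (force simp: T_def)+
  then have T': "connectedin X T" "T \<subseteq> topspace X - S" by (auto simp: connectedin_subtopology)
  then have "b \<in> V" using b T UV(4) by blast
  then show False using T T' UV a unfolding connectedin by (metis (no_types, lifting) Int_assoc Int_empty_left
      disjoint_iff order_trans)
qed

text \<open>Charts make the path components of the complement open, so two different ones would
  disconnect \<open>D\<close>.\<close>

lemma connected_linked:
  assumes S: "closedin X S" and D: "connectedin X D" "D \<inter> S = {}" "a \<in> D" "b \<in> D"
  shows "linked S a b"
proof (rule ccontr)
  assume n: "\<not> linked S a b"
  have Dt: "D \<subseteq> topspace X - S" using D connectedin_subset_topspace by blast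
  define U where "U = {b. linked S a b}"
  define V where "V = {b \<in> topspace X - S. \<not> linked S a b}"
  have "openin X U" "openin X V" "D \<subseteq> U \<union> V" "U \<inter> V \<inter> D = {}"
    using open_linked[OF S] open_not_linked[OF S] Dt by (auto simp: U_def V_def)
  moreover have "a \<in> U" using D Dt by (auto simp: U_def path_component_of_refl)
  moreover have "b \<in> V" using D Dt n by (auto simp: V_def)
  ultimately show False using D(1,3,4) unfolding connectedin by blast
qed

text \<open>A disc or half disc stays connected without one point because it is convex of dimension
  2. In a separation of \<open>D - {b}\<close> the punctured chart \<open>B - {b}\<close> lies on
  one side, and adding \<open>b\<close> to that side would separate \<open>D\<close>.\<close>

lemma connected_delete:
  assumes D: "openin X D" "connectedin X D"
  shows "connectedin X (D - {b})"
proof (cases "b \<in> D")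
  case True
  obtain B h k r where B: "r > 0" "chart B h k (ball (h b) r \<inter> half_plane)" "b \<in> B" "B \<subseteq> D"
    by (rule disc_chart[OF D(1) True])
  define C where "C = ball (h b) r \<inter> half_plane"
  have ch: "chart B h k C" using B by (simp add: C_def)
  have bt: "b \<in> topspace X" using True D openin_subset by blast
  have "h b \<in> half_plane" using chart_h(1)[OF ch B(3)] by (simp add: C_def)
  have "aff_dim C = 2"
  proof -
    define G where "G = ball (h b) r \<inter> {w. Im w > 0}"
    have "open G" unfolding G_def by (intro open_Int open_ball open_halfspace_Im_gt)
    moreover have "G \<subseteq> C" by (auto simp: G_def C_def half_plane_def)
    moreover have "h b + of_real (r/2) * \<i> \<in> G"
      using B(1) \<open>h b \<in> half_plane\<close> by (auto simp: G_def half_plane_def dist_norm norm_mult)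
    ultimately have "h b + of_real (r/2) * \<i> \<in> interior C" by (meson interiorI)
    then have "interior C \<noteq> {}" by blast
    then show ?thesis by (simp add: aff_dim_nonempty_interior)
  qed
  then have "connected (C - {h b})"
    by (intro connected_punctured_convex) (auto simp: C_def intro!: convex_Int convex_half_plane)
  then have "connectedin (top_of_set C) (C - {h b})" by (auto simp: connectedin_subtopology)
  moreover have "continuous_map (top_of_set C) X k"
    using chart_continuous_k[OF ch, of "top_of_set C" "\<lambda>w. w"] by simp
  ultimately have "connectedin X (k ` (C - {h b}))" using connectedin_continuous_map_image by blast
  moreover have "k ` (C - {h b}) = B - {b}"
  proof
    show "k ` (C - {h b}) \<subseteq> B - {b}" using chart_k[OF ch] by auto
    show "B - {b} \<subseteq> k ` (C - {h b})"
    proof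
      fix z assume z: "z \<in> B - {b}"
      then have "z = k (h z)" "h z \<in> C" "h z \<noteq> h b" using chart_h[OF ch, of z] chart_h[OF ch B(3)] by auto
      then show "z \<in> k ` (C - {h b})" by blast
    qed
  qed
  ultimately have Bb: "connectedin X (B - {b})" by simp
  have oB: "openin X B" using chart_openin[OF ch] .
  have sep: False if E: "openin X E1" "openin X E2" "D - {b} \<subseteq> E1 \<union> E2" "E1 \<inter> E2 \<inter> (D - {b}) = {}"
    "E2 \<inter> (D - {b}) \<noteq> {}" "E2 \<inter> (B - {b}) = {}" for E1 E2
  proof -
    have "closedin X {b}" using Hausdorff bt by (simp add: closedin_Hausdorff_singleton)
    then have "openin X (E1 \<union> B)" "openin X (E2 - {b})" using E oB by (auto intro: openin_diff)
    moreover have "D \<subseteq> (E1 \<union> B) \<union> (E2 - {b})" "(E1 \<union> B) \<inter> (E2 - {b}) \<inter> D = {}" using E B(3) by auto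
    moreover have "(E1 \<union> B) \<inter> D \<noteq> {}" "(E2 - {b}) \<inter> D \<noteq> {}" using E(5) True B(3) by auto
    ultimately show False using D(2) unfolding connectedin by blast
  qed
  show ?thesis
    unfolding connectedin
  proof (intro conjI notI)
    show "D - {b} \<subseteq> topspace X" using D openin_subset by blast
    assume "\<exists>E1 E2. openin X E1 \<and> openin X E2 \<and> D - {b} \<subseteq> E1 \<union> E2 \<and> E1 \<inter> E2 \<inter> (D - {b}) = {} \<and> E1 \<inter> (D - {b})
        \<noteq> {} \<and> E2 \<inter> (D - {b}) \<noteq> {}"
    then obtain E1 E2 where E: "openin X E1" "openin X E2" "D - {b} \<subseteq> E1 \<union> E2" "E1 \<inter> E2 \<inter> (D - {b}) = {}"
       "E1 \<inter> (D - {b}) \<noteq> {}" "E2 \<inter> (D - {b}) \<noteq> {}" by blast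
    have "E1 \<inter> (B - {b}) = {} \<or> E2 \<inter> (B - {b}) = {}"
    proof (rule ccontr)
      assume "\<not> ?thesis"
      moreover have "B - {b} \<subseteq> E1 \<union> E2" "E1 \<inter> E2 \<inter> (B - {b}) = {}" using E B(4) by auto
      ultimately show False using Bb E(1,2) unfolding connectedin by blast
    qed
    then show False using sep[of E1 E2] sep[of E2 E1] E by (auto simp: Un_commute Int_commute)
  qed
qed (use D in simp)

lemma linked_point:
  assumes "b \<in> topspace X" "a \<in> topspace X" "c \<in> topspace X" "a \<noteq> b" "c \<noteq> b"
  shows "linked {b} a c"
proof (rule connected_linked[of "{b}" "topspace X - {b}"])
  show "connectedin X (topspace X - {b})"
    by (rule connected_delete) (use connected in \<open>auto simp: connectedin_topspace\<close>)
  show "closedin X {b}" using Hausdorff assms(1) by (simp add: closedin_Hausdorff_singleton)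
qed (use assms in auto)

end

locale hausdorff_flow = closed_flow +
  assumes sat: saturated_nbhds
begin

text \<open>A path witnessing the link is compact, so its complement is open and contains an
  invariant neighbourhood of the orbit.\<close>

lemma linked_near:
  assumes y: "y \<in> topspace X" and l: "linked (orbit v y) a b"
  obtains A where "openin X A" "y \<in> A" "\<And>z. z \<in> A \<Longrightarrow> linked (orbit v z) a b"
proof -
  obtain g where g: "pathin X g" "\<And>t. t \<in> {0..1} \<Longrightarrow> g t \<in> topspace X - orbit v y" "g 0 = a" "g 1 = b"
    using l by (auto simp: path_component_of_def pathin_subtopology)
  have "compactin X (g ` {0..1})" by (rule compactin_path_image[OF g(1)])
  then have "closedin X (g ` {0..1})" using Hausdorff compactin_imp_closedin by blast
  then have "openin X (topspace X - g ` {0..1})" by blast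
  moreover have "orbit v y \<subseteq> topspace X - g ` {0..1}" using g(2) orbit_subset[OF y] by blast
  ultimately obtain A where A: "openin X A" "invariant A" "y \<in> A" "A \<subseteq> topspace X - g ` {0..1}"
    by (rule saturated_nbhdsD[OF sat y])
  have "linked (orbit v z) a b" if z: "z \<in> A" for z
  proof -
    have "orbit v z \<subseteq> A" using invariant_orbit A z by blast
    then have "g t \<in> topspace X - orbit v z" if "t \<in> {0..1}" for t using g(2)[OF that] A(4) that by blast
    then show ?thesis unfolding path_component_of_def pathin_subtopology using g by blast
  qed
  then show ?thesis using that A by blast
qed

lemma clopen_trivial:
  assumes "openin X U" "openin X V" "U \<union> V = topspace X" "U \<inter> V = {}"
  shows "U = {} \<or> V = {}"
  using connected assms unfolding connected_space_def by blast

lemma connectedin_split: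
  assumes "connectedin X D" "openin X U" "openin X V" "U \<inter> V = {}" "D \<subseteq> U \<union> V"
  shows "D \<subseteq> U \<or> D \<subseteq> V"
proof (rule ccontr)
  assume "\<not> ?thesis"
  then have "U \<inter> D \<noteq> {}" "V \<inter> D \<noteq> {}" using assms(5) by blast+
  then show False using assms unfolding connectedin by blast
qed

text \<open>Rescaling time by the period presents the saturation as a continuous image of the
  compact rectangle \<open>{a..b} \<times> {0..1}\<close>.\<close>

lemma two_sided_compact_sat:
  assumes ts: "two_sided d \<gamma>" and s: "{a..b} \<subseteq> {-d<..<d}"
  shows "closedin X (sat (\<gamma> ` {a..b}))"
proof -
  have \<gamma>: "continuous_map (top_of_set {-d<..<d}) X \<gamma>" "continuous_on {-d<..<d} (\<lambda>s. period (\<gamma> s))"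
    and per: "\<And>s. s \<in> {-d<..<d} \<Longrightarrow> periodic_point v (\<gamma> s)"
    using ts by (auto simp: two_sided_def)
  have t: "\<gamma> s \<in> topspace X" if "s \<in> {-d<..<d}" for s using \<gamma>(1) that by (auto simp: continuous_map_def)
  define K where "K = {a..b} \<times> {0..1::real}"
  have "continuous_map (top_of_set K) (top_of_set {-d<..<d}) fst"
    using s by (auto simp: continuous_map_in_subtopology K_def intro: continuous_on_fst continuous_on_id)
  then have 1: "continuous_map (top_of_set K) X (\<lambda>p. \<gamma> (fst p))"
    using continuous_map_compose[OF _ \<gamma>(1)] unfolding o_def by blast
  have "continuous_on K (\<lambda>p. snd p * period (\<gamma> (fst p)))"
    by (intro continuous_intros continuous_on_compose2[OF \<gamma>(2)]) (use s in \<open>auto simp: K_def\<close>)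
  then have 2: "continuous_map (top_of_set K) X (\<lambda>p. v (snd p * period (\<gamma> (fst p))) (\<gamma> (fst p)))"
    by (intro continuous_flow 1) simp
  have "compactin (top_of_set K) K" by (simp add: compactin_subtopology K_def compact_Times)
  from image_compactin[OF this 2]
  have c: "compactin X ((\<lambda>p. v (snd p * period (\<gamma> (fst p))) (\<gamma> (fst p))) ` K)" .
  have "(\<lambda>p. v (snd p * period (\<gamma> (fst p))) (\<gamma> (fst p))) ` K = sat (\<gamma> ` {a..b})"
  proof
    show "(\<lambda>p. v (snd p * period (\<gamma> (fst p))) (\<gamma> (fst p))) ` K \<subseteq> sat (\<gamma> ` {a..b})"
      by (force simp: K_def sat_def)
    show "sat (\<gamma> ` {a..b}) \<subseteq> (\<lambda>p. v (snd p * period (\<gamma> (fst p))) (\<gamma> (fst p))) ` K"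
    proof
      fix z assume "z \<in> sat (\<gamma> ` {a..b})"
      then obtain r \<sigma> where z: "z = v r (\<gamma> \<sigma>)" "\<sigma> \<in> {a..b}" by (auto simp: sat_def)
      have \<sigma>: "\<sigma> \<in> {-d<..<d}" using z s by blast
      define P where "P = period (\<gamma> \<sigma>)"
      have P: "P > 0" "v P (\<gamma> \<sigma>) = \<gamma> \<sigma>" using period_pos flow_period t per \<sigma> by (auto simp: P_def)
      obtain t' where t': "0 \<le> t'" "t' < P" "v t' (\<gamma> \<sigma>) = z" using flow_mod_period[OF t[OF \<sigma>] P, of r] z by
          metis
      have "(\<sigma>, t' / P) \<in> K" using z t' P by (auto simp: K_def)
      moreover have "z = (\<lambda>p. v (snd p * period (\<gamma> (fst p))) (\<gamma> (fst p))) (\<sigma>, t' / P)"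
        using t' P by (simp add: P_def)
      ultimately show "z \<in> (\<lambda>p. v (snd p * period (\<gamma> (fst p))) (\<gamma> (fst p))) ` K" by blast
    qed
  qed
  then show ?thesis using c Hausdorff compactin_imp_closedin by metis
qed

text \<open>Reduces orbits on the negative side of the annulus to orbits on the positive
  side.\<close>

lemma two_sided_reflect:
  assumes "two_sided d \<gamma>" shows "two_sided d (\<lambda>s. \<gamma> (- s))"
proof -
  have a: "d > 0" "continuous_map (top_of_set {-d<..<d}) X \<gamma>" "continuous_on {-d<..<d} (\<lambda>s. period (\<gamma> s))"
    "\<And>s. s \<in> {-d<..<d} \<Longrightarrow> periodic_point v (\<gamma> s)"
    "\<And>s s'. s \<in> {-d<..<d} \<Longrightarrow> s' \<in> {-d<..<d} \<Longrightarrow> \<gamma> s' \<in> orbit v (\<gamma> s) \<Longrightarrow> s = s'"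
    "\<And>V. open V \<Longrightarrow> V \<subseteq> {-d<..<d} \<Longrightarrow> openin X (sat (\<gamma> ` V))" using assms by (auto simp: two_sided_def)
  have "continuous_map (top_of_set {-d<..<d}) (top_of_set {-d<..<d}) (\<lambda>s. - s)"
    by (auto simp: continuous_map_in_subtopology intro: continuous_intros)
  from continuous_map_compose[OF this a(2)] have 1: "continuous_map (top_of_set {-d<..<d}) X (\<lambda>s. \<gamma> (- s))"
    by (simp add: o_def)
  have 2: "continuous_on {-d<..<d} (\<lambda>s. period (\<gamma> (- s)))"
    by (rule continuous_on_compose2[OF a(3)]) (auto intro: continuous_intros)
  have 3: "openin X (sat ((\<lambda>s. \<gamma> (- s)) ` V))" if "open V" "V \<subseteq> {-d<..<d}" for V
  proof -
    have "openin X (sat (\<gamma> ` (uminus ` V)))" using that by (intro a(6) open_negations) auto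
    then show ?thesis by (simp add: image_image)
  qed
  have 4: "s = s'" if "s \<in> {-d<..<d}" "s' \<in> {-d<..<d}" "\<gamma> (- s') \<in> orbit v (\<gamma> (- s))" for s s'
    using a(5)[of "- s" "- s'"] that by auto
  have 5: "periodic_point v (\<gamma> (- s))" if "s \<in> {-d<..<d}" for s using a(4)[of "- s"] that by auto
  show ?thesis unfolding two_sided_def using a(1) 1 2 3 4 5 by blast
qed

text \<open>Moving the orbit from parameter 0 to \<open>s\<close> transfers the part of the annulus
  in between from the side \<open>V\<close> to the side \<open>U\<close>. The new sides
  \<open>U'\<close> and \<open>V'\<close> are again open, and \<open>b\<close> stays on its side
  because it lies off the annulus.\<close>

lemma two_sided_separation:
  assumes ts: "two_sided d \<gamma>" and UV: "openin X U" "openin X V" "U \<inter> V = {}" "U \<union> V = topspace X - orbit v (\<gamma>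
      0)"
    and neg: "sat (\<gamma> ` {-d<..<0}) \<subseteq> U" and pos: "sat (\<gamma> ` {0<..<d}) \<subseteq> V"
    and s: "0 < s" "s < d"
    and ab: "a \<in> U" "b \<in> V" "b \<notin> sat (\<gamma> ` {-d<..<d})"
  shows "\<not> linked (orbit v (\<gamma> s)) a b"
proof
  assume l: "linked (orbit v (\<gamma> s)) a b"
  have d: "d > 0" "\<And>V. open V \<Longrightarrow> V \<subseteq> {-d<..<d} \<Longrightarrow> openin X (sat (\<gamma> ` V))" using ts by (auto simp: two_sided_def)
  define U' where "U' = U \<union> sat (\<gamma> ` {-d<..<s})"
  define V' where "V' = V - sat (\<gamma> ` {0..s})"
  have satU: "sat (\<gamma> ` A) = (\<Union>s\<in>A. sat {\<gamma> s})" for A by (auto simp: sat_def)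
  have sato: "sat {\<gamma> s} = orbit v (\<gamma> s)" for s by (auto simp: sat_def orbit_def)
  have "openin X U'" unfolding U'_def by (intro openin_Un UV(1) d(2)) (use s in auto)
  moreover have "openin X V'" unfolding V'_def
    by (intro openin_diff UV(2) two_sided_compact_sat[OF ts]) (use s d in auto)
  moreover have "U' \<inter> V' = {}"
  proof -
    have "{-d<..<s} = {-d<..<0} \<union> {0..<s}" using s d by auto
    then have "sat (\<gamma> ` {-d<..<s}) = sat (\<gamma> ` {-d<..<0}) \<union> sat (\<gamma> ` {0..<s})" by (simp add: satU UN_Un)
    moreover have "sat (\<gamma> ` {0..<s}) \<subseteq> sat (\<gamma> ` {0..s})" by (force simp: sat_def)
    ultimately show ?thesis using neg UV(3) by (auto simp: U'_def V'_def)
  qed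
  moreover have "topspace X - orbit v (\<gamma> s) \<subseteq> U' \<union> V'"
  proof
    fix z assume z: "z \<in> topspace X - orbit v (\<gamma> s)"
    show "z \<in> U' \<union> V'"
    proof (cases "z \<in> U \<union> V")
      case True
      then show ?thesis
      proof (cases "z \<in> sat (\<gamma> ` {0..s})")
        case True
        then obtain \<sigma> where \<sigma>: "\<sigma> \<in> {0..s}" "z \<in> orbit v (\<gamma> \<sigma>)" unfolding satU sato by blast
        then have "\<sigma> \<noteq> s" using z by auto
        then have "z \<in> sat (\<gamma> ` {-d<..<s})" unfolding satU sato using \<sigma> d by auto
        then show ?thesis by (auto simp: U'_def)
      qed (auto simp: U'_def V'_def)
    next
      case False
      then have "z \<in> orbit v (\<gamma> 0)" using z UV(4) by auto
      then have "z \<in> sat (\<gamma> ` {-d<..<s})" unfolding satU sato using s d by auto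
      then show ?thesis by (auto simp: U'_def)
    qed
  qed
  ultimately have "b \<in> U'" using linked_not_separated[OF l] ab(1) by (auto simp: U'_def)
  moreover have "sat (\<gamma> ` {-d<..<s}) \<subseteq> sat (\<gamma> ` {-d<..<d})" using s by (force simp: sat_def)
  ultimately show False using ab UV(3) by (auto simp: U'_def)
qed

text \<open>If the whole collar lay on one side, adding the orbit to that side would give an open
  set and disconnect \<open>X\<close>.\<close>

lemma separating_collar:
  assumes UV: "openin X U" "openin X V" "U \<inter> V = {}" "U \<union> V = topspace X - orbit v y" and ab: "a \<in> U" "b \<in> V"
    and A: "openin X A" "orbit v y \<subseteq> A"
  shows "\<not> A - orbit v y \<subseteq> U" "\<not> A - orbit v y \<subseteq> V"
proof -
  have At: "A \<subseteq> topspace X" using A openin_subset by blast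
  show "\<not> A - orbit v y \<subseteq> U"
  proof
    assume "A - orbit v y \<subseteq> U"
    then have "U \<union> A = {} \<or> V = {}" by (intro clopen_trivial) (use UV A At in auto)
    then show False using ab by blast
  qed
  show "\<not> A - orbit v y \<subseteq> V"
  proof
    assume "A - orbit v y \<subseteq> V"
    then have "V \<union> A = {} \<or> U = {}" by (intro clopen_trivial) (use UV A At in auto)
    then show False using ab by blast
  qed
qed

text \<open>An orbit with a connected punctured collar separates nothing: the collar would have to
  lie on one side, against \<open>separating_collar\<close>.\<close>

lemma connected_collar_linked:
  assumes y: "y \<in> topspace X" and A: "openin X A" "orbit v y \<subseteq> A" "connectedin X (A - orbit v y)"
    and ab: "a \<in> topspace X - orbit v y" "b \<in> topspace X - orbit v y"
  shows "linked (orbit v y) a b"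
proof (rule ccontr)
  assume n: "\<not> linked (orbit v y) a b"
  have cl: "closedin X (orbit v y)" using closed_orbit[OF y closed_points[OF y]] .
  define U where "U = {c. linked (orbit v y) a c}"
  define V where "V = {c \<in> topspace X - orbit v y. \<not> linked (orbit v y) a c}"
  have UV: "openin X U" "openin X V" "U \<inter> V = {}" "U \<union> V = topspace X - orbit v y"
    using open_linked[OF cl] open_not_linked[OF cl] linked_in by (auto simp: U_def V_def)
  have aU: "a \<in> U" using ab(1) by (auto simp: U_def path_component_of_refl)
  have bV: "b \<in> V" using ab(2) n by (auto simp: V_def)
  have "A - orbit v y \<subseteq> U \<union> V" using UV(4) openin_subset[OF A(1)] by blast
  then show False using connectedin_split[OF A(3) UV(1-3)] separating_collar[OF UV aU bV A(1,2)] by blast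
qed

text \<open>Together with \<open>linked_near\<close>, this says that the way in which a periodic orbit separates two
  points does not change under small displacements of the orbit.\<close>

lemma not_linked_near:
  assumes y: "y \<in> topspace X" and per: "periodic_point v y"
    and ab: "a \<in> topspace X - orbit v y" "b \<in> topspace X - orbit v y" and n: "\<not> linked (orbit v y) a b"
  obtains A where "openin X A" "y \<in> A" "\<And>z. z \<in> A \<Longrightarrow> \<not> linked (orbit v z) a b"
proof -
  have cl: "closedin X (orbit v y)" using closed_orbit[OF y closed_points[OF y]] .
  define U where "U = {c. linked (orbit v y) a c}"
  define V where "V = {c \<in> topspace X - orbit v y. \<not> linked (orbit v y) a c}"
  have UV: "openin X U" "openin X V" "U \<inter> V = {}" "U \<union> V = topspace X - orbit v y"
    using open_linked[OF cl] open_not_linked[OF cl] linked_in by (auto simp: U_def V_def)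
  have aU: "a \<in> U" using ab(1) by (auto simp: U_def path_component_of_refl)
  have bV: "b \<in> V" using ab(2) n by (auto simp: V_def)
  show ?thesis
  proof (rule one_or_two_sided[OF y per])
    fix A assume A: "openin X A" "invariant A" "y \<in> A" "connectedin X (A - orbit v y)"
    show ?thesis
      using connected_collar_linked[OF y A(1) invariant_orbit[OF A(2,3)] A(4) ab] n by blast
  next
    fix d0 \<gamma> assume ts0: "two_sided d0 \<gamma>" and \<gamma>0: "\<gamma> 0 = y"
    \<comment> \<open>The annulus is shrunk until it avoids \<open>a\<close> and
      \<open>b\<close>.\<close>
    have "closedin X {a, b}"
      using Hausdorff ab by (metis DiffD1 closedin_Hausdorff_finite empty_subsetI finite.emptyI finite.insertI
          insert_subset)
    then have oab: "openin X (topspace X - {a, b})" by blast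
    have "orbit v y \<subseteq> topspace X - {a, b}" using ab orbit_subset[OF y] by blast
    then obtain A0 where A0: "openin X A0" "invariant A0" "y \<in> A0" "A0 \<subseteq> topspace X - {a, b}"
      by (rule saturated_nbhdsD[OF sat y oab])
    have c0: "d0 > 0" "continuous_map (top_of_set {-d0<..<d0}) X \<gamma>" using ts0 by (auto simp: two_sided_def)
    have "openin (top_of_set {-d0<..<d0}) {s \<in> {-d0<..<d0}. \<gamma> s \<in> A0}"
      using openin_continuous_map_preimage[OF c0(2) A0(1)] by simp
    moreover have "0 \<in> {s \<in> {-d0<..<d0}. \<gamma> s \<in> A0}" using c0 \<gamma>0 A0 by auto
    ultimately obtain r where r: "r > 0" "ball 0 r \<inter> {-d0<..<d0} \<subseteq> {s \<in> {-d0<..<d0}. \<gamma> s \<in> A0}"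
      unfolding openin_contains_ball by blast
    define d where "d = min r d0"
    have d: "d > 0" "d \<le> d0" using r c0 by (auto simp: d_def)
    have inA0: "\<gamma> s \<in> A0" if "s \<in> {-d<..<d}" for s
    proof -
      have "s \<in> ball 0 r \<inter> {-d0<..<d0}" using that by (auto simp: d_def dist_real_def)
      then show ?thesis using r by blast
    qed
    have sub: "{-d<..<d} \<subseteq> {-d0<..<d0}" using d by auto
    have ts: "two_sided d \<gamma>"
      using ts0 d(1) sub unfolding two_sided_def
      by (intro conjI) (use sub in \<open>blast intro: continuous_on_subset continuous_map_from_subtopology_mono[OF
          _ sub]\<close>)+
    have satU: "sat (\<gamma> ` A) = (\<Union>s\<in>A. sat {\<gamma> s})" for A by (auto simp: sat_def)
    have sato: "sat {\<gamma> s} = orbit v (\<gamma> s)" for s by (auto simp: sat_def orbit_def)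
    define W where "W = sat (\<gamma> ` {-d<..<d})"
    have oW: "openin X W" using ts by (auto simp: two_sided_def W_def)
    have WA0: "W \<subseteq> A0" unfolding W_def satU sato using invariant_orbit[OF A0(2)] inA0 by blast
    have split: "{-d<..<d} = {-d<..<0} \<union> {0} \<union> {0<..<d}" using d by auto
    have W3: "W = sat (\<gamma> ` {-d<..<0}) \<union> orbit v y \<union> sat (\<gamma> ` {0<..<d})"
      unfolding W_def satU sato split by (auto simp: \<gamma>0)
    have disj: "orbit v (\<gamma> s) \<inter> orbit v y = {}" if "s \<in> {-d<..<d}" "s \<noteq> 0" for s
    proof (rule ccontr)
      assume "orbit v (\<gamma> s) \<inter> orbit v y \<noteq> {}"
      moreover have st: "\<gamma> s \<in> topspace X" using inA0 that A0(4) by blast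
      ultimately have "\<gamma> s \<in> orbit v (\<gamma> 0)" using orbit_disjoint[OF y st] \<gamma>0 by blast
      moreover have "0 \<in> {-d<..<d}" using d by auto
      ultimately have "0 = s" using ts that(1) unfolding two_sided_def by blast
      then show False using that by simp
    qed
    have ct: "continuous_map (top_of_set {-d<..<d}) X \<gamma>" using ts by (simp add: two_sided_def)
    have Wt: "W \<subseteq> topspace X" using oW openin_subset by blast
    have avoid: "sat (\<gamma> ` I) \<subseteq> topspace X - orbit v y" if I: "I \<subseteq> {-d<..<d}" "0 \<notin> I" for I
    proof
      fix z assume "z \<in> sat (\<gamma> ` I)"
      then obtain s where s: "s \<in> I" "z \<in> orbit v (\<gamma> s)" unfolding satU sato by blast
      then have s': "s \<in> {-d<..<d}" "s \<noteq> 0" using I by auto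
      have "z \<in> W" unfolding W_def satU sato using s(2) s'(1) by blast
      then show "z \<in> topspace X - orbit v y" using disj[OF s'] s(2) Wt by blast
    qed
    have neg: "sat (\<gamma> ` {-d<..<0}) \<subseteq> U \<union> V" and pos: "sat (\<gamma> ` {0<..<d}) \<subseteq> U \<union> V"
      unfolding UV(4) by (intro avoid; use d in auto)+
    have neg': "sat (\<gamma> ` {-d<..<0}) \<subseteq> U \<or> sat (\<gamma> ` {-d<..<0}) \<subseteq> V"
      by (rule connectedin_split[OF connected_sat[OF ct] UV(1-3) neg]) auto
    have pos': "sat (\<gamma> ` {0<..<d}) \<subseteq> U \<or> sat (\<gamma> ` {0<..<d}) \<subseteq> V"
      by (rule connectedin_split[OF connected_sat[OF ct] UV(1-3) pos]) auto
    have oyW: "orbit v y \<subseteq> W" using W3 by blast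
    have abW: "a \<notin> W" "b \<notin> W" using WA0 A0(4) by auto
    have nl: "\<not> linked (orbit v (\<gamma> s)) a b" if s: "s \<in> {-d<..<d}" for s
    proof -
      have refl: "sat ((\<lambda>s. \<gamma> (- s)) ` I) = sat (\<gamma> ` uminus ` I)" for I by (simp add: image_image)
      have UV': "U \<union> V = topspace X - orbit v (\<gamma> 0)" "V \<union> U = topspace X - orbit v (\<gamma> (- 0))" "V \<inter> U = {}"
          using UV \<gamma>0 by auto
      have ba: "\<not> linked (orbit v (\<gamma> s)) b a \<Longrightarrow> \<not> linked (orbit v (\<gamma> s)) a b" for s
        using path_component_of_sym by metis
      consider "s = 0" | "0 < s" "s < d" | "- d < s" "s < 0" using s by fastforce
      then show ?thesis
      proof cases
        case 1 then show ?thesis using n \<gamma>0 by simp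
      next
        case 2
        \<comment> \<open>The two halves of the annulus lie on different sides, since otherwise a
          whole collar would lie on one side.\<close>
        have "\<not> (sat (\<gamma> ` {-d<..<0}) \<subseteq> U \<and> sat (\<gamma> ` {0<..<d}) \<subseteq> U) \<and> \<not> (sat (\<gamma> ` {-d<..<0}) \<subseteq> V \<and> sat (\<gamma> `
            {0<..<d}) \<subseteq> V)"
          using separating_collar[OF UV aU bV oW oyW] W3 by blast
        then consider "sat (\<gamma> ` {-d<..<0}) \<subseteq> U" "sat (\<gamma> ` {0<..<d}) \<subseteq> V" | "sat (\<gamma> ` {-d<..<0}) \<subseteq> V" "sat (\<gamma> `
            {0<..<d}) \<subseteq> U"
          using neg' pos' by blast
        then show ?thesis
        proof cases
          case 1
          show ?thesis by (rule two_sided_separation[OF ts UV(1-3) UV'(1) 1 2 aU bV abW(2)[unfolded W_def]])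
        next
          case b: 2
          show ?thesis
            by (rule ba, rule two_sided_separation[OF ts UV(2,1) UV'(3) _ b 2 bV aU abW(1)[unfolded W_def]])
                (use UV'(1) in auto)
        qed
      next
        case 3
        note ts' = two_sided_reflect[OF ts]
        have im: "uminus ` {-d<..<0} = {0<..<d}" "uminus ` {0<..<d} = {-d<..<0}" "uminus ` {-d<..<d} =
            {-d<..<d}" by auto
        have s': "0 < - s" "- s < d" using 3 by auto
        have "\<not> (sat (\<gamma> ` {-d<..<0}) \<subseteq> U \<and> sat (\<gamma> ` {0<..<d}) \<subseteq> U) \<and> \<not> (sat (\<gamma> ` {-d<..<0}) \<subseteq> V \<and> sat (\<gamma> `
            {0<..<d}) \<subseteq> V)"
          using separating_collar[OF UV aU bV oW oyW] W3 by blast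
        then consider "sat (\<gamma> ` {0<..<d}) \<subseteq> V" "sat (\<gamma> ` {-d<..<0}) \<subseteq> U" | "sat (\<gamma> ` {0<..<d}) \<subseteq> U" "sat (\<gamma> `
            {-d<..<0}) \<subseteq> V"
          using neg' pos' by blast
        then show ?thesis
        proof cases
          case 1
          have "\<not> linked (orbit v (\<gamma> (- (- s)))) b a"
            by (rule two_sided_separation[OF ts' UV(2,1) UV'(3) _ _ _ s' bV aU])
               (use 1 abW UV' in \<open>simp_all add: refl im W_def\<close>)
          then show ?thesis using ba by simp
        next
          case 2
          have "\<not> linked (orbit v (\<gamma> (- (- s)))) a b"
            by (rule two_sided_separation[OF ts' UV(1-3) _ _ _ s' aU bV])
               (use 2 abW UV' in \<open>simp_all add: refl im W_def\<close>)
          then show ?thesis by simp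
        qed
      qed
    qed
    show ?thesis
    proof (rule that[OF oW])
      show "y \<in> W" using oyW orbit_self[OF y] by blast
      fix z assume "z \<in> W"
      then obtain s where s: "s \<in> {-d<..<d}" "z \<in> orbit v (\<gamma> s)" unfolding W_def satU sato by blast
      then have "orbit v z = orbit v (\<gamma> s)" using orbit_eq inA0 A0(4) by blast
      then show "\<not> linked (orbit v z) a b" using nl[OF s(1)] by simp
    qed
  qed
qed

section \<open>Singular points separated by a periodic orbit\<close>

lemma periodic_iff: "x \<in> topspace X \<Longrightarrow> periodic_point v x \<longleftrightarrow> \<not> singular_point v x"
  using closed_points by (auto simp: closed_point_def periodic_point_def)

text \<open>A third singular point would be a one-point orbit, and such orbits do not separate by
  \<open>linked_point\<close>. It would lie in the nonseparating part of the connected set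
  \<open>D\<close>, while \<open>y\<close> lies in the separating part.\<close>

lemma separated_singular_points:
  assumes q: "q1 \<in> singular_set X v" "q2 \<in> singular_set X v"
    and y: "y \<in> topspace X" "periodic_point v y" "\<not> linked (orbit v y) q1 q2"
  shows "singular_set X v = {q1, q2}"
proof -
  have qt: "q1 \<in> topspace X" "q2 \<in> topspace X" "singular_point v q1" "singular_point v q2"
    using q by (auto simp: singular_set_def)
  define D where "D = topspace X - {q1} - {q2}"
  have "openin X (topspace X - {q1})" using Hausdorff qt by (intro openin_diff) (auto simp:
      closedin_Hausdorff_singleton)
  moreover have "connectedin X (topspace X - {q1})"
    by (rule connected_delete) (use connected in \<open>auto simp: connectedin_topspace\<close>)
  ultimately have D: "connectedin X D" unfolding D_def by (rule connected_delete)
  define P where "P = topspace X - singular_set X v"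
  have oP: "openin X P" unfolding P_def using closed_singular_set by blast
  define S where "S = {z \<in> P. \<not> linked (orbit v z) q1 q2}"
  define R where "R = {z \<in> D. linked (orbit v z) q1 q2}"
  \<comment> \<open>An open set between \<open>R\<close> and the set of all points whose orbits do
    not separate \<open>q1\<close> from \<open>q2\<close>.\<close>
  define G where "G = \<Union>{A. openin X A \<and> (\<forall>z\<in>A. linked (orbit v z) q1 q2)}"
  have notorb: "q \<notin> orbit v z" if "z \<in> P" "singular_point v q" for z q
    using that orbit_eq[of z q] orbit_self[of z] singular_orbit[of q] by (force simp: P_def singular_set_def)
  have "openin X S"
  proof (subst openin_subopen, clarify)
    fix z assume z: "z \<in> S"
    then have zP: "z \<in> P" and zt: "z \<in> topspace X" "periodic_point v z"
      using periodic_iff by (auto simp: S_def P_def singular_set_def)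
    obtain A where A: "openin X A" "z \<in> A" "\<And>z'. z' \<in> A \<Longrightarrow> \<not> linked (orbit v z') q1 q2"
      by (rule not_linked_near[OF zt, of q1 q2]) (use z notorb[OF zP] qt in \<open>auto simp: S_def\<close>)
    then show "\<exists>T. openin X T \<and> z \<in> T \<and> T \<subseteq> S" using oP zP by (intro exI[of _ "A \<inter> P"]) (auto simp: S_def)
  qed
  moreover have lin: "linked (orbit v z) q1 q2" if "z \<in> D" "z \<notin> P" for z
  proof -
    have "singular_point v z" "z \<in> topspace X" "q1 \<noteq> z" "q2 \<noteq> z" using that by (auto simp: D_def P_def
        singular_set_def)
    then show ?thesis using linked_point[of z q1 q2] qt by (simp add: singular_orbit)
  qed
  moreover have "openin X G" unfolding G_def by (rule openin_Union) auto
  moreover have RG: "R \<subseteq> G"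
  proof
    fix z assume z: "z \<in> R"
    then have zt: "z \<in> topspace X" and l: "linked (orbit v z) q1 q2" by (auto simp: R_def D_def)
    obtain A where "openin X A" "z \<in> A" "\<And>z'. z' \<in> A \<Longrightarrow> linked (orbit v z') q1 q2"
      using linked_near[OF zt l] by blast
    then show "z \<in> G" unfolding G_def by blast
  qed
  moreover have "D \<subseteq> S \<union> R" using lin by (auto simp: S_def R_def)
  moreover have "S \<inter> G \<inter> D = {}" by (auto simp: S_def G_def)
  moreover have "y \<in> S \<inter> D"
    using y qt periodic_iff[of y] by (auto simp: S_def D_def P_def singular_set_def)
  ultimately have "openin X S" "openin X G" "D \<subseteq> S \<union> G" "S \<inter> G \<inter> D = {}" "S \<inter> D \<noteq> {}" by blast+
  then have "G \<inter> D = {}"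
    using D unfolding connectedin by blast
  then have "D \<inter> R = {}" using RG by blast
  then have "D \<subseteq> P" using lin by (auto simp: R_def)
  then show ?thesis using q by (auto simp: D_def P_def singular_set_def)
qed

end

section \<open>Periodic orbits as Jordan curves\<close>

lemma connected_unbounded_outside:
  fixes S :: "complex set"
  assumes "connected U" "U \<inter> S = {}" "\<not> bounded U"
  shows "U \<subseteq> outside S"
proof
  fix x assume x: "x \<in> U"
  have "U \<subseteq> connected_component_set (- S) x"
    using assms x by (intro connected_component_maximal) auto
  then show "x \<in> outside S" using assms x bounded_subset by (auto simp: outside_def)
qed

context hausdorff_flow
begin

context
  fixes B h k C
  assumes c: "chart B h k C" and conv: "convex C"
begin

text \<open>One period, rescaled to the unit interval, is a simple closed path, so the Jordan curve
  theorem applies to its chart image. The inside stays in \<open>C\<close> because the complement of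
  a convex set containing the curve belongs to the outside.\<close>

lemma
  assumes y: "y \<in> topspace X" "periodic_point v y" "orbit v y \<subseteq> B"
  shows inner_ne: "inside (h ` orbit v y) \<noteq> {}"
    and open_inner: "open (inside (h ` orbit v y))"
    and connected_inner: "connected (inside (h ` orbit v y))"
    and open_outer: "open (outside (h ` orbit v y))"
    and connected_outer: "connected (outside (h ` orbit v y))"
    and unbounded_outer: "\<not> bounded (outside (h ` orbit v y))"
    and inner_outer: "inside (h ` orbit v y) \<inter> outside (h ` orbit v y) = {}"
      "inside (h ` orbit v y) \<union> outside (h ` orbit v y) = - h ` orbit v y"
    and frontier_inner: "frontier (inside (h ` orbit v y)) = h ` orbit v y"
    and frontier_outer: "frontier (outside (h ` orbit v y)) = h ` orbit v y"
    and inner_subset: "inside (h ` orbit v y) \<subseteq> C"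
    and bounded_inner: "bounded (inside (h ` orbit v y))"
proof -
  define P where "P = period y"
  have P: "P > 0" "v P y = y" using period_pos flow_period y by (auto simp: P_def)
  define g where "g t = h (v (t * P) y)" for t
  have inB: "v t y \<in> B" for t using y(3) by (auto simp: orbit_def)
  have "continuous_map euclideanreal X (\<lambda>t. v (t * P) y)"
    using y by (intro continuous_flow) (auto intro!: continuous_intros)
  then have "continuous_map euclideanreal euclidean g"
    unfolding g_def by (intro chart_continuous_h[OF c]) (auto simp: inB)
  then have cont: "continuous_on UNIV g" by simp
  have path: "path g" unfolding path_def using cont continuous_on_subset by blast
  have loop: "pathfinish g = pathstart g" using P y by (simp add: g_def pathfinish_def pathstart_def)
  have "loop_free g"
    unfolding loop_free_def
  proof (intro ballI impI)
    fix s t :: real assume st: "s \<in> {0..1}" "t \<in> {0..1}" "g s = g t"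
    have "v (s * P) y = v (t * P) y" using st(3) chart_h(2)[OF c inB] by (metis g_def)
    then obtain m :: int where "t * P - s * P = of_int m * P"
      using flow_same_iff[OF y(1,2)] by (auto simp: P_def)
    then have "(t - s) * P = of_int m * P" by (simp add: algebra_simps)
    then have m: "t - s = of_int m" using P by simp
    have "m \<le> 1" "m \<ge> -1" using m st by auto
    then have "m = 0 \<or> m = 1 \<or> m = -1" by auto
    then show "s = t \<or> s = 0 \<and> t = 1 \<or> s = 1 \<and> t = 0" using m st by auto
  qed
  then have simple: "simple_path g" using path by (simp add: simple_path_def)
  have img: "path_image g = h ` orbit v y"
  proof -
    have "orbit v y = (\<lambda>t. v t y) ` {0..P}" by (rule orbit_eq_segment[OF y(1) P])
    also have "{0..P} = (\<lambda>t. t * P) ` {0..1}"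
    proof
      show "{0..P} \<subseteq> (\<lambda>t. t * P) ` {0..1}"
      proof
        fix t assume "t \<in> {0..P}"
        then show "t \<in> (\<lambda>t. t * P) ` {0..1}" using P by (intro image_eqI[of _ _ "t / P"]) auto
      qed
      show "(\<lambda>t. t * P) ` {0..1} \<subseteq> {0..P}" using P by (auto simp: mult_left_le_one_le)
    qed
    finally show ?thesis by (auto simp: path_image_def g_def image_image)
  qed
  note J = Jordan_inside_outside[OF simple loop, unfolded img]
  show "inside (h ` orbit v y) \<noteq> {}" "open (inside (h ` orbit v y))" "connected (inside (h ` orbit v y))"
    "open (outside (h ` orbit v y))" "connected (outside (h ` orbit v y))" "\<not> bounded (outside (h ` orbit v
        y))"
    "inside (h ` orbit v y) \<inter> outside (h ` orbit v y) = {}"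
    "inside (h ` orbit v y) \<union> outside (h ` orbit v y) = - h ` orbit v y"
    "frontier (inside (h ` orbit v y)) = h ` orbit v y"
    "frontier (outside (h ` orbit v y)) = h ` orbit v y"
    "bounded (inside (h ` orbit v y))"
    using J by blast+
  have "h ` orbit v y \<subseteq> C" using y(3) chart_h(1)[OF c] by auto
  then have "- C \<subseteq> outside (h ` orbit v y)" by (rule outside_subset_convex[OF conv])
  then show "inside (h ` orbit v y) \<subseteq> C" using J by blast
qed

text \<open>Transfer of the Jordan interior to the surface. The closed disc is compact in the chart,
  hence closed in all of \<open>X\<close> and not only in \<open>B\<close>.\<close>

lemma
  assumes y: "y \<in> topspace X" "periodic_point v y" "orbit v y \<subseteq> B"
  shows open_disc: "openin X (k ` inside (h ` orbit v y))"
    and closed_disc: "closedin X (k ` inside (h ` orbit v y) \<union> orbit v y)"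
    and connected_disc: "connectedin X (k ` inside (h ` orbit v y))"
    and disc_disjoint: "k ` inside (h ` orbit v y) \<inter> orbit v y = {}"
    and disc_subset: "k ` inside (h ` orbit v y) \<subseteq> B"
    and disc_iff: "z \<in> B \<Longrightarrow> z \<in> k ` inside (h ` orbit v y) \<longleftrightarrow> h z \<in> inside (h ` orbit v y)"
proof -
  define S where "S = h ` orbit v y"
  have sub: "inside S \<subseteq> C" using inner_subset[OF y] by (simp add: S_def)
  have SC: "S \<subseteq> C" using y(3) chart_h(1)[OF c] by (auto simp: S_def)
  have ck: "continuous_map (top_of_set C) X k"
    using chart_continuous_k[OF c, of "top_of_set C" "\<lambda>w. w"] by simp
  show "openin X (k ` inside (h ` orbit v y))"
    using chart_open_k'[OF c open_inner[OF y] inner_subset[OF y]] .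
  show "k ` inside (h ` orbit v y) \<subseteq> B" using sub chart_k(1)[OF c] by (auto simp: S_def)
  have "connectedin (top_of_set C) (inside S)"
    using connected_inner[OF y] sub by (auto simp: connectedin_subtopology S_def)
  then show "connectedin X (k ` inside (h ` orbit v y))"
    using connectedin_continuous_map_image[OF ck] by (simp add: S_def)
  have "inside S \<union> S = closure (inside S)"
    unfolding closure_Un_frontier using frontier_inner[OF y] by (simp add: S_def)
  then have "compact (inside S \<union> S)" using bounded_inner[OF y] by (simp add: S_def compact_closure)
  then have "compactin (top_of_set C) (inside S \<union> S)" using sub SC by (auto simp: compactin_subtopology)
  from image_compactin[OF this ck] have "compactin X (k ` (inside S \<union> S))" .
  moreover have "k ` S = orbit v y"
    unfolding S_def image_image using chart_h(2)[OF c] y(3) by (force simp: image_iff)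
  ultimately have "compactin X (k ` inside S \<union> orbit v y)" by (simp add: image_Un)
  then show "closedin X (k ` inside (h ` orbit v y) \<union> orbit v y)"
    using compactin_imp_closedin[OF Hausdorff] by (simp add: S_def)
  show iff: "z \<in> k ` inside (h ` orbit v y) \<longleftrightarrow> h z \<in> inside (h ` orbit v y)" if "z \<in> B" for z
    using that chart_h(2)[OF c, of z] chart_k(2)[OF c] sub unfolding S_def by (force simp: image_iff)
  show "k ` inside (h ` orbit v y) \<inter> orbit v y = {}"
  proof (rule ccontr)
    assume "\<not> ?thesis"
    then obtain z where z: "z \<in> k ` inside (h ` orbit v y)" "z \<in> orbit v y" by blast
    then have "h z \<in> inside S" using iff y(3) by (auto simp: S_def)
    moreover have "h z \<in> S" using z by (auto simp: S_def)
    ultimately show False using inner_outer(2)[OF y] unfolding S_def by blast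
  qed
qed

text \<open>The disc is connected and open, and together with the orbit it is closed in
  \<open>X\<close>, so it is a full component of the complement of the orbit. This describes the
  Jordan interior by separation in \<open>X\<close>, where the stability results apply.\<close>

lemma linked_disc:
  assumes y: "y \<in> topspace X" "periodic_point v y" "orbit v y \<subseteq> B"
    and a: "a \<in> k ` inside (h ` orbit v y)" and b: "b \<in> topspace X - orbit v y"
  shows "linked (orbit v y) a b \<longleftrightarrow> b \<in> k ` inside (h ` orbit v y)"
proof
  let ?D = "k ` inside (h ` orbit v y)"
  assume l: "linked (orbit v y) a b"
  have "openin X (topspace X - (?D \<union> orbit v y))" using closed_disc[OF y] by blast
  then show "b \<in> ?D"
    using linked_not_separated[OF l open_disc[OF y]] a by blast
next
  assume "b \<in> k ` inside (h ` orbit v y)"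
  then show "linked (orbit v y) a b"
    using connected_linked[OF closed_orbit[OF y(1) closed_points[OF y(1)]] connected_disc[OF y]
        disc_disjoint[OF y] a] by blast
qed

text \<open>An orbit that starts in the disc is connected and avoids the bounding orbit, so it
  cannot leave the component.\<close>

lemma invariant_disc:
  assumes y: "y \<in> topspace X" "periodic_point v y" "orbit v y \<subseteq> B"
  shows "invariant (k ` inside (h ` orbit v y))"
  unfolding invariant_def
proof (intro ballI allI)
  fix z t assume z: "z \<in> k ` inside (h ` orbit v y)"
  have zt: "z \<in> topspace X" using z disc_subset[OF y] chart_subset[OF c] by blast
  have "z \<notin> orbit v y" using z disc_disjoint[OF y] by blast
  then have d: "orbit v z \<inter> orbit v y = {}" using orbit_disjoint[OF y(1) zt] by blast
  have vz: "v t z \<in> orbit v z" by (auto simp: orbit_def)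
  have "linked (orbit v y) z (v t z)"
    by (rule connected_linked[OF closed_orbit[OF y(1) closed_points[OF y(1)]] connected_orbit[OF zt] d
        orbit_self[OF zt] vz])
  moreover have "v t z \<in> topspace X - orbit v y" using d vz zt by auto
  ultimately show "v t z \<in> k ` inside (h ` orbit v y)" using linked_disc[OF y z] by blast
qed

text \<open>The closed exterior of the larger curve is connected, unbounded and misses the smaller
  curve, so it lies outside the smaller curve.\<close>

lemma inner_mono:
  assumes y: "y \<in> topspace X" "periodic_point v y" "orbit v y \<subseteq> B"
    and z: "z \<in> topspace X" "periodic_point v z" and zy: "z \<in> k ` inside (h ` orbit v y)"
  shows "orbit v z \<subseteq> B" "inside (h ` orbit v z) \<union> h ` orbit v z \<subseteq> inside (h ` orbit v y)"
proof -
  have oz: "orbit v z \<subseteq> k ` inside (h ` orbit v y)" by (rule invariant_orbit[OF invariant_disc[OF y] zy])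
  then show zB: "orbit v z \<subseteq> B" using disc_subset[OF y] by blast
  have S: "h ` orbit v z \<subseteq> inside (h ` orbit v y)" using oz zB disc_iff[OF y] by blast
  define U where "U = closure (outside (h ` orbit v y))"
  have U: "U = outside (h ` orbit v y) \<union> h ` orbit v y"
    unfolding U_def closure_Un_frontier frontier_outer[OF y] ..
  have "connected U" unfolding U_def by (rule connected_imp_connected_closure[OF connected_outer[OF y]])
  moreover have "U \<inter> h ` orbit v z = {}" using S inner_outer[OF y] unfolding U by blast
  moreover have "\<not> bounded U" using unbounded_outer[OF y] bounded_subset U by blast
  ultimately have "U \<subseteq> outside (h ` orbit v z)" by (rule connected_unbounded_outside)
  then have "inside (h ` orbit v z) \<subseteq> inside (h ` orbit v y)"
    using inner_outer[OF y] inner_outer[OF z zB] unfolding U by blast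
  then show "inside (h ` orbit v z) \<union> h ` orbit v z \<subseteq> inside (h ` orbit v y)" using S by blast
qed

text \<open>With no singular point inside, every point of the disc is periodic and bounds its own
  closed disc. Zorn's lemma yields a minimal one, whose nonempty interior would contain a strictly
  smaller one.\<close>

lemma disc_contains_singular:
  assumes y: "y \<in> topspace X" "periodic_point v y" "orbit v y \<subseteq> B"
  shows "\<exists>q \<in> k ` inside (h ` orbit v y). singular_point v q"
proof (rule ccontr)
  assume contra: "\<not> ?thesis"
  then have ns: "\<not> singular_point v q" if "q \<in> k ` inside (h ` orbit v y)" for q using that by blast
  define K where "K z = inside (h ` orbit v z) \<union> h ` orbit v z" for z
  define D where "D = orbit v y \<union> k ` inside (h ` orbit v y)"
  have D: "z \<in> topspace X" "periodic_point v z" "orbit v z \<subseteq> B" if z: "z \<in> D" for z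
  proof -
    have "z \<in> topspace X \<and> periodic_point v z \<and> orbit v z \<subseteq> B"
    proof (cases "z \<in> orbit v y")
      case True
      then obtain t where zt: "z = v t y" by (auto simp: orbit_def)
      have "z \<in> topspace X" "\<not> singular_point v z"
        using zt y(1) singular_flow[OF y(1), of t] periodic_iff[OF y(1)] y(2) by auto
      moreover have "orbit v z = orbit v y" by (rule orbit_eq[OF y(1) True])
      ultimately show ?thesis using y periodic_iff by auto
    next
      case False
      then have zd: "z \<in> k ` inside (h ` orbit v y)" using z by (auto simp: D_def)
      then have "z \<in> topspace X" "periodic_point v z"
        using ns[OF zd] disc_subset[OF y] chart_subset[OF c] periodic_iff by auto
      then show ?thesis using inner_mono(1)[OF y _ _ zd] by blast
    qed
    then show "z \<in> topspace X" "periodic_point v z" "orbit v z \<subseteq> B" by auto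
  qed
  have oD: "orbit v z \<subseteq> D" if "z \<in> D" for z
    using that orbit_eq[OF y(1)] invariant_orbit[OF invariant_disc[OF y]] unfolding D_def by blast
  have Kcomp: "compact (K z)" if "z \<in> D" for z
  proof -
    have "K z = closure (inside (h ` orbit v z))"
      unfolding K_def closure_Un_frontier frontier_inner[OF D(1-3)[OF that]] ..
    then show ?thesis using bounded_inner[OF D(1-3)[OF that]] by (simp add: compact_closure)
  qed
  have hin: "h z \<in> h ` orbit v z" if "z \<in> D" for z using orbit_self[OF D(1)[OF that]] by auto
  have inner: "k w \<in> D \<and> K (k w) \<subseteq> inside (h ` orbit v z)" if z: "z \<in> D" and w: "w \<in> inside (h ` orbit v z)"
      for z w
  proof -
    have zd: "k w \<in> k ` inside (h ` orbit v z)" using w by blast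
    have "inside (h ` orbit v z) \<subseteq> inside (h ` orbit v y)"
    proof (cases "z \<in> orbit v y")
      case True then show ?thesis using orbit_eq[OF y(1)] by simp
    next
      case False
      then show ?thesis using z inner_mono(2)[OF y D(1,2)[OF z]] by (auto simp: D_def)
    qed
    then have kD: "k w \<in> D" using w by (auto simp: D_def)
    then show ?thesis using inner_mono(2)[OF D(1-3)[OF z] D(1,2)[OF kD] zd] by (auto simp: K_def)
  qed
  have KK: "k w \<in> D \<and> K (k w) \<subseteq> K z" if z: "z \<in> D" and w: "w \<in> K z" for z w
  proof (cases "w \<in> inside (h ` orbit v z)")
    case True
    then show ?thesis using inner[OF z True] by (auto simp: K_def)
  next
    case False
    then obtain x where x: "x \<in> orbit v z" "w = h x" using w by (auto simp: K_def)
    then have "k w = x" using chart_h(2)[OF c] D(3)[OF z] by auto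
    moreover have "orbit v x = orbit v z" using x orbit_eq D(1)[OF z] by auto
    ultimately show ?thesis using x oD[OF z] by (auto simp: K_def)
  qed
  \<comment> \<open>Complements, because \<open>subset_Zorn\<close> produces maximal sets while a
    minimal closed disc is wanted.\<close>
  have "\<exists>M\<in>(\<lambda>z. - K z) ` D. \<forall>Y\<in>(\<lambda>z. - K z) ` D. M \<subseteq> Y \<longrightarrow> Y = M"
  proof (rule subset_Zorn)
    fix \<C> assume ch: "subset.chain ((\<lambda>z. - K z) ` D) \<C>"
    then have sub: "\<C> \<subseteq> (\<lambda>z. - K z) ` D" and lin: "\<And>Y Z. Y \<in> \<C> \<Longrightarrow> Z \<in> \<C> \<Longrightarrow> Y \<subseteq> Z \<or> Z \<subseteq> Y"
      by (auto simp: subset_chain_def)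
    have yD: "y \<in> D" using orbit_self[OF y(1)] by (auto simp: D_def)
    show "\<exists>U\<in>(\<lambda>z. - K z) ` D. \<forall>Y\<in>\<C>. Y \<subseteq> U"
    proof (cases "\<C> = {}")
      case True then show ?thesis using yD by blast
    next
      case False
      \<comment> \<open>A chain of nonempty compact discs has a common point \<open>w\<close>; by
        \<open>KK\<close> the closed disc of \<open>k w\<close> lies in all of them.\<close>
      have "\<Inter>(uminus ` \<C>) \<noteq> {}"
      proof (rule compact_chain)
        show "compact S" if "S \<in> uminus ` \<C>" for S using that sub Kcomp by force
        show "{} \<notin> uminus ` \<C>" using sub hin by (force simp: K_def)
        show "S \<subseteq> T \<or> T \<subseteq> S" if "S \<in> uminus ` \<C> \<and> T \<in> uminus ` \<C>" for S T using that lin by blast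
      qed
      then obtain w where w: "\<And>Y. Y \<in> \<C> \<Longrightarrow> w \<notin> Y" by blast
      have *: "k w \<in> D \<and> Y \<subseteq> - K (k w)" if Y: "Y \<in> \<C>" for Y
      proof -
        obtain z where "z \<in> D" "Y = - K z" using Y sub by blast
        then show ?thesis using KK[of z w] w[OF Y] by auto
      qed
      then show ?thesis using False by blast
    qed
  qed
  then obtain M where M: "M \<in> (\<lambda>z. - K z) ` D" "\<forall>Y\<in>(\<lambda>z. - K z) ` D. M \<subseteq> Y \<longrightarrow> Y = M" ..
  then obtain z0 where z0: "z0 \<in> D" "M = - K z0" by (elim imageE)
  have max: "- K z = - K z0" if "z \<in> D" "- K z0 \<subseteq> - K z" for z
    using M(2)[rule_format, of "- K z"] that z0(2) by simp
  obtain w where w: "w \<in> inside (h ` orbit v z0)" using inner_ne[OF D[OF z0(1)]] by blast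
  have kw: "k w \<in> D" "K (k w) \<subseteq> inside (h ` orbit v z0)" using inner[OF z0(1) w] by auto
  then have "K (k w) = K z0" using max[of "k w"] by (auto simp: K_def)
  then have "h z0 \<in> inside (h ` orbit v z0)" using kw hin[OF z0(1)] by (auto simp: K_def)
  then show False using hin[OF z0(1)] inner_outer[OF D[OF z0(1)]] by blast
qed

end

text \<open>Otherwise the singular set would be open as well as closed.\<close>

lemma singular_accumulation:
  assumes ne: "singular_set X v \<noteq> topspace X" "singular_set X v \<noteq> {}"
  obtains p where "p \<in> singular_set X v" "\<And>N. openin X N \<Longrightarrow> p \<in> N \<Longrightarrow> \<exists>y\<in>N. periodic_point v y"
proof (rule ccontr)
  assume contra: "\<not> thesis"
  note acc = that
  have "openin X (singular_set X v)"
  proof (subst openin_subopen, intro ballI)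
    fix p assume p: "p \<in> singular_set X v"
    have "\<exists>N. openin X N \<and> p \<in> N \<and> (\<forall>y\<in>N. \<not> periodic_point v y)"
    proof (rule ccontr)
      assume "\<not> ?thesis"
      then have thesis by (intro acc[OF p]) blast
      with contra show False ..
    qed
    then obtain N where N: "openin X N" "p \<in> N" "\<forall>y\<in>N. \<not> periodic_point v y" by blast
    have "N \<subseteq> singular_set X v"
      using N periodic_iff openin_subset[OF N(1)] by (auto simp: singular_set_def)
    then show "\<exists>T. openin X T \<and> p \<in> T \<and> T \<subseteq> singular_set X v" using N by blast
  qed
  moreover have "openin X (topspace X - singular_set X v)" using closed_singular_set by blast
  ultimately have "singular_set X v = {} \<or> topspace X - singular_set X v = {}"
    by (intro clopen_trivial) (auto simp: singular_set_def)
  then show False using ne by (auto simp: singular_set_def)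
qed

text \<open>Near a limit \<open>p\<close> of periodic points there is a periodic orbit inside a
  chart that misses another singular point \<open>p'\<close>. Its disc contains a singular point
  \<open>q\<close>, so the orbit separates \<open>q\<close> from \<open>p'\<close> and
  \<open>separated_singular_points\<close> leaves no third one.\<close>

lemma singular_card:
  assumes ne: "singular_set X v \<noteq> topspace X"
  shows "finite (singular_set X v) \<and> card (singular_set X v) \<le> 2"
proof (cases "singular_set X v = {}")
  case False
  obtain p where p: "p \<in> singular_set X v" and acc: "\<And>N. openin X N \<Longrightarrow> p \<in> N \<Longrightarrow> \<exists>y\<in>N. periodic_point v y"
    by (rule singular_accumulation[OF ne False], rule that)
  show ?thesis
  proof (cases "singular_set X v = {p}")
    case False
    then obtain p' where p': "p' \<in> singular_set X v" "p' \<noteq> p" using p by blast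
    have pt: "p \<in> topspace X" "p' \<in> topspace X" "singular_point v p" using p p' by (auto simp:
        singular_set_def)
    have oN: "openin X (topspace X - {p'})"
      using Hausdorff pt by (intro openin_diff) (auto simp: closedin_Hausdorff_singleton)
    have pN: "p \<in> topspace X - {p'}" using pt p' by auto
    obtain B h k r where B: "r > 0" "chart B h k (ball (h p) r \<inter> half_plane)" "p \<in> B" "B \<subseteq> topspace X - {p'}"
      by (rule disc_chart[OF oN pN])
    have conv: "convex (ball (h p) r \<inter> half_plane)" by (intro convex_Int convex_ball convex_half_plane)
    have "orbit v p \<subseteq> B" using B(3) singular_orbit[OF pt(3)] by simp
    then obtain A where A: "openin X A" "invariant A" "p \<in> A" "A \<subseteq> B"
      by (rule saturated_nbhdsD[OF sat pt(1) chart_openin[OF B(2)]])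
    obtain y where y: "y \<in> A" "periodic_point v y" using acc[OF A(1,3)] by blast
    have yt: "y \<in> topspace X" "orbit v y \<subseteq> B" using y(1) openin_subset[OF A(1)] invariant_orbit[OF A(2) y(1)]
        A(4) by blast+
    note yy = yt(1) y(2) yt(2)
    obtain q where q: "q \<in> k ` inside (h ` orbit v y)" "singular_point v q"
      using disc_contains_singular[OF B(2) conv yy] by blast
    have qB: "q \<in> B" using q disc_subset[OF B(2) conv yy] by blast
    have "p' \<notin> B" using B(4) by blast
    then have "p' \<notin> k ` inside (h ` orbit v y)" "p' \<in> topspace X - orbit v y"
      using disc_subset[OF B(2) conv yy] pt yt by auto
    then have "\<not> linked (orbit v y) q p'" using linked_disc[OF B(2) conv yy q(1)] by blast
    moreover have "q \<in> singular_set X v" using q(2) qB chart_subset[OF B(2)] by (auto simp: singular_set_def)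
    ultimately have "singular_set X v = {q, p'}" using separated_singular_points[OF _ p'(1) yy(1,2)] by blast
    then show ?thesis by (simp add: card_insert_if)
  qed simp
qed simp

end

section \<open>Polar coordinates for nested periodic orbits\<close>

text \<open>A planar flow that is periodic off \<open>w0\<close>, detached from charts and surfaces.
  The function \<open>\<alpha>\<close> labels the orbits; by \<open>shrink\<close>, orbits with
  sufficiently large labels are close to \<open>w0\<close>, and \<open>local_curve\<close> provides
  transversals on which the label is injective.\<close>

locale planar_center =
  fixes \<Omega> :: "complex set" and w0 :: complex and V :: "real \<Rightarrow> complex \<Rightarrow> complex"
    and T :: "complex \<Rightarrow> real" and \<alpha> :: "complex \<Rightarrow> real" and M :: real
  assumes open_dom: "open \<Omega>" and connected_dom: "connected \<Omega>" and ne_dom: "\<Omega> - {w0} \<noteq> {}"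
    and continuous_V: "continuous_on (UNIV \<times> \<Omega>) (\<lambda>(t, w). V t w)"
    and V_V: "w \<in> \<Omega> \<Longrightarrow> V s (V t w) = V (s + t) w"
    and V_in: "w \<in> \<Omega> - {w0} \<Longrightarrow> V t w \<in> \<Omega> - {w0}"
    and T_pos: "w \<in> \<Omega> - {w0} \<Longrightarrow> T w > 0"
    and T_iff: "w \<in> \<Omega> - {w0} \<Longrightarrow> V s w = V t w \<longleftrightarrow> (\<exists>k::int. t - s = of_int k * T w)"
    and T_V: "w \<in> \<Omega> - {w0} \<Longrightarrow> T (V t w) = T w"
    and continuous_\<alpha>: "continuous_on (\<Omega> - {w0}) \<alpha>"
    and \<alpha>_iff: "w \<in> \<Omega> - {w0} \<Longrightarrow> w' \<in> \<Omega> - {w0} \<Longrightarrow> \<alpha> w = \<alpha> w' \<longleftrightarrow> (\<exists>t. w' = V t w)"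
    and \<alpha>_less: "w \<in> \<Omega> - {w0} \<Longrightarrow> \<alpha> w < M"
    and local_curve: "w \<in> \<Omega> - {w0} \<Longrightarrow> \<exists>(d::real) \<kappa>. d > 0 \<and> continuous_on {-d<..<d} \<kappa> \<and> \<kappa> ` {-d<..<d} \<subseteq> \<Omega> -
        {w0} \<and> \<kappa> 0 = w \<and>
      inj_on (\<lambda>s. \<alpha> (\<kappa> s)) {-d<..<d} \<and> continuous_on {-d<..<d} (\<lambda>s. T (\<kappa> s))"
    and shrink: "e > 0 \<Longrightarrow> \<exists>w\<in>\<Omega> - {w0}. \<forall>w'\<in>\<Omega> - {w0}. \<alpha> w < \<alpha> w' \<longrightarrow> dist w0 w' < e"
    and w0_in: "w0 \<in> \<Omega>"
begin

text \<open>A section of \<open>\<alpha>\<close>: a continuous choice of one point on each orbit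
  with label in \<open>S\<close>.\<close>

definition sec :: "real set \<Rightarrow> (real \<Rightarrow> complex) \<Rightarrow> bool" where
  "sec S \<sigma> \<longleftrightarrow> continuous_on S \<sigma> \<and> (\<forall>x\<in>S. \<sigma> x \<in> \<Omega> - {w0} \<and> \<alpha> (\<sigma> x) = x)"

definition rng :: "real set" where
  "rng = \<alpha> ` (\<Omega> - {w0})"

lemma T_cong: "w \<in> \<Omega> - {w0} \<Longrightarrow> w' \<in> \<Omega> - {w0} \<Longrightarrow> \<alpha> w = \<alpha> w' \<Longrightarrow> T w = T w'"
  using \<alpha>_iff T_V by metis

lemma \<alpha>_V: "w \<in> \<Omega> - {w0} \<Longrightarrow> \<alpha> (V t w) = \<alpha> w"
  using \<alpha>_iff V_in by metis

lemma continuous_V_compose: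
  assumes "continuous_on S f" "continuous_on S g" "g ` S \<subseteq> \<Omega>"
  shows "continuous_on S (\<lambda>x. V (f x) (g x))"
proof -
  have "continuous_on S (\<lambda>x. (\<lambda>(t, w). V t w) (f x, g x))"
    by (rule continuous_on_compose2[OF continuous_V]) (use assms in \<open>auto intro: continuous_intros\<close>)
  then show ?thesis by simp
qed

text \<open>Along a local transversal the label is a continuous injective real function of the
  parameter, so its image is open and its inverse continuous.\<close>

lemma local_section:
  assumes "x \<in> rng"
  obtains L \<sigma> where "open L" "x \<in> L" "L \<subseteq> rng" "sec L \<sigma>" "continuous_on L (\<lambda>x. T (\<sigma> x))"
proof -
  obtain w where w: "w \<in> \<Omega> - {w0}" "x = \<alpha> w" using assms by (auto simp: rng_def)
  obtain d :: real and \<kappa> where \<kappa>: "d > 0" "continuous_on {-d<..<d} \<kappa>" "\<kappa> ` {-d<..<d} \<subseteq> \<Omega> - {w0}" "\<kappa> 0 = w"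
      "inj_on (\<lambda>s. \<alpha> (\<kappa> s)) {-d<..<d}" "continuous_on {-d<..<d} (\<lambda>s. T (\<kappa> s))"
    using local_curve[OF w(1)] by metis
  define D where "D = {-d<..<d}"
  define f where "f s = \<alpha> (\<kappa> s)" for s
  have cf: "continuous_on D f"
    unfolding f_def D_def by (rule continuous_on_compose2[OF continuous_\<alpha> \<kappa>(2,3)])
  have inj: "inj_on f D" using \<kappa>(5) by (simp add: f_def D_def inj_on_def)
  define L where "L = f ` D"
  have oL: "open L"
    unfolding L_def by (rule injective_into_1d_imp_open_map_UNIV[of D D]) (use cf inj in \<open>auto simp: D_def\<close>)
  define \<rho> where "\<rho> = inv_into D f"
  have c\<rho>: "continuous_on L \<rho>"
    unfolding L_def by (rule continuous_on_inverse_open[OF _ cf]) (use inj in \<open>auto simp: D_def \<rho>_def\<close>)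
  have \<rho>: "\<rho> y \<in> D" "f (\<rho> y) = y" if "y \<in> L" for y
    using that by (auto simp: L_def \<rho>_def inv_into_into f_inv_into_f)
  have im\<rho>: "\<rho> ` L \<subseteq> {-d<..<d}" using \<rho> by (auto simp: D_def)
  show ?thesis
  proof (rule that[of L "\<lambda>x. \<kappa> (\<rho> x)"])
    show "x \<in> L" using \<kappa> w by (auto simp: L_def f_def D_def intro!: image_eqI[of _ _ 0])
    show "L \<subseteq> rng" using \<kappa>(3) by (auto simp: L_def rng_def f_def D_def)
    show "sec L (\<lambda>x. \<kappa> (\<rho> x))"
      unfolding sec_def using \<rho> subsetD[OF \<kappa>(3) imageI] continuous_on_compose2[OF \<kappa>(2) c\<rho> im\<rho>] by (auto simp:
          f_def D_def)
    show "continuous_on L (\<lambda>x. T (\<kappa> (\<rho> x)))" by (rule continuous_on_compose2[OF \<kappa>(6) c\<rho> im\<rho>])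
  qed (rule oL)
qed

lemma open_rng: "open rng"
  by (subst open_subopen) (meson local_section)

lemma interval_rng: "a \<in> rng \<Longrightarrow> b \<in> rng \<Longrightarrow> a \<le> x \<Longrightarrow> x \<le> b \<Longrightarrow> x \<in> rng"
proof -
  have "connected (\<Omega> - {w0})" using connected_open_delete[OF open_dom connected_dom] by simp
  then have "connected rng" unfolding rng_def by (rule connected_continuous_image[OF continuous_\<alpha>])
  then show "a \<in> rng \<Longrightarrow> b \<in> rng \<Longrightarrow> a \<le> x \<Longrightarrow> x \<le> b \<Longrightarrow> x \<in> rng"
    using connectedD_interval by blast
qed

text \<open>At \<open>m\<close> both sections hit the same orbit, so a single flow time
  \<open>t\<close> moves the second onto the first there; flowing does not change labels.\<close>

lemma glue:
  assumes s: "sec {a..m} \<sigma>" "sec {m..b} \<sigma>'" and ab: "a \<le> m" "m \<le> b"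
  obtains \<sigma>'' where "sec {a..b} \<sigma>''" "\<And>x. x \<in> {a..m} \<Longrightarrow> \<sigma>'' x = \<sigma> x"
proof -
  have m: "\<sigma> m \<in> \<Omega> - {w0}" "\<sigma>' m \<in> \<Omega> - {w0}" "\<alpha> (\<sigma>' m) = \<alpha> (\<sigma> m)" using s ab by (auto simp: sec_def)
  then obtain t where t: "\<sigma> m = V t (\<sigma>' m)" using \<alpha>_iff by metis
  define \<sigma>'' where "\<sigma>'' x = (if x \<le> m then \<sigma> x else V t (\<sigma>' x))" for x
  have "continuous_on ({a..m} \<union> {m..b}) \<sigma>''"
    unfolding \<sigma>''_def
  proof (rule continuous_on_cases)
    show "continuous_on {m..b} (\<lambda>x. V t (\<sigma>' x))"
      by (rule continuous_V_compose) (use s in \<open>auto simp: sec_def\<close>)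
    show "\<forall>x. x \<in> {a..m} \<and> \<not> x \<le> m \<or> x \<in> {m..b} \<and> x \<le> m \<longrightarrow> \<sigma> x = V t (\<sigma>' x)"
      using t by (metis atLeastAtMost_iff order_antisym_conv)
  qed (use s in \<open>auto simp: sec_def\<close>)
  moreover have "{a..m} \<union> {m..b} = {a..b}" using ab by auto
  moreover have "\<sigma>'' x \<in> \<Omega> - {w0} \<and> \<alpha> (\<sigma>'' x) = x" if "x \<in> {a..b}" for x
    using that s V_in[of "\<sigma>' x" t] \<alpha>_V[of "\<sigma>' x" t] by (auto simp: \<sigma>''_def sec_def)
  ultimately have "sec {a..b} \<sigma>''" by (simp add: sec_def)
  then show ?thesis using that by (simp add: \<sigma>''_def)
qed

text \<open>Bisection: sections exist over short intervals by \<open>local_section\<close> and are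
  joined by \<open>glue\<close>.\<close>

lemma compact_section:
  assumes "a \<le> b" "a \<in> rng" "b \<in> rng"
  shows "\<exists>\<sigma>. sec {a..b} \<sigma>"
  using assms(1)
proof (induction rule: Bolzano)
  case (trans a m b)
  then show ?case by (metis glue)
next
  case (local x)
  then have "x \<in> rng" using interval_rng assms by blast
  then obtain L \<sigma> where L: "open L" "x \<in> L" "sec L \<sigma>" by (rule local_section)
  then obtain d where d: "d > 0" "ball x d \<subseteq> L" using open_contains_ball by blast
  have "\<exists>\<sigma>. sec {a..b} \<sigma>" if "a \<le> x \<and> x \<le> b \<and> b - a < d" for a b
  proof -
    have "{a..b} \<subseteq> ball x d" using that by (auto simp: dist_real_def)
    then show ?thesis using L(3) d(2) by (auto simp: sec_def intro!: exI[of _ \<sigma>] continuous_on_subset[of L \<sigma>])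
  qed
  then show ?case using d(1) by blast
qed

text \<open>The period depends only on the orbit, so it may be computed from a local section, along
  which it is continuous by \<open>local_curve\<close>.\<close>

lemma section_period:
  assumes S: "open S" "S \<subseteq> rng" and \<sigma>: "sec S \<sigma>"
  shows "continuous_on S (\<lambda>x. T (\<sigma> x))"
proof -
  have "\<exists>L. open L \<and> x \<in> L \<and> continuous_on (S \<inter> L) (\<lambda>x. T (\<sigma> x))" if x: "x \<in> S" for x
  proof -
    obtain L \<sigma>' where L: "open L" "x \<in> L" "L \<subseteq> rng" "sec L \<sigma>'" "continuous_on L (\<lambda>x. T (\<sigma>' x))"
      using x S(2) local_section by (metis subsetD)
    have "T (\<sigma>' y) = T (\<sigma> y)" if "y \<in> S \<inter> L" for y
      using that \<sigma> L(4) T_cong[of "\<sigma>' y" "\<sigma> y"] by (auto simp: sec_def)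
    then have "continuous_on (S \<inter> L) (\<lambda>x. T (\<sigma> x))"
      using continuous_on_eq[OF continuous_on_subset[OF L(5), of "S \<inter> L"]] by auto
    then show ?thesis using L by blast
  qed
  then obtain L where L: "\<And>x. x \<in> S \<Longrightarrow> open (L x) \<and> x \<in> L x \<and> continuous_on (S \<inter> L x) (\<lambda>x. T (\<sigma> x))" by metis
  have "continuous_on (\<Union>x\<in>S. S \<inter> L x) (\<lambda>x. T (\<sigma> x))"
    using L S by (intro continuous_on_open_UN) auto
  moreover have "(\<Union>x\<in>S. S \<inter> L x) = S" using L by blast
  ultimately show ?thesis by simp
qed

text \<open>The right end \<open>b\<close> of the interval of labels is not attained and belongs to
  \<open>w0\<close>. Sections over \<open>{c..B n}\<close> are chosen so that each extends the
  previous one; together they give a section up to \<open>b\<close>.\<close>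

lemma end_section:
  obtains c b \<sigma> where "c < b" "{c..<b} \<subseteq> rng" "\<And>x. x \<in> rng \<Longrightarrow> x < b" "sec {c<..<b} \<sigma>"
proof -
  obtain c where c: "c \<in> rng" using ne_dom by (auto simp: rng_def)
  define b where "b = Sup rng"
  have bdd: "bdd_above rng" by (rule bdd_aboveI[of _ M]) (use \<alpha>_less in \<open>fastforce simp: rng_def intro:
      less_imp_le\<close>)
  have lt: "x < b" if x: "x \<in> rng" for x
  proof -
    obtain d where d: "d > 0" "ball x d \<subseteq> rng" using open_rng x open_contains_ball by blast
    have "x + d/2 \<in> rng" using d by (auto simp: dist_real_def subset_iff)
    then have "x + d/2 \<le> b" unfolding b_def using bdd cSup_upper by blast
    then show ?thesis using d by simp
  qed
  have cb: "c < b" by (rule lt[OF c])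
  have sub: "{c..<b} \<subseteq> rng"
  proof
    fix x assume x: "x \<in> {c..<b}"
    then obtain y where "y \<in> rng" "x < y" using less_cSup_iff[of rng x] bdd c by (auto simp: b_def)
    then show "x \<in> rng" using interval_rng[OF c] x by auto
  qed
  \<comment> \<open>Increases from \<open>c\<close> towards \<open>b\<close> without reaching
    it.\<close>
  define B where "B n = b - (b - c) / real (Suc n)" for n
  have B0: "B 0 = c" by (simp add: B_def)
  have Bb: "B n < b" for n using cb by (simp add: B_def)
  have Bmono: "B m \<le> B n" if "m \<le> n" for m n
    unfolding B_def using cb that by (intro diff_left_mono divide_left_mono) auto
  have Bin: "B n \<in> rng" "c \<le> B n" for n using sub Bb Bmono[of 0 n] B0 by auto
  have Bex: "\<exists>n. x < B n" if x: "x < b" for x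
  proof -
    obtain n where n: "(b - c) / (b - x) < real (Suc n)" using reals_Archimedean2 by (metis less_Suc_eq
        of_nat_less_iff order_less_trans)
    then have "b - c < real (Suc n) * (b - x)" using x by (simp add: pos_divide_less_eq)
    then have "(b - c) / real (Suc n) < b - x" by (simp add: pos_divide_less_eq mult.commute)
    then show ?thesis by (intro exI[of _ n]) (simp add: B_def)
  qed
  have "\<exists>f. \<forall>n. sec {c..B n} (f n) \<and> (\<forall>x\<in>{c..B n}. f (Suc n) x = f n x)"
  proof (rule dependent_nat_choice)
    show "\<exists>\<sigma>. sec {c..B 0} \<sigma>" using compact_section[OF Bin(2) c Bin(1)] .
    fix \<sigma> n assume s: "sec {c..B n} \<sigma>"
    obtain \<sigma>' where s': "sec {B n..B (Suc n)} \<sigma>'" using compact_section[OF Bmono Bin(1) Bin(1)] by (metis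
        le_SucI order_refl)
    obtain \<sigma>'' where "sec {c..B (Suc n)} \<sigma>''" "\<And>x. x \<in> {c..B n} \<Longrightarrow> \<sigma>'' x = \<sigma> x"
      using glue[OF s s' Bin(2) Bmono] by (metis le_SucI order_refl)
    then show "\<exists>\<sigma>'. sec {c..B (Suc n)} \<sigma>' \<and> (\<forall>x\<in>{c..B n}. \<sigma>' x = \<sigma> x)" by blast
  qed
  then obtain f where f: "\<And>n. sec {c..B n} (f n)" "\<And>n x. x \<in> {c..B n} \<Longrightarrow> f (Suc n) x = f n x" by metis
  have agree: "f (n + m) x = f n x" if "x \<in> {c..B n}" for n m x
  proof (induction m)
    case (Suc m)
    have "x \<in> {c..B (n + m)}" using that Bmono[of n "n + m"] by auto
    then show ?case using f(2) Suc by simp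
  qed simp
  define N where "N x = (SOME n. x < B n)" for x
  define \<sigma> where "\<sigma> x = f (N x) x" for x
  have \<sigma>: "\<sigma> x = f n x" if x: "x \<in> {c..B n}" for n x
  proof -
    have "x < b" using x Bb[of n] by auto
    then have "x < B (N x)" using someI_ex[OF Bex] by (simp add: N_def)
    then have "x \<in> {c..B (N x)}" using x by auto
    then show ?thesis using agree[OF x, of "N x - n"] agree[of x "N x" "n - N x"]
      by (cases "n \<le> N x") (auto simp: \<sigma>_def)
  qed
  have "continuous_on (\<Union>n. {c<..<B n}) \<sigma>"
  proof (rule continuous_on_open_UN)
    fix n
    have "continuous_on {c<..<B n} (f n)" using f(1)[of n] by (auto simp: sec_def intro: continuous_on_subset)
    then show "continuous_on {c<..<B n} \<sigma>" proof (rule continuous_on_eq)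
      fix x assume "x \<in> {c<..<B n}"
      then show "f n x = \<sigma> x" using \<sigma>[of x n] by simp
    qed
  qed auto
  moreover have U: "(\<Union>n. {c<..<B n}) = {c<..<b}"
    using Bex Bb by (fastforce intro: order_less_trans)
  moreover have "\<sigma> x \<in> \<Omega> - {w0} \<and> \<alpha> (\<sigma> x) = x" if x: "x \<in> {c<..<b}" for x
  proof -
    obtain n where "x < B n" using Bex x by auto
    then have "x \<in> {c..B n}" using x by auto
    then show ?thesis using \<sigma> f(1)[of n] by (auto simp: sec_def)
  qed
  ultimately have "sec {c<..<b} \<sigma>" by (simp add: sec_def)
  then show ?thesis using that cb sub lt by blast
qed

text \<open>The radius selects the orbit through a section, and the angle is the elapsed time
  divided by the period, times a full turn. In these coordinates the flow rotates each circle at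
  constant speed; continuity at the origin comes from \<open>shrink\<close>.\<close>

lemma polar_coordinates:
  obtains g :: "complex \<Rightarrow> complex" where
    "continuous_on (ball 0 1) g" "inj_on g (ball 0 1)" "g ` ball 0 1 \<subseteq> \<Omega>" "g 0 = w0"
    "\<And>z. z \<in> ball 0 1 - {0} \<Longrightarrow> \<exists>P>0. \<forall>t. V t (g z) = g (exp (\<i> * of_real (2 * pi * t / P)) * z)"
proof -
  obtain c b \<sigma> where cb: "c < b" "{c..<b} \<subseteq> rng" and top: "\<And>x. x \<in> rng \<Longrightarrow> x < b" and \<sigma>: "sec {c<..<b} \<sigma>"
    by (rule end_section, rule that)
  have per: "continuous_on {c<..<b} (\<lambda>x. T (\<sigma> x))"
    by (rule section_period[OF _ _ \<sigma>]) (use cb in auto)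
  \<comment> \<open>Radii between 0 and 1 correspond to labels between \<open>c\<close> and
    \<open>b\<close> in reverse order, so that the radius tends to 0 as the orbit approaches
    \<open>w0\<close>.\<close>
  define a where "a r = b - (b - c) * r" for r
  have a_in: "a r \<in> {c<..<b}" if "0 < r" "r < 1" for r
  proof -
    have "(b - c) * r < b - c" "(b - c) * r > 0" using that cb(1) by auto
    then show ?thesis by (auto simp: a_def)
  qed
  have a_inj: "a r = a r' \<longleftrightarrow> r = r'" for r r' using cb(1) by (auto simp: a_def)
  define s where "s r = \<sigma> (a r)" for r
  define P where "P r = T (s r)" for r
  have s: "s r \<in> \<Omega> - {w0}" "\<alpha> (s r) = a r" if "0 < r" "r < 1" for r
    using a_in[OF that] \<sigma> by (auto simp: s_def sec_def)
  have P: "P r > 0" if "0 < r" "r < 1" for r using T_pos s(1)[OF that] by (simp add: P_def)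
  have cs: "continuous_on {0<..<1} s"
    unfolding s_def by (rule continuous_on_compose2[of "{c<..<b}" \<sigma>])
      (use \<sigma> a_in in \<open>auto simp: sec_def a_def intro!: continuous_intros\<close>)
  have cP: "continuous_on {0<..<1} P"
    unfolding P_def s_def by (rule continuous_on_compose2[OF per])
      (use a_in in \<open>auto simp: a_def intro!: continuous_intros\<close>)
  \<comment> \<open>The point reached from the section after the fraction
    \<open>\<theta> / (2 * pi)\<close> of a period.\<close>
  define F where "F r \<theta> = V (P r * \<theta> / (2 * pi)) (s r)" for r \<theta>
  have cF: "continuous_on S (\<lambda>z. F (f z) (\<theta> z))" if "continuous_on S f" "continuous_on S \<theta>" "f ` S \<subseteq> {0<..<1}"
      for S :: "complex set" and f \<theta>
    unfolding F_def
    by (intro continuous_V_compose continuous_intros continuous_on_compose2[OF cP that(1,3)] that(2)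
        continuous_on_compose2[OF cs that(1,3)])
       (use that(3) s(1) in auto)
  have F_in: "F r \<theta> \<in> \<Omega> - {w0}" "\<alpha> (F r \<theta>) = a r" if "0 < r" "r < 1" for r \<theta>
    using V_in s[OF that] \<alpha>_V by (auto simp: F_def)
  have F_eq: "F r \<theta> = F r \<theta>' \<longleftrightarrow> (\<exists>k::int. \<theta>' - \<theta> = 2 * pi * of_int k)" if r: "0 < r" "r < 1" for r \<theta> \<theta>'
  proof -
    have "F r \<theta> = F r \<theta>' \<longleftrightarrow> (\<exists>k::int. P r * \<theta>' / (2 * pi) - P r * \<theta> / (2 * pi) = of_int k * P r)"
      unfolding F_def using T_iff[OF s(1)[OF r]] by (simp add: P_def)
    also have "\<dots> \<longleftrightarrow> (\<exists>k::int. \<theta>' - \<theta> = 2 * pi * of_int k)"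
    proof -
      have "P r * \<theta>' / (2 * pi) - P r * \<theta> / (2 * pi) = of_int k * P r \<longleftrightarrow> \<theta>' - \<theta> = 2 * pi * of_int k" for k ::
          int
      proof -
        have "P r * \<theta>' / (2 * pi) - P r * \<theta> / (2 * pi) = (\<theta>' - \<theta>) / (2 * pi) * P r"
          by (simp add: field_simps)
        then have "P r * \<theta>' / (2 * pi) - P r * \<theta> / (2 * pi) = of_int k * P r \<longleftrightarrow> (\<theta>' - \<theta>) / (2 * pi) = of_int k"
          using P[OF r] by (metis less_irrefl mult_right_cancel)
        also have "\<dots> \<longleftrightarrow> \<theta>' - \<theta> = of_int k * (2 * pi)" by (rule nonzero_divide_eq_eq) simp
        finally show ?thesis by (simp only: mult.commute)
      qed
      then show ?thesis by simp
    qed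
    finally show ?thesis .
  qed
  define g where "g z = (if z = 0 then w0 else F (norm z) (Arg z))" for z
  have g_polar: "g (of_real r * exp (\<i> * of_real \<theta>)) = F r \<theta>" if r: "0 < r" "r < 1" for r \<theta>
  proof -
    define z where "z = of_real r * exp (\<i> * of_real \<theta>)"
    have nz: "norm z = r" "z \<noteq> 0" using r by (auto simp: z_def norm_mult)
    have "of_real r * exp (\<i> * of_real (Arg z)) = of_real r * exp (\<i> * of_real \<theta>)"
      using Arg_eq[OF nz(2)] unfolding nz(1) by (simp only: z_def)
    then have "exp (\<i> * of_real (Arg z)) = exp (\<i> * of_real \<theta>)" using r by simp
    then obtain n :: int where "\<i> * of_real (Arg z) = \<i> * of_real \<theta> + (of_int (2 * n) * pi) * \<i>" by (auto
        simp: exp_eq)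
    then have "\<i> * of_real (Arg z) = \<i> * of_real (\<theta> + of_int (2 * n) * pi)" by (simp add: algebra_simps)
    then have "complex_of_real (Arg z) = of_real (\<theta> + of_int (2 * n) * pi)" by (metis complex_i_not_zero
        mult_left_cancel)
    then have "Arg z = \<theta> + of_int (2 * n) * pi" using of_real_eq_iff by blast
    then have "F r (Arg z) = F r \<theta>" using F_eq[OF r] by (auto intro!: exI[of _ "- n"])
    then show ?thesis using nz by (simp add: g_def z_def)
  qed
  \<comment> \<open>A second formula with the branch cut on the other side: \<open>Arg z\<close>
    jumps along the negative real axis, \<open>Arg (- z)\<close> along the positive one. Together
    they give continuity off the origin.\<close>
  have g_neg: "g z = F (norm z) (Arg (- z) + pi)" if "z \<in> ball 0 1 - {0}" for z
  proof -
    have "z = of_real (norm z) * exp (\<i> * of_real (Arg (- z) + pi))"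
      using Arg_eq[of "- z"] that by (simp add: exp_add ring_distribs minus_equation_iff)
    then show ?thesis using g_polar[of "norm z" "Arg (- z) + pi"] that by auto
  qed
  have open1: "open (ball 0 1 - \<real>\<^sub>\<le>\<^sub>0 :: complex set)" and open2: "open (ball 0 1 - \<real>\<^sub>\<ge>\<^sub>0 :: complex set)"
    by (intro open_Diff open_ball closed_nonpos_Reals_complex closed_nonneg_Reals_complex)+
  have c1: "continuous_on (ball 0 1 - \<real>\<^sub>\<le>\<^sub>0) g"
  proof -
    have "continuous_on (ball 0 1 - \<real>\<^sub>\<le>\<^sub>0) (\<lambda>z. F (norm z) (Arg z))"
      by (rule cF) (auto intro!: continuous_intros)
    then show ?thesis by (rule continuous_on_eq) (auto simp: g_def)
  qed
  have c2: "continuous_on (ball 0 1 - \<real>\<^sub>\<ge>\<^sub>0) g"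
  proof -
    have "continuous_on (ball 0 1 - \<real>\<^sub>\<ge>\<^sub>0) (\<lambda>z. F (norm z) (Arg (- z) + pi))"
      by (rule cF) (auto intro!: continuous_intros simp: uminus_nonpos_Reals_iff)
    then show ?thesis
    proof (rule continuous_on_eq)
      fix z :: complex assume "z \<in> ball 0 1 - \<real>\<^sub>\<ge>\<^sub>0"
      then have "z \<in> ball 0 1 - {0}" by auto
      then show "F (cmod z) (Arg (- z) + pi) = g z" using g_neg by simp
    qed
  qed
  have un: "(ball 0 1 - \<real>\<^sub>\<le>\<^sub>0) \<union> (ball 0 1 - \<real>\<^sub>\<ge>\<^sub>0) = ball 0 1 - {0::complex}"
    by (auto simp: complex_nonpos_Reals_iff complex_nonneg_Reals_iff complex_eq_iff)
  have cg: "continuous_on (ball 0 1 - {0}) g"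
    using continuous_on_open_Un[OF open1 open2 c1 c2] un by simp
  have lim0: "\<exists>d>0. \<forall>z\<in>ball 0 1. dist z 0 < d \<longrightarrow> dist (g z) (g 0) < e" if e: "e > 0" for e
  proof -
    obtain w where w: "w \<in> \<Omega> - {w0}" "\<And>w'. w' \<in> \<Omega> - {w0} \<Longrightarrow> \<alpha> w < \<alpha> w' \<Longrightarrow> dist w0 w' < e" using shrink[OF e] by
        blast
    have wb: "\<alpha> w < b" using top w by (auto simp: rng_def)
    define d where "d = (b - \<alpha> w) / (b - c)"
    have d: "d > 0" using wb cb by (simp add: d_def)
    have "dist (g z) (g 0) < e" if z: "z \<in> ball 0 1" "dist z 0 < d" for z
    proof (cases "z = 0")
      case False
      then have r: "0 < norm z" "norm z < 1" using z by auto
      have "norm z < d" using z by simp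
      then have "(b - c) * norm z < b - \<alpha> w" using cb by (simp add: d_def pos_less_divide_eq mult.commute)
      then have "\<alpha> w < \<alpha> (F (norm z) (Arg z))" using F_in(2)[OF r] by (simp add: a_def)
      then have "dist w0 (F (norm z) (Arg z)) < e" using w(2) F_in(1)[OF r] by blast
      then show ?thesis using False by (simp add: g_def dist_commute)
    qed (use e in simp)
    then show ?thesis using d by blast
  qed
  show ?thesis
  proof (rule that[of g])
    show "g 0 = w0" by (simp add: g_def)
    show "g ` ball 0 1 \<subseteq> \<Omega>" using F_in(1) w0_in by (auto simp: g_def)
    show "continuous_on (ball 0 1) g"
      unfolding continuous_on_iff
    proof (intro ballI allI impI)
      fix x :: complex and e :: real assume x: "x \<in> ball 0 1" and e: "e > 0"
      show "\<exists>d>0. \<forall>x'\<in>ball 0 1. dist x' x < d \<longrightarrow> dist (g x') (g x) < e"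
      proof (cases "x = 0")
        case True then show ?thesis using lim0[OF e] by blast
      next
        case False
        then obtain d where d: "d > 0" "\<forall>x'\<in>ball 0 1 - {0}. dist x' x < d \<longrightarrow> dist (g x') (g x) < e"
          using cg x e unfolding continuous_on_iff by (metis DiffI empty_iff insert_iff)
        then show ?thesis using False by (intro exI[of _ "min d (norm x)"]) (auto simp: dist_norm)
      qed
    qed
    show "inj_on g (ball 0 1)"
    proof (rule inj_onI)
      fix z z' :: complex assume z: "z \<in> ball 0 1" "z' \<in> ball 0 1" "g z = g z'"
      show "z = z'"
      proof (cases "z = 0 \<or> z' = 0")
        case True
        have "g y \<noteq> w0" if "y \<in> ball 0 1" "y \<noteq> 0" for y using F_in(1)[of "norm y" "Arg y"] that by (auto simp:
            g_def)
        then show ?thesis using True z by (metis g_def)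
      next
        case False
        then have r: "0 < norm z" "norm z < 1" "0 < norm z'" "norm z' < 1" using z by auto
        have eq: "F (norm z) (Arg z) = F (norm z') (Arg z')" using z False by (simp add: g_def)
        then have "a (norm z) = a (norm z')" using F_in(2) r by metis
        then have n: "norm z = norm z'" using a_inj by blast
        then obtain k :: int where k: "Arg z' - Arg z = 2 * pi * of_int k" using eq F_eq[OF r(1,2)] by auto
        have "exp (\<i> * of_real (Arg z')) = exp (\<i> * of_real (Arg z))"
          unfolding exp_eq
        proof (intro exI[of _ k])
          have "Arg z' = Arg z + 2 * pi * of_int k" using k by simp
          then show "\<i> * of_real (Arg z') = \<i> * of_real (Arg z) + (of_int (2 * k) * pi) * \<i>" by (simp add:
              algebra_simps)
        qed
        then show ?thesis using Arg_eq[of z] Arg_eq[of z'] n False by metis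
      qed
    qed
    fix z assume z: "z \<in> ball 0 1 - {0::complex}"
    then have r: "0 < norm z" "norm z < 1" by auto
    define Q where "Q = P (norm z)"
    have Q: "Q > 0" using P[OF r] by (simp add: Q_def)
    have "V t (g z) = g (exp (\<i> * of_real (2 * pi * t / Q)) * z)" for t
    proof -
      have sr: "s (norm z) \<in> \<Omega>" using s(1)[OF r] by blast
      have "V t (g z) = V (t + Q * Arg z / (2 * pi)) (s (norm z))"
        using z V_V[OF sr] by (simp add: g_def F_def Q_def)
      also have "t + Q * Arg z / (2 * pi) = Q * (2 * pi * t / Q + Arg z) / (2 * pi)"
        using Q by (simp add: field_simps)
      also have "V \<dots> (s (norm z)) = F (norm z) (2 * pi * t / Q + Arg z)" by (simp add: F_def Q_def)
      also have "\<dots> = g (of_real (norm z) * exp (\<i> * of_real (2 * pi * t / Q + Arg z)))" by (rule g_polar[OF r,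
          symmetric])
      also have "of_real (norm z) * exp (\<i> * of_real (2 * pi * t / Q + Arg z)) = exp (\<i> * of_real (2 * pi * t
          / Q)) * (of_real (norm z) * exp (\<i> * of_real (Arg z)))"
        by (simp add: exp_add ring_distribs)
      also have "of_real (norm z) * exp (\<i> * of_real (Arg z)) = z" using Arg_eq[of z] z by simp
      finally show ?thesis .
    qed
    then show "\<exists>P>0. \<forall>t. V t (g z) = g (exp (\<i> * of_real (2 * pi * t / P)) * z)" using Q by blast
  qed
qed

end

section \<open>Isolated singular points are centers\<close>

text \<open>The orbit of \<open>y0\<close> bounds the disc in which everything takes place. That
  \<open>q\<close> lies in this disc is derived: the disc contains a singular point, and
  \<open>q\<close> is the only one in \<open>B\<close>.\<close>

locale singular_disc = hausdorff_flow X v for X :: "'a topology" and v +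
  fixes q :: 'a and B h k C and y0 :: 'a
  assumes chart: "chart B h k C" and conv: "convex C" and qB: "q \<in> B" and q_sing: "singular_point v q"
    and only_q: "x \<in> B \<Longrightarrow> singular_point v x \<Longrightarrow> x = q"
    and y0: "y0 \<in> topspace X" "periodic_point v y0" "orbit v y0 \<subseteq> B"
begin

definition \<Omega> :: "complex set" where "\<Omega> = inside (h ` orbit v y0)"

definition w0 :: complex where "w0 = h q"

definition curve :: "complex \<Rightarrow> complex set" where "curve w = h ` orbit v (k w)"

definition region :: "complex \<Rightarrow> complex set" where "region w = inside (curve w)"

definition V :: "real \<Rightarrow> complex \<Rightarrow> complex" where "V t w = h (v t (k w))"

lemma qt: "q \<in> topspace X"
  using qB chart_subset[OF chart] by blast

lemma kw0: "k w0 = q"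
  by (simp add: w0_def chart_h(2)[OF chart qB])

lemma \<Omega>_C: "\<Omega> \<subseteq> C"
  unfolding \<Omega>_def by (rule inner_subset[OF chart conv y0])

lemma open_\<Omega>: "open \<Omega>" and connected_\<Omega>: "connected \<Omega>"
  unfolding \<Omega>_def by (rule open_inner[OF chart conv y0], rule connected_inner[OF chart conv y0])

lemma q_in_disc:
  assumes "y \<in> topspace X" "periodic_point v y" "orbit v y \<subseteq> B"
  shows "q \<in> k ` inside (h ` orbit v y)"
  using disc_contains_singular[OF chart conv assms] disc_subset[OF chart conv assms] only_q by blast

text \<open>Since \<open>\<Omega>\<close> is open in the plane and contained in \<open>C\<close>,
  this also shows that \<open>q\<close> is not on the boundary of the half plane in the
  chart.\<close>

lemma w0_\<Omega>: "w0 \<in> \<Omega>"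
  using q_in_disc[OF y0] disc_iff[OF chart conv y0 qB] by (simp add: \<Omega>_def w0_def)

lemma k_in: "w \<in> \<Omega> \<Longrightarrow> k w \<in> k ` \<Omega>" "w \<in> \<Omega> \<Longrightarrow> k w \<in> B" "w \<in> \<Omega> \<Longrightarrow> k w \<in> topspace X" "w \<in> \<Omega> \<Longrightarrow> h (k w) = w"
  using chart_k[OF chart] \<Omega>_C chart_subset[OF chart] by auto

lemma V_\<Omega>: assumes "w \<in> \<Omega>" shows "V t w \<in> \<Omega>" "k (V t w) = v t (k w)"
proof -
  have "v t (k w) \<in> k ` \<Omega>"
    using invariant_disc[OF chart conv y0] k_in(1)[OF assms] unfolding invariant_def \<Omega>_def by blast
  then obtain z where "z \<in> \<Omega>" "v t (k w) = k z" by blast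
  then show "V t w \<in> \<Omega>" "k (V t w) = v t (k w)" using k_in by (auto simp: V_def)
qed

lemma kq: "w \<in> \<Omega> - {w0} \<Longrightarrow> k w \<noteq> q"
  using k_in(4) w0_def by force

lemma periodic_k: "w \<in> \<Omega> - {w0} \<Longrightarrow> periodic_point v (k w)"
  using periodic_iff only_q k_in kq by (metis DiffD1)

lemma orbit_k: assumes "w \<in> \<Omega> - {w0}" shows "orbit v (k w) \<subseteq> B" "region w \<union> curve w \<subseteq> \<Omega>"
proof -
  have *: "k w \<in> k ` inside (h ` orbit v y0)" using k_in(1) assms by (auto simp: \<Omega>_def)
  have w: "k w \<in> topspace X" using k_in(3) assms by blast
  show "orbit v (k w) \<subseteq> B" "region w \<union> curve w \<subseteq> \<Omega>"
    using inner_mono[OF chart conv y0 w periodic_k[OF assms] *] by (auto simp: region_def curve_def \<Omega>_def)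
qed

lemma Y: assumes "w \<in> \<Omega> - {w0}"
  shows "k w \<in> topspace X" "periodic_point v (k w)" "orbit v (k w) \<subseteq> B"
  using assms k_in(3) periodic_k orbit_k(1) by blast+

lemma w_curve: "w \<in> \<Omega> \<Longrightarrow> w \<in> curve w"
  using orbit_self[of "k w"] k_in unfolding curve_def by (metis image_eqI)

text \<open>Every periodic disc contains a singular point and \<open>q\<close> is the only
  candidate; so all regions have a common point, which forces them to be nested.\<close>

lemma w0_region: "w \<in> \<Omega> - {w0} \<Longrightarrow> w0 \<in> region w"
  using q_in_disc[OF Y] disc_iff[OF chart conv Y qB] by (simp add: region_def curve_def w0_def)

section \<open>Nesting of the orbits around the singular point\<close>

lemma jordan:
  assumes "w \<in> \<Omega> - {w0}"
  shows "region w \<noteq> {}" "open (region w)" "connected (region w)" "region w \<inter> outside (curve w) = {}"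
    "region w \<union> outside (curve w) = - curve w" "frontier (region w) = curve w"
    "frontier (outside (curve w)) = curve w" "region w \<subseteq> C" "open (outside (curve w))"
  unfolding region_def curve_def
  using inner_ne[OF chart conv Y[OF assms]] open_inner[OF chart conv Y[OF assms]] connected_inner[OF chart
      conv Y[OF assms]]
    inner_outer[OF chart conv Y[OF assms]] frontier_inner[OF chart conv Y[OF assms]] frontier_outer[OF chart
        conv Y[OF assms]]
    inner_subset[OF chart conv Y[OF assms]] open_outer[OF chart conv Y[OF assms]] by auto

lemma curve_cong: "w \<in> \<Omega> - {w0} \<Longrightarrow> w' \<in> curve w \<Longrightarrow> w' \<in> \<Omega> - {w0} \<and> curve w' = curve w \<and> (\<exists>t. w' = V t w)"
proof -
  assume w: "w \<in> \<Omega> - {w0}" and w': "w' \<in> curve w"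
  then obtain t where t: "w' = V t w" by (auto simp: curve_def orbit_def V_def)
  have wt: "w \<in> \<Omega>" using w by blast
  have kw': "k w' = v t (k w)" using V_\<Omega>(2)[OF wt] t by simp
  have "w' \<in> \<Omega>" using V_\<Omega>(1)[OF wt] t by simp
  moreover have "w' \<noteq> w0"
  proof
    assume "w' = w0"
    then have "v t (k w) = q" using kw' kw0 by simp
    then have "k w = v (- t) q" using k_in(3)[OF wt] by auto
    then have "k w = q" using q_sing by (simp add: singular_point_def)
    then show False using kq[OF w] by simp
  qed
  moreover have "orbit v (k w') = orbit v (k w)"
    using kw' k_in(3)[OF wt] by (intro orbit_eq) (auto simp: orbit_def)
  ultimately show ?thesis using t by (auto simp: curve_def)
qed

lemma V_curve: "w \<in> \<Omega> \<Longrightarrow> V t w \<in> curve w"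
  by (auto simp: V_def curve_def orbit_def)

lemma region_nest:
  assumes w: "w \<in> \<Omega> - {w0}" and w': "w' \<in> \<Omega> - {w0}" "w' \<in> region w"
  shows "region w' \<union> curve w' \<subseteq> region w"
proof -
  have "k w' \<in> k ` inside (h ` orbit v (k w))" using w'(2) by (auto simp: region_def curve_def)
  then show ?thesis using inner_mono(2)[OF chart conv Y[OF w] Y(1,2)[OF w'(1)]] by (simp add: region_def
      curve_def)
qed

lemma curve_disjoint:
  assumes w: "w \<in> \<Omega> - {w0}" and w': "w' \<in> \<Omega> - {w0}" "w' \<notin> curve w"
  shows "curve w \<inter> curve w' = {}"
proof (rule ccontr)
  assume "\<not> ?thesis"
  then obtain u where u: "u \<in> curve w" "u \<in> curve w'" by blast
  have "curve w = curve w'" using curve_cong[OF w u(1)] curve_cong[OF w'(1) u(2)] by simp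
  then show False using w_curve[of w'] w' by blast
qed

lemma connected_region_subset:
  assumes w: "w \<in> \<Omega> - {w0}" and K: "connected K" "K \<inter> curve w = {}"
  shows "K \<subseteq> region w \<or> K \<inter> region w = {}"
  using connected_Int_frontier[OF K(1), of "region w"] K(2) jordan(6)[OF w] by (auto simp: region_def
      curve_def)

text \<open>Both regions contain \<open>w0\<close>. If neither point lies in the other's region, the
  curve of \<open>w'\<close> misses \<open>region w\<close>, which is connected and therefore
  contained in \<open>region w'\<close>; taking closures puts the curve of \<open>w\<close> inside
  as well.\<close>

lemma nested:
  assumes w: "w \<in> \<Omega> - {w0}" and w': "w' \<in> \<Omega> - {w0}" "w' \<notin> curve w"
  shows "w' \<in> region w \<or> w \<in> region w'"
proof (rule ccontr)
  assume n: "\<not> ?thesis"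
  have dj: "curve w \<inter> curve w' = {}" by (rule curve_disjoint[OF w w'])
  have "region w \<inter> curve w' = {}"
  proof (rule ccontr)
    assume "region w \<inter> curve w' \<noteq> {}"
    then obtain u where u: "u \<in> region w" "u \<in> curve w'" by blast
    then have u': "u \<in> \<Omega> - {w0}" "curve u = curve w'" using curve_cong[OF w'(1)] by blast+
    then have "curve w' \<subseteq> region w" using region_nest[OF w u'(1) u(1)] by blast
    then show False using n w_curve w'(1) by blast
  qed
  moreover have "connected (region w)" using jordan(3)[OF w] by (simp add: region_def curve_def)
  moreover have "w0 \<in> region w \<inter> region w'" using w0_region w w' by blast
  ultimately have sub: "region w \<subseteq> region w'" using connected_region_subset[OF w'(1), of "region w"] by blast
  have "curve w \<subseteq> closure (region w)"
    using jordan(6)[OF w] by (auto simp: region_def curve_def frontier_def)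
  also have "\<dots> \<subseteq> closure (region w')" by (rule closure_mono[OF sub])
  also have "\<dots> = region w' \<union> curve w'"
    unfolding closure_Un_frontier using jordan(6)[OF w'(1)] by (simp add: region_def curve_def)
  finally have "curve w \<subseteq> region w'" using dj by blast
  then show False using n w_curve w by blast
qed

section \<open>Dependence of the Jordan interior on the orbit\<close>

lemma near:
  assumes A: "openin X A" "k w \<in> A" and w: "w \<in> \<Omega>"
  obtains e where "e > 0" "\<And>w'. dist w' w < e \<Longrightarrow> w' \<in> \<Omega> \<and> k w' \<in> A"
proof -
  have "continuous_map (top_of_set \<Omega>) X k"
    using chart_continuous_k[OF chart, of "top_of_set \<Omega>" "\<lambda>w. w"] \<Omega>_C by auto
  from openin_continuous_map_preimage[OF this A(1)]
  have "open {w \<in> \<Omega>. k w \<in> A}" using open_\<Omega> by (simp add: openin_open_eq)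
  then obtain e where "e > 0" "ball w e \<subseteq> {w \<in> \<Omega>. k w \<in> A}"
    using A w open_contains_ball by (metis (mono_tags, lifting) mem_Collect_eq)
  then show ?thesis using that[of e] by (auto simp: dist_commute subset_iff)
qed

text \<open>By \<open>linked_disc\<close>, lying in the region means being linked with
  \<open>q\<close> off the orbit, and this persists for nearby orbits by
  \<open>linked_near\<close>.\<close>

lemma region_near:
  assumes w: "w \<in> \<Omega> - {w0}" and z: "z \<in> region w"
  obtains e where "e > 0" "\<And>w'. w' \<in> \<Omega> - {w0} \<Longrightarrow> dist w' w < e \<Longrightarrow> z \<in> region w'"
proof -
  have zC: "z \<in> C" using z jordan(8)[OF w] by (auto simp: region_def curve_def)
  have kz: "k z \<in> k ` inside (h ` orbit v (k w))" using z by (auto simp: region_def curve_def)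
  have "k z \<in> topspace X - orbit v (k w)"
    using kz disc_disjoint[OF chart conv Y[OF w]] chart_k(1)[OF chart zC] chart_subset[OF chart] by blast
  then have lk: "linked (orbit v (k w)) q (k z)"
    using linked_disc[OF chart conv Y[OF w] q_in_disc[OF Y[OF w]]] kz by blast
  obtain A where A: "openin X A" "k w \<in> A" "\<And>x. x \<in> A \<Longrightarrow> linked (orbit v x) q (k z)"
    by (rule linked_near[OF Y(1)[OF w] lk], rule that)
  obtain e where e: "e > 0" "\<And>w'. dist w' w < e \<Longrightarrow> w' \<in> \<Omega> \<and> k w' \<in> A" using near[OF A(1,2)] w by blast
  have "z \<in> region w'" if w': "w' \<in> \<Omega> - {w0}" "dist w' w < e" for w'
  proof -
    have l: "linked (orbit v (k w')) q (k z)" using A(3) e(2) w' by blast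
    then have "k z \<in> k ` inside (h ` orbit v (k w'))"
      using linked_disc[OF chart conv Y[OF w'(1)] q_in_disc[OF Y[OF w'(1)]]] linked_in by blast
    then show ?thesis
      using disc_iff[OF chart conv Y[OF w'(1)] chart_k(1)[OF chart zC]] chart_k(2)[OF chart zC]
      by (simp add: region_def curve_def)
  qed
  then show ?thesis using that e(1) by blast
qed

text \<open>The counterpart for points outside the closed disc, from \<open>not_linked_near\<close>.
  Points outside \<open>C\<close> lie in no region at all.\<close>

lemma outer_near:
  assumes w: "w \<in> \<Omega> - {w0}" and z: "z \<notin> region w" "z \<notin> curve w"
  obtains e where "e > 0" "\<And>w'. w' \<in> \<Omega> - {w0} \<Longrightarrow> dist w' w < e \<Longrightarrow> z \<notin> region w'"
proof (cases "z \<in> C")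
  case False
  then have "z \<notin> region w'" if "w' \<in> \<Omega> - {w0}" for w' using jordan(8)[OF that] by (auto simp: region_def
      curve_def)
  then show ?thesis using that[of 1] by simp
next
  case zC: True
  have kzB: "k z \<in> B" by (rule chart_k(1)[OF chart zC])
  have "k z \<notin> orbit v (k w)" using z(2) chart_k(2)[OF chart zC] by (force simp: curve_def)
  then have kz: "k z \<in> topspace X - orbit v (k w)" using kzB chart_subset[OF chart] by blast
  have "k z \<notin> k ` inside (h ` orbit v (k w))"
    using z(1) disc_iff[OF chart conv Y[OF w] kzB] chart_k(2)[OF chart zC] by (simp add: region_def curve_def)
  then have nl: "\<not> linked (orbit v (k w)) q (k z)"
    using linked_disc[OF chart conv Y[OF w] q_in_disc[OF Y[OF w]] kz] by blast
  have qO: "q \<in> topspace X - orbit v (k w)"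
    using disc_disjoint[OF chart conv Y[OF w]] q_in_disc[OF Y[OF w]] qt by blast
  obtain A where A: "openin X A" "k w \<in> A" "\<And>x. x \<in> A \<Longrightarrow> \<not> linked (orbit v x) q (k z)"
    by (rule not_linked_near[OF Y(1,2)[OF w] qO kz nl], rule that)
  obtain e where e: "e > 0" "\<And>w'. dist w' w < e \<Longrightarrow> w' \<in> \<Omega> \<and> k w' \<in> A" using near[OF A(1,2)] w by blast
  have "z \<notin> region w'" if w': "w' \<in> \<Omega> - {w0}" "dist w' w < e" for w'
  proof
    assume "z \<in> region w'"
    then have kz': "k z \<in> k ` inside (h ` orbit v (k w'))" by (auto simp: region_def curve_def)
    then have "k z \<in> topspace X - orbit v (k w')"
      using disc_disjoint[OF chart conv Y[OF w'(1)]] kzB chart_subset[OF chart] by blast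
    then have "linked (orbit v (k w')) q (k z)"
      using linked_disc[OF chart conv Y[OF w'(1)] q_in_disc[OF Y[OF w'(1)]]] kz' by blast
    then show False using A(3) e(2) w' by blast
  qed
  then show ?thesis using that e(1) by blast
qed

text \<open>An invariant neighbourhood of the orbit inside the preimage of \<open>G\<close> confines
  all orbits that start near \<open>w\<close>.\<close>

lemma curve_near:
  assumes w: "w \<in> \<Omega> - {w0}" and G: "open G" "curve w \<subseteq> G"
  obtains e where "e > 0" "\<And>w'. w' \<in> \<Omega> - {w0} \<Longrightarrow> dist w' w < e \<Longrightarrow> curve w' \<subseteq> G"
proof -
  define N where "N = {x \<in> topspace (subtopology X B). h x \<in> G}"
  have tB: "topspace (subtopology X B) = B" using chart_subset[OF chart] by auto
  have "continuous_map (subtopology X B) euclidean h"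
    using chart_continuous_h[OF chart, of "subtopology X B" "\<lambda>x. x"] tB by (auto simp:
        continuous_map_in_subtopology)
  then have "openin (subtopology X B) N" unfolding N_def using G by (intro openin_continuous_map_preimage)
      auto
  then have N: "openin X N" using chart_openin[OF chart] openin_trans_full by blast
  have "orbit v (k w) \<subseteq> N" using Y(3)[OF w] G(2) unfolding N_def tB by (auto simp: curve_def)
  then obtain A where A: "openin X A" "invariant A" "k w \<in> A" "A \<subseteq> N"
    by (rule saturated_nbhdsD[OF sat Y(1)[OF w] N])
  obtain e where e: "e > 0" "\<And>w'. dist w' w < e \<Longrightarrow> w' \<in> \<Omega> \<and> k w' \<in> A" using near[OF A(1,3)] w by blast
  have "curve w' \<subseteq> G" if w': "dist w' w < e" for w'
  proof -
    have "orbit v (k w') \<subseteq> A" using invariant_orbit[OF A(2)] e(2)[OF w'] by blast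
    then show ?thesis using A(4) by (auto simp: N_def curve_def)
  qed
  then show ?thesis using that e(1) by blast
qed

text \<open>From above: an almost nearest point of the region stays in the nearby regions. From
  below: a closed ball around \<open>d\<close> that misses the closed disc is connected, nearby
  curves still miss it and \<open>d\<close> stays outside, so the whole ball stays outside the
  nearby regions.\<close>

lemma continuous_infdist_region: "continuous_on (\<Omega> - {w0}) (\<lambda>w. infdist d (region w))"
  unfolding continuous_on_iff
proof (intro ballI allI impI)
  fix w e assume w: "w \<in> \<Omega> - {w0}" and e: "e > (0::real)"
  define r where "r = infdist d (region w)"
  have ne: "region w \<noteq> {}" if "w \<in> \<Omega> - {w0}" for w using w0_region[OF that] by blast
  have "\<exists>z\<in>region w. dist d z < r + e"
  proof (rule ccontr)
    assume "\<not> ?thesis"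
    then have "r + e \<le> infdist d (region w)" unfolding infdist_notempty[OF ne[OF w]]
      using ne[OF w] by (intro cINF_greatest) auto
    then show False using e by (simp add: r_def)
  qed
  then obtain z where z: "z \<in> region w" "dist d z < r + e" by blast
  obtain e1 where e1: "e1 > 0" "\<And>w'. w' \<in> \<Omega> - {w0} \<Longrightarrow> dist w' w < e1 \<Longrightarrow> z \<in> region w'"
    by (rule region_near[OF w z(1)], rule that)
  have up: "infdist d (region w') < r + e" if "w' \<in> \<Omega> - {w0}" "dist w' w < e1" for w'
    using infdist_le[OF e1(2)[OF that], of d] z(2) by simp
  have "\<exists>e2>0. \<forall>w'\<in>\<Omega> - {w0}. dist w' w < e2 \<longrightarrow> infdist d (region w') > r - e"
  proof (cases "r < e")
    case True
    then have "r - e < infdist d (region w')" for w' using infdist_nonneg[of d "region w'"] by linarith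
    then show ?thesis by (intro exI[of _ 1]) auto
  next
    case False
    \<comment> \<open>The radius is below \<open>r\<close>, so the ball misses the closure of the
      region, but above the \<open>r - e\<close> that has to be beaten.\<close>
    define K where "K = cball d (r - e/2)"
    have r: "r > 0" using False e by simp
    have Kw: "K \<inter> closure (region w) = {}"
    proof (rule ccontr)
      assume "K \<inter> closure (region w) \<noteq> {}"
      then obtain u where u: "u \<in> closure (region w)" "dist d u \<le> r - e/2" by (auto simp: K_def)
      then obtain u' where "u' \<in> region w" "dist u' u < e/2" using closure_approachable e by (metis
          half_gt_zero)
      then have "infdist d (region w) \<le> dist d u'" "dist d u' < r" using infdist_le[of u' "region w" d] u
          dist_triangle[of d u' u]
        by (auto simp: dist_commute)
      then show False by (simp add: r_def)
    qed
    have cl: "closure (region w) = region w \<union> curve w"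
      unfolding closure_Un_frontier using jordan(6)[OF w] by (simp add: region_def curve_def)
    have dK: "d \<in> K" using False e by (simp add: K_def)
    have "connected K" by (simp add: K_def)
    have "curve w \<subseteq> - K" using Kw cl by blast
    then obtain e2 where e2: "e2 > 0" "\<And>w'. w' \<in> \<Omega> - {w0} \<Longrightarrow> dist w' w < e2 \<Longrightarrow> curve w' \<subseteq> - K"
      by (rule curve_near[OF w, rotated], unfold K_def) (auto intro: that)
    have "d \<notin> region w" "d \<notin> curve w" using dK Kw cl by auto
    then obtain e3 where e3: "e3 > 0" "\<And>w'. w' \<in> \<Omega> - {w0} \<Longrightarrow> dist w' w < e3 \<Longrightarrow> d \<notin> region w'"
      by (rule outer_near[OF w], blast intro: that)
    have "infdist d (region w') > r - e" if w': "w' \<in> \<Omega> - {w0}" "dist w' w < min e2 e3" for w'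
    proof -
      have "K \<inter> curve w' = {}" "d \<notin> region w'" using e2(2)[OF w'(1)] e3(2)[OF w'(1)] w'(2) by auto
      then have "K \<inter> region w' = {}"
        using connected_region_subset[OF w'(1), of K] dK \<open>connected K\<close> by blast
      then have "r - e/2 \<le> infdist d (region w')"
        unfolding infdist_notempty[OF ne[OF w'(1)]] using ne[OF w'(1)]
        by (intro cINF_greatest) (auto simp: K_def disjoint_iff not_le less_imp_le)
      then show ?thesis using e by simp
    qed
    then show ?thesis using e2(1) e3(1) by (intro exI[of _ "min e2 e3"]) auto
  qed
  then obtain e2 where e2: "e2 > 0" "\<And>w'. w' \<in> \<Omega> - {w0} \<Longrightarrow> dist w' w < e2 \<Longrightarrow> infdist d (region w') > r - e" by
      blast
  show "\<exists>\<delta>>0. \<forall>w'\<in>\<Omega> - {w0}. dist w' w < \<delta> \<longrightarrow> dist (infdist d (region w')) (infdist d (region w)) < e"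
    using e1(1) e2 up by (intro exI[of _ "min e1 e2"]) (fastforce simp: dist_real_def r_def)
qed

section \<open>A real label for the nested orbits\<close>

definition dense_seq :: "nat \<Rightarrow> complex" where
  "dense_seq = (SOME d. \<forall>U. open U \<longrightarrow> U \<noteq> {} \<longrightarrow> (\<exists>n. d n \<in> U))"

lemma dense_seq: "open U \<Longrightarrow> U \<noteq> {} \<Longrightarrow> \<exists>n. dense_seq n \<in> U"
proof -
  obtain D :: "complex set" where D: "countable D" "\<forall>U. open U \<longrightarrow> U \<noteq> {} \<longrightarrow> (\<exists>d\<in>D. d \<in> U)"
    using countable_dense_exists by blast
  then have "D \<noteq> {}" by (metis empty_iff open_UNIV UNIV_not_empty)
  then have "range (from_nat_into D) = D" using D(1) by (rule range_from_nat_into)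
  then have "\<exists>n. from_nat_into D n \<in> U" if "open U" "U \<noteq> {}" for U
    using D(2)[rule_format, OF that] by (metis imageE)
  then have "\<exists>d :: nat \<Rightarrow> complex. \<forall>U. open U \<longrightarrow> U \<noteq> {} \<longrightarrow> (\<exists>n. d n \<in> U)" by (intro exI[of _ "from_nat_into D"]
      allI impI)
  then have "\<forall>U. open U \<longrightarrow> U \<noteq> {} \<longrightarrow> (\<exists>n. dense_seq n \<in> U)" unfolding dense_seq_def by (rule someI_ex)
  then show "open U \<Longrightarrow> U \<noteq> {} \<Longrightarrow> \<exists>n. dense_seq n \<in> U" by blast
qed

text \<open>A label that increases as the region shrinks: each distance to the region grows weakly,
  and for some point of a dense sequence strictly. The cut-off at 1 and the weights make the series
  converge uniformly, so continuity of the distances is inherited.\<close>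

definition \<alpha> :: "complex \<Rightarrow> real" where
  "\<alpha> w = (\<Sum>n. (1/2) ^ n * min 1 (infdist (dense_seq n) (region w)))"

lemma \<alpha>_term: "norm ((1/2::real) ^ n * min 1 (infdist d A)) \<le> (1/2) ^ n"
  using infdist_nonneg[of d A] by (simp add: abs_mult mult_left_le)

lemma \<alpha>_summable: "summable (\<lambda>n. (1/2::real) ^ n * min 1 (infdist (dense_seq n) (region w)))"
  by (rule summable_comparison_test[of _ "\<lambda>n. (1/2) ^ n"]) (use \<alpha>_term in \<open>auto intro!: summable_geometric\<close>)

lemma \<alpha>_continuous: "continuous_on (\<Omega> - {w0}) \<alpha>"
proof -
  have "uniform_limit (\<Omega> - {w0}) (\<lambda>n w. \<Sum>i<n. (1/2) ^ i * min 1 (infdist (dense_seq i) (region w)))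
     (\<lambda>w. \<Sum>i. (1/2) ^ i * min 1 (infdist (dense_seq i) (region w))) sequentially"
    by (rule Weierstrass_m_test[OF \<alpha>_term]) (auto intro!: summable_geometric)
  then have "continuous_on (\<Omega> - {w0}) (\<lambda>w. \<Sum>i. (1/2) ^ i * min 1 (infdist (dense_seq i) (region w)))"
    by (rule uniform_limit_theorem[rotated])
       (auto intro!: always_eventually continuous_intros continuous_infdist_region)
  then show ?thesis by (simp add: \<alpha>_def[abs_def])
qed

text \<open>The series is at most 2, so 3 is a strict bound that can serve as the parameter
  \<open>M\<close> of \<open>planar_center\<close>.\<close>

lemma \<alpha>_bound: "\<alpha> w < 3"
proof -
  have "\<alpha> w \<le> (\<Sum>n. (1/2::real) ^ n)"
    unfolding \<alpha>_def
  proof (rule suminf_le[OF _ \<alpha>_summable])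
    show "(1/2::real) ^ n * min 1 (infdist (dense_seq n) (region w)) \<le> (1/2) ^ n" for n
      using \<alpha>_term[of n "dense_seq n" "region w"] unfolding real_norm_def by (rule abs_le_D1)
  qed (auto intro!: summable_geometric)
  also have "\<dots> = 2" by (simp add: suminf_geometric)
  finally show ?thesis by simp
qed

text \<open>Between the two curves lies a nonempty open set. A term of the dense sequence in it has
  distance 0 from \<open>region w\<close> and positive distance from
  \<open>region w'\<close>.\<close>

lemma \<alpha>_strict:
  assumes w: "w \<in> \<Omega> - {w0}" and w': "w' \<in> \<Omega> - {w0}" "w' \<in> region w"
  shows "\<alpha> w < \<alpha> w'"
proof -
  have sub: "region w' \<union> curve w' \<subseteq> region w" by (rule region_nest[OF assms])
  have ne: "region w' \<noteq> {}" using w0_region w' by blast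
  define f where "f n = (1/2::real) ^ n * min 1 (infdist (dense_seq n) (region w')) - (1/2) ^ n * min 1
      (infdist (dense_seq n) (region w))" for n
  have "open (region w \<inter> outside (curve w'))"
    using jordan(2)[OF w] jordan(9)[OF w'(1)] by (auto simp: region_def curve_def)
  moreover have "region w \<inter> outside (curve w') \<noteq> {}"
  proof -
    have "w' \<in> frontier (outside (curve w'))" using w_curve w'(1) jordan(7)[OF w'(1)] by (auto simp:
        curve_def)
    then have "w' \<in> closure (outside (curve w'))" by (simp add: frontier_def)
    moreover have "open (region w)" using jordan(2)[OF w] by (simp add: region_def curve_def)
    ultimately show ?thesis using w'(2) by (metis IntI closure_iff_nhds_not_empty disjoint_iff
        open_Int_closure_eq_empty)
  qed
  ultimately obtain n where n: "dense_seq n \<in> region w" "dense_seq n \<in> outside (curve w')" using dense_seq by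
      (metis IntE)
  have "closure (region w') = region w' \<union> curve w'"
    unfolding closure_Un_frontier using jordan(6)[OF w'(1)] by (simp add: region_def curve_def)
  then have "dense_seq n \<notin> closure (region w')" using n(2) jordan(4,5)[OF w'(1)] by blast
  then have pos: "infdist (dense_seq n) (region w') > 0"
    using in_closure_iff_infdist_zero[OF ne] infdist_nonneg by (metis less_eq_real_def)
  have "0 < suminf f"
  proof (rule suminf_pos2)
    show "summable f" unfolding f_def by (intro summable_diff \<alpha>_summable)
    show "0 \<le> f n" for n
      using infdist_mono[of "region w'" "region w" "dense_seq n"] sub ne by (auto simp: f_def intro!:
          mult_left_mono)
    show "0 < f n" using pos n(1) by (simp add: f_def)
  qed
  also have "suminf f = \<alpha> w' - \<alpha> w" unfolding f_def \<alpha>_def by (rule suminf_diff[symmetric]) (rule \<alpha>_summable)+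
  finally show ?thesis by simp
qed

lemma \<alpha>_curve: "w \<in> \<Omega> - {w0} \<Longrightarrow> w' \<in> curve w \<Longrightarrow> \<alpha> w' = \<alpha> w"
  using curve_cong[of w w'] by (simp add: \<alpha>_def region_def)

lemma \<alpha>_eq_iff:
  assumes "w \<in> \<Omega> - {w0}" "w' \<in> \<Omega> - {w0}" shows "\<alpha> w = \<alpha> w' \<longleftrightarrow> w' \<in> curve w"
proof
  assume eq: "\<alpha> w = \<alpha> w'"
  show "w' \<in> curve w"
  proof (rule ccontr)
    assume "w' \<notin> curve w"
    then have "w' \<in> region w \<or> w \<in> region w'" by (rule nested[OF assms])
    then show False using \<alpha>_strict[OF assms] \<alpha>_strict[OF assms(2,1)] eq by auto
  qed
qed (use \<alpha>_curve[OF assms(1)] in simp)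

lemma V_curve_iff:
  assumes "w \<in> \<Omega> - {w0}" shows "w' \<in> curve w \<longleftrightarrow> (\<exists>t. w' = V t w)"
  using curve_cong[OF assms] V_curve assms by blast

text \<open>An isolated point would be clopen, leaving no room for \<open>y0\<close> in the
  connected surface.\<close>

lemma w0_not_open: "\<not> openin X {q}"
proof
  assume o: "openin X {q}"
  have "closedin X {q}" using Hausdorff qt by (simp add: closedin_Hausdorff_singleton)
  then have "{q} = {} \<or> topspace X - {q} = {}" using o qt by (intro clopen_trivial) auto
  then have "y0 = q" using y0(1) by auto
  then show False using y0(2) q_sing by (simp add: periodic_point_def)
qed

lemma nbhd_point:
  assumes A: "openin X A" "q \<in> A"
  obtains w where "w \<in> \<Omega> - {w0}" "k w \<in> A"
proof -
  have "openin X (k ` \<Omega>)" unfolding \<Omega>_def by (rule open_disc[OF chart conv y0])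
  then have "openin X (A \<inter> k ` \<Omega>)" using A by blast
  moreover have "q \<in> A \<inter> k ` \<Omega>" using A kw0 w0_\<Omega> by (metis IntI image_eqI)
  ultimately have "A \<inter> k ` \<Omega> \<noteq> {q}" using w0_not_open by metis
  then have "\<exists>y\<in>A \<inter> k ` \<Omega>. y \<noteq> q" using \<open>q \<in> A \<inter> k ` \<Omega>\<close> by blast
  then obtain w where "w \<in> \<Omega>" "k w \<in> A" "k w \<noteq> q" by blast
  moreover from this have "w \<noteq> w0" using kw0 by auto
  ultimately show ?thesis using that by blast
qed

text \<open>Some invariant neighbourhood of \<open>q\<close> lies over the ball and contains the
  orbit of a point \<open>w\<close>. The ball is convex, so it also contains the region of
  \<open>w\<close>, and points with larger label lie in that region.\<close>

lemma shrinking: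
  assumes e: "e > 0"
  shows "\<exists>w\<in>\<Omega> - {w0}. \<forall>w'\<in>\<Omega> - {w0}. \<alpha> w < \<alpha> w' \<longrightarrow> dist w0 w' < e"
proof -
  have w0C: "w0 \<in> C" using w0_\<Omega> \<Omega>_C by blast
  have oC: "openin (top_of_set half_plane) C" using chart by (simp add: chart_def)
  then have "openin (top_of_set half_plane) (C \<inter> ball w0 e)" by (simp add: openin_Int_open)
  then have oN: "openin X (k ` (C \<inter> ball w0 e))" by (rule chart_open_k[OF chart]) blast
  have "q \<in> k ` (C \<inter> ball w0 e)" using w0C kw0 e by (metis IntI centre_in_ball image_eqI)
  then have "orbit v q \<subseteq> k ` (C \<inter> ball w0 e)" using singular_orbit[OF q_sing] by simp
  then obtain A where A: "openin X A" "invariant A" "q \<in> A" "A \<subseteq> k ` (C \<inter> ball w0 e)"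
    by (rule saturated_nbhdsD[OF sat qt oN])
  obtain w where w: "w \<in> \<Omega> - {w0}" "k w \<in> A" by (rule nbhd_point[OF A(1,3)])
  have "curve w \<subseteq> ball w0 e"
    using invariant_orbit[OF A(2) w(2)] A(4) chart_k(2)[OF chart] unfolding curve_def by force
  then have "- ball w0 e \<subseteq> outside (curve w)" by (rule outside_subset_convex[OF convex_ball])
  then have inn: "region w \<subseteq> ball w0 e" using jordan(4)[OF w(1)] by blast
  have "dist w0 w' < e" if w': "w' \<in> \<Omega> - {w0}" "\<alpha> w < \<alpha> w'" for w'
  proof -
    have "w' \<notin> curve w" using \<alpha>_curve[OF w(1)] w'(2) by force
    then have "w' \<in> region w" using nested[OF w(1) w'(1)] \<alpha>_strict[OF w'(1) w(1)] w'(2) by force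
    then show ?thesis using inn by auto
  qed
  then show ?thesis using w(1) by blast
qed

text \<open>A one-sided orbit cannot occur here: its connected collar would link \<open>q\<close>
  with \<open>y0\<close>, although the orbit separates them. So there is an annulus, whose
  transversal is carried to the plane by \<open>h\<close>.\<close>

lemma local_transversal:
  assumes w: "w \<in> \<Omega> - {w0}"
  shows "\<exists>(d::real) \<kappa>. d > 0 \<and> continuous_on {-d<..<d} \<kappa> \<and> \<kappa> ` {-d<..<d} \<subseteq> \<Omega> - {w0} \<and> \<kappa> 0 = w \<and>
      inj_on (\<lambda>s. \<alpha> (\<kappa> s)) {-d<..<d} \<and> continuous_on {-d<..<d} (\<lambda>s. period (k (\<kappa> s)))"
proof (rule one_or_two_sided[OF Y(1,2)[OF w]])
  fix A assume A: "openin X A" "invariant A" "k w \<in> A" "connectedin X (A - orbit v (k w))"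
  have qd: "q \<in> k ` inside (h ` orbit v (k w))" by (rule q_in_disc[OF Y[OF w]])
  have qO: "q \<in> topspace X - orbit v (k w)" using qd disc_disjoint[OF chart conv Y[OF w]] qt by blast
  have hy0: "h y0 \<notin> \<Omega>" using orbit_self[OF y0(1)] inner_outer(2)[OF chart conv y0] unfolding \<Omega>_def by blast
  have y0B: "y0 \<in> B" using orbit_self[OF y0(1)] y0(3) by blast
  have "y0 \<notin> orbit v (k w)" using hy0 orbit_k(2)[OF w] by (auto simp: curve_def)
  then have y0O: "y0 \<in> topspace X - orbit v (k w)" using y0(1) by blast
  have "linked (orbit v (k w)) q y0"
    by (rule connected_collar_linked[OF Y(1)[OF w] A(1) invariant_orbit[OF A(2,3)] A(4) qO y0O])
  then have "y0 \<in> k ` inside (h ` orbit v (k w))" using linked_disc[OF chart conv Y[OF w] qd y0O] by blast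
  then have "h y0 \<in> region w" using disc_iff[OF chart conv Y[OF w] y0B] by (simp add: region_def curve_def)
  then show ?thesis using hy0 orbit_k(2)[OF w] by blast
next
  fix d0 \<gamma> assume ts: "two_sided d0 \<gamma>" and \<gamma>0: "\<gamma> 0 = k w"
  have d0: "d0 > 0" and c\<gamma>: "continuous_map (top_of_set {-d0<..<d0}) X \<gamma>"
    and cper: "continuous_on {-d0<..<d0} (\<lambda>s. period (\<gamma> s))"
    and dist: "\<And>s s'. s \<in> {-d0<..<d0} \<Longrightarrow> s' \<in> {-d0<..<d0} \<Longrightarrow> \<gamma> s' \<in> orbit v (\<gamma> s) \<Longrightarrow> s = s'"
    using ts by (auto simp: two_sided_def)
  define G where "G = k ` \<Omega> - {q}"
  have "openin X (k ` \<Omega>)" unfolding \<Omega>_def by (rule open_disc[OF chart conv y0])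
  moreover have "closedin X {q}" using Hausdorff qt by (simp add: closedin_Hausdorff_singleton)
  ultimately have oG: "openin X G" unfolding G_def by (rule openin_diff)
  have "openin (top_of_set {-d0<..<d0}) {s \<in> {-d0<..<d0}. \<gamma> s \<in> G}"
    using openin_continuous_map_preimage[OF c\<gamma> oG] by simp
  moreover have "0 \<in> {s \<in> {-d0<..<d0}. \<gamma> s \<in> G}" using d0 \<gamma>0 w kq[OF w] by (auto simp: G_def)
  ultimately obtain r where r: "r > 0" "ball 0 r \<inter> {-d0<..<d0} \<subseteq> {s \<in> {-d0<..<d0}. \<gamma> s \<in> G}"
    unfolding openin_contains_ball by blast
  define d where "d = min r d0"
  have d: "d > 0" "{-d<..<d} \<subseteq> {-d0<..<d0}" using r d0 by (auto simp: d_def)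
  have inG: "\<gamma> s \<in> G" if "s \<in> {-d<..<d}" for s
  proof -
    have "s \<in> ball 0 r \<inter> {-d0<..<d0}" using that by (auto simp: d_def dist_real_def)
    then show ?thesis using r by blast
  qed
  define \<kappa> where "\<kappa> s = h (\<gamma> s)" for s
  have \<kappa>: "\<kappa> s \<in> \<Omega> - {w0}" "k (\<kappa> s) = \<gamma> s" if sd: "s \<in> {-d<..<d}" for s
  proof -
    obtain z where z: "z \<in> \<Omega>" "\<gamma> s = k z" "k z \<noteq> q" using inG[OF sd] by (auto simp: G_def)
    then have "z \<noteq> w0" using kw0 by auto
    then show "\<kappa> s \<in> \<Omega> - {w0}" "k (\<kappa> s) = \<gamma> s" using z k_in(4)[of z] by (auto simp: \<kappa>_def)
  qed
  have "continuous_map (top_of_set {-d<..<d}) X \<gamma>" by (rule continuous_map_from_subtopology_mono[OF c\<gamma> d(2)])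
  then have "continuous_map (top_of_set {-d<..<d}) euclidean \<kappa>"
    unfolding \<kappa>_def
  proof (rule chart_continuous_h[OF chart])
    fix s assume "s \<in> topspace (top_of_set {-d<..<d})"
    then have "\<gamma> s \<in> k ` \<Omega>" using inG by (auto simp: G_def)
    then obtain z where "z \<in> \<Omega>" "\<gamma> s = k z" by (rule imageE)
    then show "\<gamma> s \<in> B" using k_in(2) by simp
  qed
  then have 1: "continuous_on {-d<..<d} \<kappa>" by simp
  have "inj_on (\<lambda>s. \<alpha> (\<kappa> s)) {-d<..<d}"
  proof (rule inj_onI)
    fix s s' assume s: "s \<in> {-d<..<d}" "s' \<in> {-d<..<d}" "\<alpha> (\<kappa> s) = \<alpha> (\<kappa> s')"
    then have "\<kappa> s' \<in> curve (\<kappa> s)" using \<alpha>_eq_iff \<kappa>(1) by blast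
    then obtain x where x: "x \<in> orbit v (\<gamma> s)" "\<kappa> s' = h x" using \<kappa>(2)[OF s(1)] by (auto simp: curve_def)
    have "x \<in> B" using x(1) Y(3)[OF \<kappa>(1)[OF s(1)]] \<kappa>(2)[OF s(1)] by auto
    then have "x = \<gamma> s'" using x(2) \<kappa>(2)[OF s(2)] chart_h(2)[OF chart] by metis
    then show "s = s'" using dist x(1) s d(2) by blast
  qed
  moreover have "continuous_on {-d<..<d} (\<lambda>s. period (k (\<kappa> s)))"
    using continuous_on_eq[OF continuous_on_subset[OF cper d(2)]] \<kappa>(2) by simp
  moreover have "\<kappa> 0 = w" using \<gamma>0 k_in(4) w by (simp add: \<kappa>_def)
  moreover have "\<kappa> ` {-d<..<d} \<subseteq> \<Omega> - {w0}" using \<kappa>(1) by (intro image_subsetI)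
  ultimately show ?thesis using d(1) 1 by (intro exI[of _ d] exI[of _ \<kappa>] conjI)
qed

lemma planar_center: "planar_center \<Omega> w0 V (\<lambda>w. period (k w)) \<alpha> 3"
proof
  show "open \<Omega>" "connected \<Omega>" "w0 \<in> \<Omega>" by (rule open_\<Omega>, rule connected_\<Omega>, rule w0_\<Omega>)
  show "\<Omega> - {w0} \<noteq> {}" using nbhd_point[of "topspace X"] qt by blast
  have c: "continuous_map (top_of_set (UNIV \<times> \<Omega>)) X (\<lambda>p. k (snd p))"
    using \<Omega>_C by (intro chart_continuous_k[OF chart]) (auto intro: continuous_on_snd continuous_on_id)
  have "continuous_map (top_of_set (UNIV \<times> \<Omega>)) X (\<lambda>p. v (fst p) (k (snd p)))"
    by (rule continuous_flow[OF _ c]) (auto intro: continuous_on_fst continuous_on_id)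
  moreover have "v t (k w) \<in> B" if "w \<in> \<Omega>" for t w using V_\<Omega>[OF that, of t] k_in(2) by metis
  ultimately have "continuous_map (top_of_set (UNIV \<times> \<Omega>)) euclidean (\<lambda>p. h (v (fst p) (k (snd p))))"
    by (intro chart_continuous_h[OF chart]) auto
  then show "continuous_on (UNIV \<times> \<Omega>) (\<lambda>(t, w). V t w)" by (simp add: V_def case_prod_unfold)
  fix w assume w: "w \<in> \<Omega>"
  show "V s (V t w) = V (s + t) w" for s t
    using V_\<Omega>(2)[OF w] k_in(3)[OF w] by (simp add: V_def flow_flow)
next
  fix w assume w: "w \<in> \<Omega> - {w0}"
  then have w1: "w \<in> \<Omega>" by blast
  show "V t w \<in> \<Omega> - {w0}" for t using curve_cong[OF w V_curve[OF w1]] by blast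
  show "0 < period (k w)" by (rule period_pos[OF Y(1,2)[OF w]])
  show "V s w = V t w \<longleftrightarrow> (\<exists>i::int. t - s = of_int i * period (k w))" for s t
    using flow_same_iff[OF Y(1,2)[OF w], of s t] V_\<Omega>(2)[OF w1] by (metis V_def)
  show "period (k (V t w)) = period (k w)" for t using V_\<Omega>(2)[OF w1] period_orbit[OF Y(1)[OF w]] by simp
  show "\<alpha> w < 3" by (rule \<alpha>_bound)
  show "\<exists>(d::real) \<kappa>. d > 0 \<and> continuous_on {-d<..<d} \<kappa> \<and> \<kappa> ` {-d<..<d} \<subseteq> \<Omega> - {w0} \<and> \<kappa> 0 = w \<and>
      inj_on (\<lambda>s. \<alpha> (\<kappa> s)) {-d<..<d} \<and> continuous_on {-d<..<d} (\<lambda>s. period (k (\<kappa> s)))"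
    by (rule local_transversal[OF w])
  show "\<alpha> w = \<alpha> w' \<longleftrightarrow> (\<exists>t. w' = V t w)" if "w' \<in> \<Omega> - {w0}" for w'
    using \<alpha>_eq_iff[OF w that] V_curve_iff[OF w] by blast
qed (rule \<alpha>_continuous, rule shrinking)

text \<open>The polar coordinates \<open>g\<close> followed by \<open>k\<close> parametrise a
  neighbourhood of \<open>q\<close> by the disc. Invariance of domain makes the inverse of
  \<open>g\<close> continuous, and on a nonsingular orbit the time change is
  \<open>t \<mapsto> 2 * pi * t / P\<close>.\<close>

lemma center: "center X v q"
proof -
  interpret pc: planar_center \<Omega> w0 V "\<lambda>w. period (k w)" \<alpha> 3 by (rule planar_center)
  obtain g where g: "continuous_on (ball 0 1) g" "inj_on g (ball 0 1)" "g ` ball 0 1 \<subseteq> \<Omega>" "g 0 = w0"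
    and rot: "\<And>z. z \<in> ball 0 1 - {0} \<Longrightarrow> \<exists>P>0. \<forall>t. V t (g z) = g (exp (\<i> * of_real (2 * pi * t / P)) * z)"
    by (rule pc.polar_coordinates, rule that)
  obtain gi where gi: "homeomorphism (ball 0 1) (g ` ball 0 1) g gi"
    by (rule invariance_of_domain_homeomorphism[OF open_ball g(1) _ g(2)]) auto
  have og: "open (g ` ball 0 1)" by (rule invariance_of_domain[OF g(1) open_ball g(2)])
  have gC: "g ` ball 0 1 \<subseteq> C" using g(3) \<Omega>_C by blast
  define U where "U = k ` g ` ball 0 1"
  define H where "H y = gi (h y)" for y
  have oU: "openin X U" unfolding U_def by (rule chart_open_k'[OF chart og gC])
  have UB: "U \<subseteq> B" using gC chart_k(1)[OF chart] by (auto simp: U_def)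
  have tU: "topspace (subtopology X U) = U" using openin_subset[OF oU] by auto
  have H: "H (k (g z)) = z" if "z \<in> ball 0 1" for z
  proof -
    have "g z \<in> C" using gC that by blast
    then show ?thesis using that gi chart_k(2)[OF chart] by (simp add: H_def homeomorphism_def)
  qed
  have z_rot: "exp (\<i> * of_real t) * z \<in> ball 0 1" if "z \<in> ball 0 1" for t z using that by (simp add:
      norm_mult)
  have flow_g: "v t (k (g z)) = k (V t (g z))" if "z \<in> ball 0 1" for t z
    using V_\<Omega>(2)[OF subsetD[OF g(3) imageI[OF that]]] by simp
  have orb: "\<exists>\<tau>. strict_mono \<tau> \<and> surj \<tau> \<and> (\<forall>t. v t (k (g z)) = k (g (rot_flow (\<tau> t) z)))" if z: "z \<in> ball 0 1"
      for z
  proof (cases "z = 0")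
    case True
    have "v t (k (g 0)) = k (g (rot_flow t 0))" for t
      using q_sing by (simp add: g(4) kw0 rot_flow_def singular_point_def)
    then show ?thesis using True by (intro exI[of _ "\<lambda>t. t"]) (auto simp: strict_mono_def)
  next
    case False
    then obtain P where P: "P > 0" "\<forall>t. V t (g z) = g (exp (\<i> * of_real (2 * pi * t / P)) * z)" using rot z by
        blast
    define \<tau> where "\<tau> t = 2 * pi * t / P" for t
    have "strict_mono \<tau>" using P(1) by (auto simp: strict_mono_def \<tau>_def divide_strict_right_mono)
    moreover have "surj \<tau>"
    proof (rule surjI)
      show "\<tau> (x * P / (2 * pi)) = x" for x using P(1) by (simp add: \<tau>_def)
    qed
    moreover have "v t (k (g z)) = k (g (rot_flow (\<tau> t) z))" for t
      using flow_g[OF z, of t] P(2) by (simp add: rot_flow_def \<tau>_def)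
    ultimately show ?thesis by blast
  qed
  have cH: "continuous_map (subtopology X U) euclidean H"
  proof -
    have "continuous_map (subtopology X U) X (\<lambda>x. x)" by (simp add: continuous_map_from_subtopology)
    then have "continuous_map (subtopology X U) euclidean (\<lambda>y. h y)"
      using UB tU by (intro chart_continuous_h[OF chart]) auto
    moreover have "h y \<in> g ` ball 0 1" if "y \<in> U" for y
      using that gC chart_k(2)[OF chart] by (auto simp: U_def)
    ultimately have "continuous_map (subtopology X U) (top_of_set (g ` ball 0 1)) h"
      using tU by (auto simp: continuous_map_in_subtopology)
    moreover have "continuous_map (top_of_set (g ` ball 0 1)) euclidean gi"
      using gi by (simp add: homeomorphism_def)
    ultimately show ?thesis unfolding H_def using continuous_map_compose unfolding o_def by blast
  qed
  have "homeomorphic_maps (subtopology X U) (top_of_set (ball 0 1)) H (\<lambda>z. k (g z))"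
    unfolding homeomorphic_maps_def
  proof (intro conjI ballI)
    show "continuous_map (subtopology X U) (top_of_set (ball 0 1)) H"
      using cH H tU by (auto simp: continuous_map_in_subtopology U_def)
    have "continuous_map (top_of_set (ball 0 1)) X (\<lambda>z. k (g z))"
      using g(1) gC by (intro chart_continuous_k[OF chart]) auto
    then show "continuous_map (top_of_set (ball 0 1)) (subtopology X U) (\<lambda>z. k (g z))"
      by (auto simp: continuous_map_in_subtopology U_def)
    show "k (g (H x)) = x" if "x \<in> topspace (subtopology X U)" for x
      using that H unfolding tU U_def by auto
    show "H (k (g z)) = z" if "z \<in> topspace (top_of_set (ball 0 1))" for z using H that by simp
  qed
  then have hom: "homeomorphic_map (subtopology X U) (top_of_set (ball 0 1)) H"
    using homeomorphic_map_maps by blast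
  have "q \<in> U" using g(4) kw0 unfolding U_def by (metis centre_in_ball image_eqI zero_less_one)
  moreover have "v t y \<in> U" if "y \<in> U" for t y
  proof -
    obtain z where z: "z \<in> ball 0 1" "y = k (g z)" using \<open>y \<in> U\<close> by (auto simp: U_def)
    obtain \<tau> where "v t y = k (g (rot_flow (\<tau> t) z))" using orb[OF z(1)] z(2) by blast
    then show ?thesis using z_rot[OF z(1)] unfolding U_def rot_flow_def by blast
  qed
  moreover have "\<exists>\<tau>. strict_mono \<tau> \<and> surj \<tau> \<and> (\<forall>t. H (v t y) = rot_flow (\<tau> t) (H y))" if "y \<in> U" for y
  proof -
    obtain z where z: "z \<in> ball 0 1" "y = k (g z)" using \<open>y \<in> U\<close> by (auto simp: U_def)
    obtain \<tau> where \<tau>: "strict_mono \<tau>" "surj \<tau>" "\<And>t. v t y = k (g (rot_flow (\<tau> t) z))" using orb[OF z(1)] z(2)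
        by blast
    have "H (v t y) = rot_flow (\<tau> t) (H y)" for t
      using \<tau>(3) H[OF z(1)] H[OF z_rot[OF z(1)]] z(2) by (simp add: rot_flow_def)
    then show ?thesis using \<tau> by blast
  qed
  ultimately show ?thesis
    unfolding center_def using qt q_sing oU hom by (intro conjI exI[of _ U] exI[of _ H] ballI allI)
qed

end

context hausdorff_flow
begin

text \<open>The singular set is finite, so some chart around \<open>q\<close> contains no other
  singular point. An invariant neighbourhood in that chart contains a periodic point, since
  otherwise \<open>q\<close> would be isolated and hence all of \<open>X\<close>.\<close>

lemma singular_center:
  assumes ne: "singular_set X v \<noteq> topspace X" and q: "q \<in> singular_set X v"
  shows "center X v q"
proof -
  have qt: "q \<in> topspace X" "singular_point v q" using q by (auto simp: singular_set_def)
  have "finite (singular_set X v - {q})" using singular_card[OF ne] by blast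
  moreover have "singular_set X v \<subseteq> topspace X" by (auto simp: singular_set_def)
  ultimately have "closedin X (singular_set X v - {q})"
    using Hausdorff closedin_Hausdorff_finite by blast
  then have oN: "openin X (topspace X - (singular_set X v - {q}))" by blast
  have qN: "q \<in> topspace X - (singular_set X v - {q})" using qt by blast
  obtain B h k r where B: "r > 0" "chart B h k (ball (h q) r \<inter> half_plane)" "q \<in> B"
      "B \<subseteq> topspace X - (singular_set X v - {q})"
    by (rule disc_chart[OF oN qN])
  have only: "x = q" if "x \<in> B" "singular_point v x" for x
    using that B(4) by (auto simp: singular_set_def)
  have "orbit v q \<subseteq> B" using B(3) singular_orbit[OF qt(2)] by simp
  then obtain A where A: "openin X A" "invariant A" "q \<in> A" "A \<subseteq> B"
    by (rule saturated_nbhdsD[OF sat qt(1) chart_openin[OF B(2)]])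
  have "\<exists>y\<in>A. periodic_point v y"
  proof (rule ccontr)
    assume n: "\<not> ?thesis"
    have "y = q" if "y \<in> A" for y
      using that n periodic_iff[of y] openin_subset[OF A(1)] A(4) only by blast
    then have "openin X {q}" using A(1,3) by (metis empty_iff insertI1 insert_iff subsetI subset_antisym)
    moreover have "closedin X {q}" using Hausdorff qt by (simp add: closedin_Hausdorff_singleton)
    ultimately have "{q} = {} \<or> topspace X - {q} = {}" using qt by (intro clopen_trivial) auto
    then show False using ne q by (auto simp: singular_set_def)
  qed
  then obtain y0 where y0: "y0 \<in> A" "periodic_point v y0" by blast
  have y0': "y0 \<in> topspace X" "orbit v y0 \<subseteq> B"
    using y0(1) openin_subset[OF A(1)] invariant_orbit[OF A(2) y0(1)] A(4) by blast+
  interpret singular_disc X v q B h k "ball (h q) r \<inter> half_plane" y0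
  proof
    show "convex (ball (h q) r \<inter> half_plane)" by (intro convex_Int convex_ball convex_half_plane)
  qed (rule B(2) B(3) qt(2) only y0'(1) y0(2) y0'(2); assumption?)+
  show ?thesis by (rule center)
qed

end

theorem theoremD:
  fixes X :: "'a topology" and v :: "real \<Rightarrow> 'a \<Rightarrow> 'a"
  assumes "surface X" and "compact_space X" and "connected_space X"
    and "flow X v"
  shows "Hausdorff_space (orbit_space X v) \<longleftrightarrow>
           (\<forall>x\<in>topspace X. closed_point v x) \<and>
           (singular_set X v = topspace X \<or>
            (finite (singular_set X v) \<and> card (singular_set X v) \<le> 2 \<and>
             (\<forall>x\<in>singular_set X v. center X v x)))"
proof -
  interpret surface_flow X v by (rule surface_flow.intro[OF assms])
  show ?thesis
  proof (intro iffI)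
    assume T2: "Hausdorff_space (orbit_space X v)"
    have cl: "closed_point v x" if "x \<in> topspace X" for x
      using closed_orbit_imp_closed_point[OF that Hausdorff_imp_closed_orbit[OF T2 that]] .
    interpret hausdorff_flow X v
    proof
      show "closed_point v x" if "x \<in> topspace X" for x by (rule cl[OF that])
      show saturated_nbhds by (rule Hausdorff_imp_saturated_nbhds[OF T2])
    qed
    show "(\<forall>x\<in>topspace X. closed_point v x) \<and>
           (singular_set X v = topspace X \<or>
            (finite (singular_set X v) \<and> card (singular_set X v) \<le> 2 \<and>
             (\<forall>x\<in>singular_set X v. center X v x)))"
      using cl singular_card singular_center by blast
  next
    assume R: "(\<forall>x\<in>topspace X. closed_point v x) \<and>
           (singular_set X v = topspace X \<or>
            (finite (singular_set X v) \<and> card (singular_set X v) \<le> 2 \<and>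
             (\<forall>x\<in>singular_set X v. center X v x)))"
    interpret closed_flow X v
    proof
      show "closed_point v x" if "x \<in> topspace X" for x using R that by blast
    qed
    have saturated_nbhds by (rule singular_imp_saturated_nbhds) (use R in blast)
    then show "Hausdorff_space (orbit_space X v)"
      by (intro saturated_nbhds_imp_Hausdorff closed_points)
  qed
qed

end
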